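(* Let $r\ge 0$, let $\Omega\subset\mathbb{R}^n$ be a bounded domain satisfying an exterior cone condition, and let $g\in C(\partial\Omega)$. Then there exists a unique $u\in C(\overline\Omega)$ which is a viscosity solution of $$\begin{cases}\min(-\Delta u-r,\ |Du|-1)=0&\text{in }\Omega,\\ u=g&\text{on }\partial\Omega.\end{cases}$$ Moreover, if the exterior cone condition is uniform, then the solution $u$ has a modulus of continuity on $\overline\Omega$ depending only on $r$, $\mathrm{diam}\,\Omega$, the modulus of continuity of $g$, and the parameters (radius and angle) of the uniform exterior cone condition (in the fixed dimension $n$).
   Context: $B_\rho(x_0)$ is the open ball of radius $\rho$ centred at $x_0$. Exterior cone condition: for every $y\in\partial\Omega$ there are an angle $\theta\in(0,\pi/2)$, a radius $\rho>0$ and a unit vector $e$ such that, with $C=\{x\in\mathbb{R}^n:\ x\cdot e\ge |x|\cos\theta\}$, one has $\big((y+C)\cap B_\rho(y)\big)\setminus\{y\}\subset\mathbb{R}^n\setminus\overline\Omega$. The condition is uniform if $\theta$ and $\rho$ can be chosen independent of $y\in\partial\Omega$. Viscosity solutions. A lower semicontinuous $u:\Omega\to\mathbb{R}$ is a viscosity super-solution, i.e. $\min(-\Delta u-r,|Du|-1)\ge 0$ in $\Omega$, if for every ball $B_\rho(x_0)\subset\Omega$ and every $\varphi\in C^\infty(B_\rho(x_0))$ with $\min_{B_\rho(x_0)}(u-\varphi)=(u-\varphi)(x_0)=0$ one has $\min(-\Delta\varphi(x_0)-r,|D\varphi(x_0)|-1)\ge 0$. An upper semicontinuous $u:\Omega\to\mathbb{R}$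 is a viscosity sub-solution if for every ball $B_\rho(x_0)\subset\Omega$ and every $\varphi\in C^\infty(B_\rho(x_0))$ with $\max_{B_\rho(x_0)}(u-\varphi)=(u-\varphi)(x_0)=0$ one has $\min(-\Delta\varphi(x_0)-r,|D\varphi(x_0)|-1)\le 0$. A viscosity solution is a continuous function that is both a super- and a sub-solution. *)

theory Defs
  imports "HOL-Analysis.Analysis"
begin

section \<open>Smooth functions and differential operators\<close>

definition partial :: "'a::euclidean_space \<Rightarrow> ('a \<Rightarrow> real) \<Rightarrow> 'a \<Rightarrow> real" where
  "partial b f x = frechet_derivative f (at x) b"

text \<open>The derivatives are full derivatives at the points of \<open>S\<close>, so the next two
  definitions are meant for open sets \<open>S\<close> only. The values of \<open>f\<close> outside \<open>S\<close> are then irrelevant.\<close>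

primrec Ck_on :: "nat \<Rightarrow> 'a::euclidean_space set \<Rightarrow> ('a \<Rightarrow> real) \<Rightarrow> bool" where
  "Ck_on 0 S f \<longleftrightarrow> continuous_on S f"
| "Ck_on (Suc k) S f \<longleftrightarrow>
     (\<forall>x\<in>S. f differentiable (at x)) \<and> (\<forall>b\<in>Basis. Ck_on k S (partial b f))"

definition smooth_on :: "'a::euclidean_space set \<Rightarrow> ('a \<Rightarrow> real) \<Rightarrow> bool" where
  "smooth_on S f \<longleftrightarrow> (\<forall>k. Ck_on k S f)"

definition grad :: "('a::euclidean_space \<Rightarrow> real) \<Rightarrow> 'a \<Rightarrow> 'a" where
  "grad f x = (\<Sum>b\<in>Basis. partial b f x *\<^sub>R b)"

definition laplacian :: "('a::euclidean_space \<Rightarrow> real) \<Rightarrow> 'a \<Rightarrow> real" where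
  "laplacian f x = (\<Sum>b\<in>Basis. partial b (partial b f) x)"

section \<open>Domains and exterior cones\<close>

definition bounded_domain :: "'a::euclidean_space set \<Rightarrow> bool" where
  "bounded_domain \<Omega> \<longleftrightarrow> \<Omega> \<noteq> {} \<and> open \<Omega> \<and> connected \<Omega> \<and> bounded \<Omega>"

definition circular_cone :: "real \<Rightarrow> 'a::euclidean_space \<Rightarrow> 'a set" where
  "circular_cone \<theta> e = {x. x \<bullet> e \<ge> norm x * cos \<theta>}"

definition exterior_cone_at :: "real \<Rightarrow> real \<Rightarrow> 'a::euclidean_space set \<Rightarrow> 'a \<Rightarrow> bool" where
  "exterior_cone_at \<theta> \<rho> \<Omega> y \<longleftrightarrow> 0 < \<theta> \<and> \<theta> < pi / 2 \<and> 0 < \<rho> \<and>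
     (\<exists>e. norm e = 1 \<and> ((+) y ` circular_cone \<theta> e) \<inter> ball y \<rho> - {y} \<subseteq> - closure \<Omega>)"

definition exterior_cone_condition :: "'a::euclidean_space set \<Rightarrow> bool" where
  "exterior_cone_condition \<Omega> \<longleftrightarrow> (\<forall>y\<in>frontier \<Omega>. \<exists>\<theta> \<rho>. exterior_cone_at \<theta> \<rho> \<Omega> y)"

definition uniform_exterior_cone_condition :: "real \<Rightarrow> real \<Rightarrow> 'a::euclidean_space set \<Rightarrow> bool" where
  "uniform_exterior_cone_condition \<theta> \<rho> \<Omega> \<longleftrightarrow> (\<forall>y\<in>frontier \<Omega>. exterior_cone_at \<theta> \<rho> \<Omega> y)"

section \<open>Viscosity solutions\<close>

definition lsc_on :: "'a::euclidean_space set \<Rightarrow> ('a \<Rightarrow> real) \<Rightarrow> bool" where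
  "lsc_on S u \<longleftrightarrow> (\<forall>x\<in>S. \<forall>a<u x. \<forall>\<^sub>F y in at x within S. a < u y)"

definition usc_on :: "'a::euclidean_space set \<Rightarrow> ('a \<Rightarrow> real) \<Rightarrow> bool" where
  "usc_on S u \<longleftrightarrow> (\<forall>x\<in>S. \<forall>a>u x. \<forall>\<^sub>F y in at x within S. u y < a)"

definition pde_op :: "real \<Rightarrow> ('a::euclidean_space \<Rightarrow> real) \<Rightarrow> 'a \<Rightarrow> real" where
  "pde_op r \<phi> x = min (- laplacian \<phi> x - r) (norm (grad \<phi> x) - 1)"

definition viscosity_supersolution ::
    "real \<Rightarrow> 'a::euclidean_space set \<Rightarrow> ('a \<Rightarrow> real) \<Rightarrow> bool" where
  "viscosity_supersolution r \<Omega> u \<longleftrightarrow> lsc_on \<Omega> u \<and>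
     (\<forall>x0 \<rho> \<phi>. 0 < \<rho> \<and> ball x0 \<rho> \<subseteq> \<Omega> \<and> smooth_on (ball x0 \<rho>) \<phi> \<and>
        u x0 - \<phi> x0 = 0 \<and> (\<forall>x\<in>ball x0 \<rho>. u x0 - \<phi> x0 \<le> u x - \<phi> x)
        \<longrightarrow> pde_op r \<phi> x0 \<ge> 0)"

definition viscosity_subsolution ::
    "real \<Rightarrow> 'a::euclidean_space set \<Rightarrow> ('a \<Rightarrow> real) \<Rightarrow> bool" where
  "viscosity_subsolution r \<Omega> u \<longleftrightarrow> usc_on \<Omega> u \<and>
     (\<forall>x0 \<rho> \<phi>. 0 < \<rho> \<and> ball x0 \<rho> \<subseteq> \<Omega> \<and> smooth_on (ball x0 \<rho>) \<phi> \<and>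
        u x0 - \<phi> x0 = 0 \<and> (\<forall>x\<in>ball x0 \<rho>. u x - \<phi> x \<le> u x0 - \<phi> x0)
        \<longrightarrow> pde_op r \<phi> x0 \<le> 0)"

definition viscosity_solution ::
    "real \<Rightarrow> 'a::euclidean_space set \<Rightarrow> ('a \<Rightarrow> real) \<Rightarrow> bool" where
  "viscosity_solution r \<Omega> u \<longleftrightarrow> continuous_on \<Omega> u \<and>
     viscosity_supersolution r \<Omega> u \<and> viscosity_subsolution r \<Omega> u"

definition solves_dirichlet_problem ::
    "real \<Rightarrow> 'a::euclidean_space set \<Rightarrow> ('a \<Rightarrow> real) \<Rightarrow> ('a \<Rightarrow> real) \<Rightarrow> bool" where
  "solves_dirichlet_problem r \<Omega> g u \<longleftrightarrow> continuous_on (closure \<Omega>) u \<and>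
     viscosity_solution r \<Omega> u \<and> (\<forall>x\<in>frontier \<Omega>. u x = g x)"

section \<open>Moduli of continuity\<close>

text \<open>Only the values of \<open>\<omega>\<close> on \<open>[0, \<infinity>)\<close> matter.\<close>

definition modulus :: "(real \<Rightarrow> real) \<Rightarrow> bool" where
  "modulus \<omega> \<longleftrightarrow> \<omega> 0 = 0 \<and> mono_on {0..} \<omega> \<and> (\<omega> \<longlongrightarrow> 0) (at_right 0)"

definition has_modulus_on :: "'a::metric_space set \<Rightarrow> ('a \<Rightarrow> real) \<Rightarrow> (real \<Rightarrow> real) \<Rightarrow> bool" where
  "has_modulus_on S f \<omega> \<longleftrightarrow> (\<forall>x\<in>S. \<forall>y\<in>S. \<bar>f x - f y\<bar> \<le> \<omega> (dist x y))"

end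

theory Submission
  imports Defs
begin

text \<open>Uniqueness and both continuity statements rest on a comparison principle (lemma \<open>comparison\<close>): a
continuous subsolution lies below a continuous supersolution, up to a constant, if it does so on the
boundary. Existence is Perron's method, with barriers at the exterior cones.

\<^bold>\<open>Comparison.\<close> If \<open>w\<close> is a supersolution then \<open>(1 + \<kappa>) w - \<eta> |x|\<^sup>2\<close>, with \<open>\<eta>\<close> small compared to \<open>\<kappa>\<close>, is
a strict one: its tests have slope above one and Laplacian below \<open>- r\<close> by a margin. Against such a
function, maximise \<open>v y - w z - k/2 |y - z|\<^sup>2\<close>. The test of \<open>w\<close> at the maximizer shows that the slope
there exceeds one, so the gradient alternative in the definition of a subsolution is excluded. To
conclude this also at nearby points, pass to the sup-convolution \<open>V\<close> of \<open>v\<close> and the inf-convolution of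
\<open>w\<close>: all slopes of \<open>V\<close> near the midpoint of the maximizing pair are close to the slope there. Hence
near that point \<open>V\<close> satisfies \<open>- \<Delta>V \<le> r\<close> and the inf-convolution satisfies a strictly larger lower
bound, while their difference has an interior maximum. This contradicts lemma \<open>no_interior_max\<close>,
which concerns Poisson's equation only.

\<^bold>\<open>Poisson's equation.\<close> Both functions are compared on a ball with explicit smooth functions,
polynomials of constant Laplacian with nearly the right values on the sphere. Such polynomials exist
because polynomials are dense in the continuous functions on the sphere, and because every
polynomial agrees on the sphere with a harmonic one (lemma \<open>harmonic_polynomial_extension\<close>). This
replaces Poisson integrals, measure theory and the theorem on sums for semicontinuous functions.

\<^bold>\<open>Barriers.\<close> Off a circular cone, \<open>|x|\<^sup>\<alpha> (K - exp (\<beta> cos \<angle>(x, e)))\<close> is strictly superharmonic for suitable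
\<open>\<alpha>\<close>, \<open>\<beta>\<close>, \<open>K\<close>. The minimum of a large multiple of it with a concave paraboloid is a global supersolution
whose size depends on the cone parameters, the diameter and \<open>r\<close> only (lemma \<open>barrier_exists\<close>). Since
\<open>r \<ge> 0\<close>, the negative of a supersolution is a subsolution, so the same function serves from below.

\<^bold>\<open>Existence.\<close> Let \<open>u\<close> be the supremum of all continuous subsolutions below \<open>g\<close> on the boundary. The
barriers control this family uniformly near the boundary. The equation is invariant under
translations and under adding constants; so the maximum of a member and a translate of it, lowered
by a small constant, is again a member (lemma \<open>perron_class_shift\<close>). Therefore \<open>u\<close> is uniformly
continuous, and no semicontinuous envelopes are needed. That \<open>u\<close> is a sub- and a supersolution is then the
usual argument with a strict test function and with a bump.

\<^bold>\<open>Modulus.\<close> The barriers bound \<open>|u x - u y|\<close> for boundary points \<open>y\<close>, uniformly in the data.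
Comparing \<open>u\<close> with its translates on \<open>\<Omega> \<inter> (\<Omega> - h)\<close> carries the bound to all pairs of points, and the supremum
of the oscillations of all solutions with the given data is the required modulus.\<close>

section \<open>Second-order calculus\<close>

text \<open>Second-order data at one point: near \<open>x\<close> the function has a gradient field, which is differentiable
at \<open>x\<close>; \<open>p\<close> is its value and \<open>L\<close> the trace of its derivative. Stated with a witness for
the field, the sum, product and chain rules become introduction rules, whereas \<open>grad\<close> and
\<open>laplacian\<close> are total functions whose values say nothing about differentiability.\<close>

definition has_grad_lap :: "('a::euclidean_space \<Rightarrow> real) \<Rightarrow> 'a \<Rightarrow> 'a \<Rightarrow> real \<Rightarrow> bool" where
  "has_grad_lap f x p L \<longleftrightarrow>
     (\<exists>G A. (\<forall>\<^sub>F y in nhds x. (f has_derivative (\<lambda>h. G y \<bullet> h)) (at y)) \<and> G x = p \<and>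
            (G has_derivative A) (at x) \<and> L = (\<Sum>b\<in>Basis. A b \<bullet> b))"

lemma has_grad_lapE:
  assumes "has_grad_lap f x p L"
  obtains G A where "\<forall>\<^sub>F y in nhds x. (f has_derivative (\<lambda>h. G y \<bullet> h)) (at y)" "G x = p"
    "(G has_derivative A) (at x)" "L = (\<Sum>b\<in>Basis. A b \<bullet> b)"
  using assms unfolding has_grad_lap_def by blast

lemma has_grad_lapI:
  assumes "\<forall>\<^sub>F y in nhds x. (f has_derivative (\<lambda>h. G y \<bullet> h)) (at y)" "G x = p"
    "(G has_derivative A) (at x)" "L = (\<Sum>b\<in>Basis. A b \<bullet> b)"
  shows "has_grad_lap f x p L"
  using assms unfolding has_grad_lap_def by blast

lemma has_grad_lap_cong:
  assumes "has_grad_lap f x p L" "p = q" "L = M" shows "has_grad_lap f x q M"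
  using assms by simp

lemma has_grad_lap_const: "has_grad_lap (\<lambda>x. c) x 0 0"
  by (rule has_grad_lapI[where G="\<lambda>_. 0" and A="\<lambda>_. 0"]) auto

lemma has_grad_lap_inner: "has_grad_lap (\<lambda>x. x \<bullet> e) x e 0"
  by (rule has_grad_lapI[where G="\<lambda>_. e" and A="\<lambda>_. 0"])
    (auto intro!: always_eventually derivative_eq_intros simp: inner_commute)

lemma has_grad_lap_add:
  assumes "has_grad_lap f x p L" "has_grad_lap g x q M"
  shows "has_grad_lap (\<lambda>y. f y + g y) x (p + q) (L + M)"
proof -
  obtain G A where 1: "\<forall>\<^sub>F y in nhds x. (f has_derivative (\<lambda>h. G y \<bullet> h)) (at y)" "G x = p"
    "(G has_derivative A) (at x)" "L = (\<Sum>b\<in>Basis. A b \<bullet> b)"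
    using assms(1) by (rule has_grad_lapE)
  obtain H B where 2: "\<forall>\<^sub>F y in nhds x. (g has_derivative (\<lambda>h. H y \<bullet> h)) (at y)" "H x = q"
    "(H has_derivative B) (at x)" "M = (\<Sum>b\<in>Basis. B b \<bullet> b)"
    using assms(2) by (rule has_grad_lapE)
  show ?thesis
  proof (rule has_grad_lapI)
    show "\<forall>\<^sub>F y in nhds x. ((\<lambda>y. f y + g y) has_derivative (\<lambda>h. (G y + H y) \<bullet> h)) (at y)"
      using 1(1) 2(1) by eventually_elim (auto intro!: derivative_eq_intros simp: inner_add_left)
    show "((\<lambda>y. G y + H y) has_derivative (\<lambda>h. A h + B h)) (at x)"
      using 1 2 by (auto intro!: derivative_eq_intros)
  qed (use 1 2 in \<open>auto simp: inner_add_left sum.distrib\<close>)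
qed

lemma has_grad_lap_mult:
  assumes "has_grad_lap f x p L" "has_grad_lap g x q M"
  shows "has_grad_lap (\<lambda>y. f y * g y) x (f x *\<^sub>R q + g x *\<^sub>R p) (f x * M + g x * L + 2 * (p \<bullet> q))"
proof -
  obtain G A where 1: "\<forall>\<^sub>F y in nhds x. (f has_derivative (\<lambda>h. G y \<bullet> h)) (at y)" "G x = p"
    "(G has_derivative A) (at x)" "L = (\<Sum>b\<in>Basis. A b \<bullet> b)"
    using assms(1) by (rule has_grad_lapE)
  obtain H B where 2: "\<forall>\<^sub>F y in nhds x. (g has_derivative (\<lambda>h. H y \<bullet> h)) (at y)" "H x = q"
    "(H has_derivative B) (at x)" "M = (\<Sum>b\<in>Basis. B b \<bullet> b)"
    using assms(2) by (rule has_grad_lapE)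
  have f: "(f has_derivative (\<lambda>h. G x \<bullet> h)) (at x)" and g: "(g has_derivative (\<lambda>h. H x \<bullet> h)) (at x)"
    using 1(1) 2(1) eventually_nhds_x_imp_x by blast+
  show ?thesis
  proof (rule has_grad_lapI)
    show "\<forall>\<^sub>F y in nhds x. ((\<lambda>y. f y * g y) has_derivative (\<lambda>h. (f y *\<^sub>R H y + g y *\<^sub>R G y) \<bullet> h)) (at y)"
      using 1(1) 2(1)
      by eventually_elim (auto intro!: derivative_eq_intros simp: inner_add_left algebra_simps)
    show "((\<lambda>y. f y *\<^sub>R H y + g y *\<^sub>R G y) has_derivative
            (\<lambda>h. (f x *\<^sub>R B h + (G x \<bullet> h) *\<^sub>R H x) + (g x *\<^sub>R A h + (H x \<bullet> h) *\<^sub>R G x))) (at x)"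
      by (rule has_derivative_add has_derivative_scaleR f g 1 2)+
    have "(\<Sum>b\<in>Basis. (f x *\<^sub>R B b + (G x \<bullet> b) *\<^sub>R H x + (g x *\<^sub>R A b + (H x \<bullet> b) *\<^sub>R G x)) \<bullet> b)
       = f x * (\<Sum>b\<in>Basis. B b \<bullet> b) + g x * (\<Sum>b\<in>Basis. A b \<bullet> b) + 2 * (\<Sum>b\<in>Basis. (G x \<bullet> b) * (H x \<bullet> b))"
      by (simp add: inner_add_left sum.distrib sum_distrib_left algebra_simps)
    then show "f x * M + g x * L + 2 * (p \<bullet> q) = (\<Sum>b\<in>Basis. (f x *\<^sub>R B b + (G x \<bullet> b) *\<^sub>R H x + (g x *\<^sub>R A b + (H x \<bullet> b) *\<^sub>R G x)) \<bullet> b)"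
      using 1 2 by (simp add: euclidean_inner[of p q])
  qed (use 1 2 in simp)
qed

lemma has_grad_lap_cmult:
  assumes "has_grad_lap f x p L"
  shows "has_grad_lap (\<lambda>y. c * f y) x (c *\<^sub>R p) (c * L)"
  using has_grad_lap_mult[OF has_grad_lap_const[of c x] assms] by simp

lemma has_grad_lap_diff:
  assumes "has_grad_lap f x p L" "has_grad_lap g x q M"
  shows "has_grad_lap (\<lambda>y. f y - g y) x (p - q) (L - M)"
  using has_grad_lap_add[OF assms(1) has_grad_lap_cmult[OF assms(2), of "-1"]] by simp

lemma has_grad_lap_compose:
  assumes f: "has_grad_lap f x p L"
    and \<phi>: "\<forall>\<^sub>F s in nhds (f x). (\<phi> has_real_derivative \<phi>' s) (at s)"
    and \<phi>': "(\<phi>' has_real_derivative c) (at (f x))"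
  shows "has_grad_lap (\<lambda>y. \<phi> (f y)) x (\<phi>' (f x) *\<^sub>R p) (\<phi>' (f x) * L + c * (p \<bullet> p))"
proof -
  obtain G A where 1: "\<forall>\<^sub>F y in nhds x. (f has_derivative (\<lambda>h. G y \<bullet> h)) (at y)" "G x = p"
    "(G has_derivative A) (at x)" "L = (\<Sum>b\<in>Basis. A b \<bullet> b)"
    using f by (rule has_grad_lapE)
  have f: "(f has_derivative (\<lambda>h. G x \<bullet> h)) (at x)"
    using 1(1) eventually_nhds_x_imp_x by blast
  have "isCont f x" using f has_derivative_continuous by blast
  then have "filterlim f (nhds (f x)) (nhds x)"
    by (simp add: continuous_at_imp_continuous_at_within isCont_def tendsto_at_iff_tendsto_nhds)
  then have 2: "\<forall>\<^sub>F y in nhds x. (\<phi> has_real_derivative \<phi>' (f y)) (at (f y))"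
    using \<phi> by (rule eventually_compose_filterlim[rotated])
  show ?thesis
  proof (rule has_grad_lapI)
    show "\<forall>\<^sub>F y in nhds x. ((\<lambda>y. \<phi> (f y)) has_derivative (\<lambda>h. (\<phi>' (f y) *\<^sub>R G y) \<bullet> h)) (at y)"
      using 1(1) 2
    proof eventually_elim
      case (elim y)
      from DERIV_compose_FDERIV[OF elim(2,1)] show ?case by (simp add: mult.commute)
    qed
    have "((\<lambda>y. \<phi>' (f y)) has_derivative (\<lambda>h. c * (G x \<bullet> h))) (at x)"
      using DERIV_compose_FDERIV[OF \<phi>' f] by (simp add: mult.commute)
    then show "((\<lambda>y. \<phi>' (f y) *\<^sub>R G y) has_derivative
        (\<lambda>h. \<phi>' (f x) *\<^sub>R A h + (c * (G x \<bullet> h)) *\<^sub>R G x)) (at x)"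
      by (rule has_derivative_scaleR) (rule 1)
    have "(\<Sum>b\<in>Basis. (\<phi>' (f x) *\<^sub>R A b + (c * (G x \<bullet> b)) *\<^sub>R G x) \<bullet> b)
       = \<phi>' (f x) * (\<Sum>b\<in>Basis. A b \<bullet> b) + c * (\<Sum>b\<in>Basis. (G x \<bullet> b) * (G x \<bullet> b))"
      by (simp add: inner_add_left sum.distrib sum_distrib_left algebra_simps)
    then show "\<phi>' (f x) * L + c * (p \<bullet> p) = (\<Sum>b\<in>Basis. (\<phi>' (f x) *\<^sub>R A b + (c * (G x \<bullet> b)) *\<^sub>R G x) \<bullet> b)"
      using 1 by (simp add: euclidean_inner[of p p])
  qed (use 1 in simp)
qed

lemma has_grad_lap_translate:
  assumes "has_grad_lap f (x + a) p L"
  shows "has_grad_lap (\<lambda>y. f (y + a)) x p L"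
proof -
  obtain G A where 1: "\<forall>\<^sub>F y in nhds (x + a). (f has_derivative (\<lambda>h. G y \<bullet> h)) (at y)" "G (x + a) = p"
    "(G has_derivative A) (at (x + a))" "L = (\<Sum>b\<in>Basis. A b \<bullet> b)"
    using assms by (rule has_grad_lapE)
  have t: "((\<lambda>y. y + a) has_derivative (\<lambda>h. h)) (at y)" for y
    by (auto intro!: derivative_eq_intros)
  have "filterlim (\<lambda>y. y + a) (nhds (x + a)) (nhds x)"
    by (intro tendsto_add filterlim_ident tendsto_const)
  then have "\<forall>\<^sub>F y in nhds x. (f has_derivative (\<lambda>h. G (y + a) \<bullet> h)) (at (y + a))"
    using 1(1) by (rule eventually_compose_filterlim[rotated])
  then have "\<forall>\<^sub>F y in nhds x. ((\<lambda>y. f (y + a)) has_derivative (\<lambda>h. G (y + a) \<bullet> h)) (at y)"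
    by eventually_elim (rule has_derivative_compose[OF t])
  then show ?thesis
    by (rule has_grad_lapI) (use 1 has_derivative_compose[OF t 1(3)] in auto)
qed

lemma has_grad_lap_dot_self: "has_grad_lap (\<lambda>x::'a::euclidean_space. x \<bullet> x) x (2 *\<^sub>R x) (2 * DIM('a))"
  by (rule has_grad_lapI[where G="\<lambda>x. 2 *\<^sub>R x" and A="\<lambda>h. 2 *\<^sub>R h"])
    (auto intro!: always_eventually derivative_eq_intros simp: inner_commute)

text \<open>The one-variable second derivative test along each coordinate direction suffices, since the
Laplacian only involves the diagonal of the Hessian.\<close>

lemma has_grad_lap_local_min_0:
  fixes f :: "'a::euclidean_space \<Rightarrow> real"
  assumes f: "has_grad_lap f x p L" and min: "\<forall>\<^sub>F y in nhds x. f x \<le> f y"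
  shows "p = 0" "L \<ge> 0"
proof -
  obtain G A where 1: "\<forall>\<^sub>F y in nhds x. (f has_derivative (\<lambda>h. G y \<bullet> h)) (at y)" "G x = p"
    "(G has_derivative A) (at x)" "L = (\<Sum>b\<in>Basis. A b \<bullet> b)"
    using f by (rule has_grad_lapE)
  have fx: "(f has_derivative (\<lambda>h. G x \<bullet> h)) (at x)"
    using 1(1) eventually_nhds_x_imp_x by blast
  obtain e where e: "e > 0" "\<And>y. dist y x < e \<Longrightarrow> f x \<le> f y"
    "\<And>y. dist y x < e \<Longrightarrow> (f has_derivative (\<lambda>h. G y \<bullet> h)) (at y)"
    using eventually_conj[OF min 1(1)] unfolding eventually_nhds_metric by blast
  have "(\<lambda>h. G x \<bullet> h) = (\<lambda>h. 0)"
    by (rule has_derivative_local_min[OF fx]) (use e(1,2) in \<open>auto simp: eventually_at\<close>)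
  then have "p \<bullet> p = 0" using 1(2) by metis
  then show p0: "p = 0" by simp
  have "A b \<bullet> b \<ge> 0" if b: "b \<in> Basis" for b
  proof (rule ccontr)
    assume neg: "\<not> A b \<bullet> b \<ge> 0"
    have t: "((\<lambda>t. x + t *\<^sub>R b) has_derivative (\<lambda>h. h *\<^sub>R b)) (at t)" for t
      by (auto intro!: derivative_eq_intros)
    have "((\<lambda>t. G (x + t *\<^sub>R b)) has_derivative (\<lambda>h. A (h *\<^sub>R b))) (at 0)"
      using has_derivative_compose[OF t[of 0], of G A] 1(3) by simp
    then have "((\<lambda>t. G (x + t *\<^sub>R b) \<bullet> b) has_derivative (\<lambda>h. A (h *\<^sub>R b) \<bullet> b)) (at 0)"
      by (intro has_derivative_inner_left)
    moreover have "(\<lambda>h. A (h *\<^sub>R b) \<bullet> b) = (*) (A b \<bullet> b)"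
      using has_derivative_linear[OF 1(3)] by (auto simp: linear_scale)
    ultimately have "((\<lambda>t. G (x + t *\<^sub>R b) \<bullet> b) has_real_derivative (A b \<bullet> b)) (at 0)"
      by (simp add: has_field_derivative_def)
    from DERIV_neg_dec_right[OF this] neg obtain d where d: "d > 0"
      "\<And>h. 0 < h \<Longrightarrow> h < d \<Longrightarrow> G (x + h *\<^sub>R b) \<bullet> b < 0"
      using 1(2) p0 by auto
    define t1 where "t1 = min d e / 2"
    have t1: "0 < t1" "t1 < d" "t1 < e" using d e by (auto simp: t1_def)
    have D: "((\<lambda>t. f (x + t *\<^sub>R b)) has_real_derivative G (x + t *\<^sub>R b) \<bullet> b) (at t)" if "0 \<le> t" "t \<le> t1" for t
    proof -
      have "dist (x + t *\<^sub>R b) x < e" using that t1 b by (simp add: dist_norm)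
      from has_derivative_compose[OF t e(3)[OF this]]
      show ?thesis unfolding has_field_derivative_def
        by (rule has_derivative_eq_rhs) (simp add: fun_eq_iff)
    qed
    have "f (x + t1 *\<^sub>R b) < f (x + 0 *\<^sub>R b)"
    proof (rule DERIV_neg_imp_decreasing_open[OF t1(1)])
      show "continuous_on {0..t1} (\<lambda>t. f (x + t *\<^sub>R b))"
        using D by (auto intro!: DERIV_isCont continuous_at_imp_continuous_on)
      fix t assume "0 < t" "t < t1"
      then show "\<exists>y. ((\<lambda>t. f (x + t *\<^sub>R b)) has_real_derivative y) (at t) \<and> y < 0"
        using D[of t] d(2)[of t] t1 by auto
    qed
    moreover have "f x \<le> f (x + t1 *\<^sub>R b)"
      using t1 b by (intro e(2)) (simp add: dist_norm)
    ultimately show False by simp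
  qed
  then show "L \<ge> 0" unfolding 1(4) by (intro sum_nonneg) auto
qed

lemma has_grad_lap_local_min:
  assumes "has_grad_lap f x p L" "has_grad_lap g x q M" "\<forall>\<^sub>F y in nhds x. f x - g x \<le> f y - g y"
  shows "p = q" "M \<le> L"
  using has_grad_lap_local_min_0[OF has_grad_lap_diff[OF assms(1,2)] assms(3)] by auto

lemma partial_eq:
  assumes "(f has_derivative (\<lambda>h. G y \<bullet> h)) (at y)"
  shows "partial b f y = G y \<bullet> b"
  using frechet_derivative_at[OF assms] unfolding partial_def by metis

lemma has_grad_lap_unique:
  fixes f :: "'a::euclidean_space \<Rightarrow> real"
  assumes "has_grad_lap f x p L" shows "grad f x = p" "laplacian f x = L"
proof -
  obtain G A where 1: "\<forall>\<^sub>F y in nhds x. (f has_derivative (\<lambda>h. G y \<bullet> h)) (at y)" "G x = p"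
    "(G has_derivative A) (at x)" "L = (\<Sum>b\<in>Basis. A b \<bullet> b)"
    using assms by (rule has_grad_lapE)
  have ev: "\<forall>\<^sub>F y in nhds x. partial b f y = G y \<bullet> b" for b
    using 1(1) by eventually_elim (rule partial_eq)
  have "partial b f x = p \<bullet> b" for b
    using eventually_nhds_x_imp_x[OF ev] 1(2) by simp
  then show "grad f x = p" unfolding grad_def by (simp add: euclidean_representation)
  have "partial b (partial b f) x = A b \<bullet> b" for b
  proof -
    have "((\<lambda>y. G y \<bullet> b) has_derivative (\<lambda>h. A h \<bullet> b)) (at x)"
      using 1(3) by (rule has_derivative_inner_left)
    then have "(partial b f has_derivative (\<lambda>h. A h \<bullet> b)) (at x)"
    proof (rule has_derivative_transform_eventually)
      show "\<forall>\<^sub>F x' in at x. G x' \<bullet> b = partial b f x'"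
        using ev[of b] by (auto simp: eventually_at_filter elim: eventually_mono)
      show "G x \<bullet> b = partial b f x" using eventually_nhds_x_imp_x[OF ev] by simp
    qed simp
    from frechet_derivative_at[OF this] show ?thesis
      by (metis partial_def)
  qed
  then show "laplacian f x = L" unfolding laplacian_def 1(4) by simp
qed

lemma differentiable_has_derivative_grad:
  fixes f :: "'a::euclidean_space \<Rightarrow> real"
  assumes "f differentiable (at y)"
  shows "(f has_derivative (\<lambda>h. grad f y \<bullet> h)) (at y)"
proof -
  have d: "(f has_derivative frechet_derivative f (at y)) (at y)"
    using assms frechet_derivative_works by blast
  have "frechet_derivative f (at y) h = grad f y \<bullet> h" for h
  proof -
    have lin: "linear (frechet_derivative f (at y))" using d has_derivative_linear by blast
    have "frechet_derivative f (at y) h = frechet_derivative f (at y) (\<Sum>b\<in>Basis. (h \<bullet> b) *\<^sub>R b)"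
      by (simp add: euclidean_representation)
    also have "\<dots> = (\<Sum>b\<in>Basis. (h \<bullet> b) * frechet_derivative f (at y) b)"
      using lin by (simp add: linear_sum linear_scale)
    finally show ?thesis
      by (simp add: grad_def partial_def inner_sum_left inner_commute[of h] mult.commute)
  qed
  then show ?thesis using d by (metis (no_types, lifting) ext)
qed

lemma smooth_on_has_grad_lap:
  fixes f :: "'a::euclidean_space \<Rightarrow> real"
  assumes S: "open S" and f: "smooth_on S f" and x: "x \<in> S"
  shows "has_grad_lap f x (grad f x) (laplacian f x)"
proof (rule has_grad_lapI)
  have "Ck_on 2 S f" using f unfolding smooth_on_def by blast
  then have d: "\<forall>y\<in>S. f differentiable (at y)" "\<forall>b\<in>Basis. \<forall>y\<in>S. partial b f differentiable (at y)"
    by (simp_all add: numeral_2_eq_2)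
  show "\<forall>\<^sub>F y in nhds x. (f has_derivative (\<lambda>h. grad f y \<bullet> h)) (at y)"
    unfolding eventually_nhds using S x d differentiable_has_derivative_grad by blast
  have "((\<lambda>y. \<Sum>b\<in>Basis. partial b f y *\<^sub>R b) has_derivative
      (\<lambda>h. \<Sum>b\<in>Basis. frechet_derivative (partial b f) (at x) h *\<^sub>R b)) (at x)"
    by (intro has_derivative_sum has_derivative_scaleR_left)
      (use d x frechet_derivative_works in blast)
  then show "(grad f has_derivative (\<lambda>h. \<Sum>b\<in>Basis. frechet_derivative (partial b f) (at x) h *\<^sub>R b)) (at x)"
    by (simp add: grad_def[abs_def])
  show "laplacian f x = (\<Sum>b\<in>Basis. (\<Sum>c\<in>Basis. frechet_derivative (partial c f) (at x) b *\<^sub>R c) \<bullet> b)"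
    unfolding laplacian_def
    by (intro sum.cong) (simp_all add: inner_sum_left_Basis partial_def)
qed simp

section \<open>Smooth test functions\<close>

text \<open>The partial derivatives of a sum or a multiple are known at the points of \<open>S\<close> only, but they enter
the recursion as functions on the whole space.\<close>

lemma Ck_on_cong:
  assumes "open S" "\<And>x. x \<in> S \<Longrightarrow> f x = g x" "Ck_on k S f"
  shows "Ck_on k S g"
  using assms(2,3)
proof (induction k arbitrary: f g)
  case 0
  then show ?case by (simp cong: continuous_on_cong)
next
  case (Suc k)
  have D: "(g has_derivative D) (at x) \<longleftrightarrow> (f has_derivative D) (at x)" if "x \<in> S" for x D
    using has_derivative_transform_within_open[OF _ assms(1) that] Suc.prems(1) by metis
  then have p: "partial b f x = partial b g x" if "x \<in> S" for b x
    using that unfolding partial_def frechet_derivative_def by simp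
  have "Ck_on k S (partial b g)" if "b \<in> Basis" for b
    using Suc.IH[of "partial b f" "partial b g"] p Suc.prems(2) that by simp
  then show ?case using Suc.prems D unfolding Ck_on.simps differentiable_def by blast
qed

lemma Ck_on_add:
  assumes "open S" "Ck_on k S f" "Ck_on k S g"
  shows "Ck_on k S (\<lambda>x. f x + g x)"
  using assms(2,3)
proof (induction k arbitrary: f g)
  case 0
  then show ?case by (simp add: continuous_on_add)
next
  case (Suc k)
  have "Ck_on k S (partial b (\<lambda>x. f x + g x))" if b: "b \<in> Basis" for b
  proof (rule Ck_on_cong[OF assms(1)])
    show "Ck_on k S (\<lambda>x. partial b f x + partial b g x)" using Suc b by simp
    show "partial b f x + partial b g x = partial b (\<lambda>x. f x + g x) x" if "x \<in> S" for x
    proof -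
      have "(f has_derivative frechet_derivative f (at x)) (at x)"
        "(g has_derivative frechet_derivative g (at x)) (at x)"
        using Suc.prems that by (simp_all flip: frechet_derivative_works)
      from frechet_derivative_at[OF has_derivative_add[OF this]]
      show ?thesis unfolding partial_def by metis
    qed
  qed
  with Suc.prems show ?case by simp
qed

lemma Ck_on_cmult:
  assumes "open S" "Ck_on k S f"
  shows "Ck_on k S (\<lambda>x. c * f x)"
  using assms(2)
proof (induction k arbitrary: f)
  case 0
  then show ?case by (simp add: continuous_on_mult_left)
next
  case (Suc k)
  have "Ck_on k S (partial b (\<lambda>x. c * f x))" if b: "b \<in> Basis" for b
  proof (rule Ck_on_cong[OF assms(1)])
    show "Ck_on k S (\<lambda>x. c * partial b f x)" using Suc b by simp
    show "c * partial b f x = partial b (\<lambda>x. c * f x) x" if "x \<in> S" for x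
    proof -
      have "(f has_derivative frechet_derivative f (at x)) (at x)"
        using Suc.prems that frechet_derivative_works by auto
      from frechet_derivative_at[OF has_derivative_mult_right[OF this, of c]]
      show ?thesis unfolding partial_def by metis
    qed
  qed
  with Suc.prems show ?case by (simp add: differentiable_mult)
qed

lemma Ck_on_translate:
  fixes f :: "'a::euclidean_space \<Rightarrow> real"
  assumes "Ck_on k S f"
  shows "Ck_on k {x. x + a \<in> S} (\<lambda>x. f (x + a))"
  using assms
proof (induction k arbitrary: f)
  case 0
  then show ?case by (auto intro!: continuous_on_compose2[of S f] continuous_intros)
next
  case (Suc k)
  have t: "((\<lambda>y. y + a) has_derivative (\<lambda>h. h)) (at y)" for y :: 'a
    by (auto intro!: derivative_eq_intros)
  have D: "((\<lambda>x. f (x + a)) has_derivative frechet_derivative f (at (x + a))) (at x)" if "x + a \<in> S" for x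
    using has_derivative_compose[OF t] that Suc.prems frechet_derivative_works by fastforce
  have "partial b (\<lambda>x. f (x + a)) x = partial b f (x + a)" for x b
  proof (cases "f differentiable (at (x + a))")
    case True
    then show ?thesis using has_derivative_compose[OF t] frechet_derivative_works
      by (metis frechet_derivative_at partial_def)
  next
    case False
    have t': "((\<lambda>y. y - a) has_derivative (\<lambda>h. h)) (at y)" for y :: 'a
      by (auto intro!: derivative_eq_intros)
    have "((\<lambda>x. f (x + a)) has_derivative D) (at x) \<longleftrightarrow> (f has_derivative D) (at (x + a))" for D
      using has_derivative_compose[OF t[of x], of f D]
        has_derivative_compose[OF t'[of "x + a"], of "\<lambda>x. f (x + a)" D] by auto
    then show ?thesis unfolding partial_def frechet_derivative_def by simp
  qed
  then have "partial b (\<lambda>x. f (x + a)) = (\<lambda>x. partial b f (x + a))" for b by blast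
  then show ?case using Suc D unfolding Ck_on.simps differentiable_def by auto
qed

lemma smooth_on_add:
  "open S \<Longrightarrow> smooth_on S f \<Longrightarrow> smooth_on S g \<Longrightarrow> smooth_on S (\<lambda>x. f x + g x)"
  unfolding smooth_on_def using Ck_on_add by blast

lemma smooth_on_cmult: "open S \<Longrightarrow> smooth_on S f \<Longrightarrow> smooth_on S (\<lambda>x. c * f x)"
  unfolding smooth_on_def using Ck_on_cmult by blast

lemma Ck_on_subset: "Ck_on k S f \<Longrightarrow> T \<subseteq> S \<Longrightarrow> Ck_on k T f"
  by (induction k arbitrary: f) (auto intro: continuous_on_subset)

lemma smooth_on_subset: "smooth_on S f \<Longrightarrow> T \<subseteq> S \<Longrightarrow> smooth_on T f"
  unfolding smooth_on_def using Ck_on_subset by blast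

lemma smooth_on_translate:
  assumes "smooth_on (ball (x + a) \<rho>) f"
  shows "smooth_on (ball x \<rho>) (\<lambda>y. f (y + a))"
proof -
  have "{y. y + a \<in> ball (x + a) \<rho>} = ball x \<rho>" by (auto simp: dist_norm)
  then show ?thesis using assms Ck_on_translate unfolding smooth_on_def by metis
qed

lemma real_polynomial_function_gradient:
  fixes f :: "'a::euclidean_space \<Rightarrow> real"
  assumes "real_polynomial_function f"
  shows "\<exists>G. (\<forall>x. (f has_derivative (\<lambda>h. G x \<bullet> h)) (at x)) \<and> (\<forall>b. real_polynomial_function (\<lambda>x. G x \<bullet> b))"
  using assms
proof induction
  case (linear f)
  have e: "f h = (\<Sum>b\<in>Basis. f b *\<^sub>R b) \<bullet> h" for h
  proof -
    have "f h = f (\<Sum>b\<in>Basis. (h \<bullet> b) *\<^sub>R b)" by (simp add: euclidean_representation)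
    also have "\<dots> = (\<Sum>b\<in>Basis. (h \<bullet> b) * f b)"
      using linear by (simp add: bounded_linear.linear linear_sum linear_scale)
    finally show ?thesis by (simp add: inner_sum_left inner_commute[of h] mult.commute)
  qed
  have "(f has_derivative f) (at x)" for x
    using linear by (rule bounded_linear_imp_has_derivative)
  then have "(f has_derivative (\<lambda>h. (\<Sum>b\<in>Basis. f b *\<^sub>R b) \<bullet> h)) (at x)" for x
    using e by (metis (no_types, lifting) ext)
  then show ?case by (intro exI[where x="\<lambda>_. \<Sum>b\<in>Basis. f b *\<^sub>R b"]) auto
next
  case (const c)
  then show ?case by (intro exI[where x="\<lambda>_. 0"]) auto
next
  case (add f g)
  then obtain G H where "\<forall>x. (f has_derivative (\<lambda>h. G x \<bullet> h)) (at x)" "\<forall>b. real_polynomial_function (\<lambda>x. G x \<bullet> b)"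
    "\<forall>x. (g has_derivative (\<lambda>h. H x \<bullet> h)) (at x)" "\<forall>b. real_polynomial_function (\<lambda>x. H x \<bullet> b)" by blast
  then show ?case
    by (intro exI[where x="\<lambda>x. G x + H x"])
      (auto simp: inner_add_left intro!: derivative_eq_intros)
next
  case (mult f g)
  then obtain G H where "\<forall>x. (f has_derivative (\<lambda>h. G x \<bullet> h)) (at x)" "\<forall>b. real_polynomial_function (\<lambda>x. G x \<bullet> b)"
    "\<forall>x. (g has_derivative (\<lambda>h. H x \<bullet> h)) (at x)" "\<forall>b. real_polynomial_function (\<lambda>x. H x \<bullet> b)" by blast
  with mult.hyps show ?case
    by (intro exI[where x="\<lambda>x. f x *\<^sub>R H x + g x *\<^sub>R G x"])
      (auto simp: inner_add_left algebra_simps intro!: derivative_eq_intros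
        real_polynomial_function.intros(3,4))
qed

lemma real_polynomial_function_partial:
  fixes f :: "'a::euclidean_space \<Rightarrow> real"
  assumes "real_polynomial_function f"
  shows "f differentiable (at x)" "real_polynomial_function (partial b f)"
proof -
  obtain G where G: "\<And>x. (f has_derivative (\<lambda>h. G x \<bullet> h)) (at x)"
    "\<And>b. real_polynomial_function (\<lambda>x. G x \<bullet> b)"
    using real_polynomial_function_gradient[OF assms] by blast
  show "f differentiable (at x)" using G(1) differentiable_def by blast
  have "partial b f = (\<lambda>x. G x \<bullet> b)" by (rule ext) (rule partial_eq[OF G(1)])
  then show "real_polynomial_function (partial b f)" using G(2) by simp
qed

lemma real_polynomial_function_laplacian:
  fixes f :: "'a::euclidean_space \<Rightarrow> real"
  shows "real_polynomial_function f \<Longrightarrow> real_polynomial_function (laplacian f)"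
  unfolding laplacian_def[abs_def] by (intro real_polynomial_function_sum real_polynomial_function_partial) auto

lemma smooth_on_polynomial:
  fixes f :: "'a::euclidean_space \<Rightarrow> real"
  assumes "real_polynomial_function f" shows "smooth_on S f"
proof -
  have "Ck_on k S f" for k
    using assms
  proof (induction k arbitrary: f)
    case 0
    then show ?case
      using real_polynomial_function_eq continuous_on_polymonial_function by (metis Ck_on.simps(1))
  next
    case (Suc k)
    then show ?case by (simp add: real_polynomial_function_partial)
  qed
  then show ?thesis unfolding smooth_on_def by blast
qed

lemma smooth_on_const: "smooth_on S (\<lambda>_::'a::euclidean_space. c)"
  by (intro smooth_on_polynomial real_polynomial_function.intros(2))

lemma polynomial_has_grad_lap:
  fixes f :: "'a::euclidean_space \<Rightarrow> real"
  shows "real_polynomial_function f \<Longrightarrow> has_grad_lap f x (grad f x) (laplacian f x)"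
  by (rule smooth_on_has_grad_lap[of UNIV]) (auto intro: smooth_on_polynomial)

lemma smooth_on_continuous_grad_lap:
  fixes f :: "'a::euclidean_space \<Rightarrow> real"
  assumes f: "smooth_on S f"
  shows "continuous_on S (grad f)" "continuous_on S (laplacian f)" "continuous_on S f"
proof -
  have "Ck_on 0 S f" "Ck_on 1 S f" "Ck_on 2 S f" using f unfolding smooth_on_def by blast+
  then have "\<forall>b\<in>Basis. continuous_on S (partial b f)"
    "\<forall>b\<in>Basis. \<forall>c\<in>Basis. continuous_on S (partial c (partial b f))" "continuous_on S f"
    by (simp_all add: numeral_2_eq_2)
  then show "continuous_on S (grad f)" "continuous_on S (laplacian f)" "continuous_on S f"
    unfolding grad_def[abs_def] laplacian_def[abs_def] by (auto intro!: continuous_intros)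
qed

section \<open>Harmonic polynomials\<close>

text \<open>The zero function is homogeneous of every degree, so the truncated degrees \<open>d - 1\<close> and \<open>d - 2\<close> of
derivatives below are correct for small \<open>d\<close> as well.\<close>

inductive homogeneous_poly :: "nat \<Rightarrow> ('a::euclidean_space \<Rightarrow> real) \<Rightarrow> bool" where
  homogeneous_poly_const: "homogeneous_poly 0 (\<lambda>x. c)"
| homogeneous_poly_linear_mult: "homogeneous_poly d f \<Longrightarrow> homogeneous_poly (Suc d) (\<lambda>x. (x \<bullet> b) * f x)"
| homogeneous_poly_add: "homogeneous_poly d f \<Longrightarrow> homogeneous_poly d g \<Longrightarrow> homogeneous_poly d (\<lambda>x. f x + g x)"

lemma homogeneous_poly_cmult: "homogeneous_poly d f \<Longrightarrow> homogeneous_poly d (\<lambda>x. c * f x)"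
proof (induction rule: homogeneous_poly.induct)
  case (homogeneous_poly_const c')
  then show ?case by (rule homogeneous_poly.homogeneous_poly_const)
next
  case (homogeneous_poly_linear_mult d f b)
  from homogeneous_poly.homogeneous_poly_linear_mult[OF homogeneous_poly_linear_mult.IH, of b] show ?case by (simp add: algebra_simps)
next
  case (homogeneous_poly_add d f g)
  from homogeneous_poly.homogeneous_poly_add[OF homogeneous_poly_add.IH] show ?case by (simp add: algebra_simps)
qed

lemma homogeneous_poly_zero: "homogeneous_poly d (\<lambda>x. 0)"
  by (induction d) (use homogeneous_poly_const homogeneous_poly_linear_mult[where b=0] in auto)

lemma homogeneous_poly_sum: "(\<And>i. i \<in> I \<Longrightarrow> homogeneous_poly d (f i)) \<Longrightarrow> homogeneous_poly d (\<lambda>x. \<Sum>i\<in>I. f i x)"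
  by (induction I rule: infinite_finite_induct) (auto intro: homogeneous_poly_zero homogeneous_poly_add)

lemma homogeneous_poly_mult: "homogeneous_poly d f \<Longrightarrow> homogeneous_poly e g \<Longrightarrow> homogeneous_poly (d + e) (\<lambda>x. f x * g x)"
proof (induction rule: homogeneous_poly.induct)
  case (homogeneous_poly_const c)
  then show ?case by (auto intro: homogeneous_poly_cmult)
next
  case (homogeneous_poly_linear_mult d f b)
  from homogeneous_poly.homogeneous_poly_linear_mult[OF homogeneous_poly_linear_mult.IH, of b] homogeneous_poly_linear_mult.prems
  show ?case by (simp add: mult.assoc)
next
  case (homogeneous_poly_add d f g)
  from homogeneous_poly.homogeneous_poly_add[OF homogeneous_poly_add.IH] homogeneous_poly_add.prems show ?case by (simp add: algebra_simps)
qed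

lemma homogeneous_poly_dot_self: "homogeneous_poly 2 (\<lambda>x. x \<bullet> x)"
proof -
  have "homogeneous_poly (Suc (Suc 0)) (\<lambda>x::'a. \<Sum>b\<in>Basis. (x \<bullet> b) * ((x \<bullet> b) * 1))"
    by (intro homogeneous_poly_sum homogeneous_poly.intros)
  then show ?thesis by (simp add: numeral_2_eq_2 flip: euclidean_inner)
qed

lemma homogeneous_poly_dot_power: "homogeneous_poly d f \<Longrightarrow> homogeneous_poly (d + 2 * k) (\<lambda>x. (x \<bullet> x) ^ k * f x)"
proof (induction k)
  case (Suc k)
  from homogeneous_poly_mult[OF homogeneous_poly_dot_self Suc.IH[OF Suc.prems]] show ?case by (simp add: mult.assoc)
qed simp

lemma real_polynomial_function_inner: "real_polynomial_function (\<lambda>x. x \<bullet> b)"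
  by (intro real_polynomial_function.intros(1) bounded_linear_inner_left)

lemma homogeneous_poly_imp_polynomial: "homogeneous_poly d f \<Longrightarrow> real_polynomial_function f"
  by (induction rule: homogeneous_poly.induct)
    (auto intro: real_polynomial_function.intros real_polynomial_function_inner)

lemma polynomial_dot_self: "real_polynomial_function (\<lambda>x::'a::euclidean_space. x \<bullet> x)"
  using homogeneous_poly_imp_polynomial[OF homogeneous_poly_dot_self] .

text \<open>Euler's identity and the degrees of the derivatives have to be proved together: the Laplacian of
\<open>(x \<bullet> c) f\<close> contains the derivative of \<open>f\<close> in direction \<open>c\<close>.\<close>

lemma homogeneous_poly_derivatives:
  fixes f :: "'a::euclidean_space \<Rightarrow> real"
  assumes "homogeneous_poly d f"
  shows "(\<forall>x. x \<bullet> grad f x = d * f x) \<and> (\<forall>b. homogeneous_poly (d - 1) (\<lambda>x. grad f x \<bullet> b)) \<and>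
    (d = 0 \<longrightarrow> (\<forall>x. grad f x = 0)) \<and> homogeneous_poly (d - 2) (laplacian f) \<and> (d < 2 \<longrightarrow> (\<forall>x. laplacian f x = 0))"
  using assms
proof (induction rule: homogeneous_poly.induct)
  case (homogeneous_poly_const c)
  have "grad (\<lambda>x::'a. c) = (\<lambda>x. 0)" "laplacian (\<lambda>x::'a. c) = (\<lambda>x. 0)"
    using has_grad_lap_unique[OF has_grad_lap_const] by blast+
  then show ?case by (auto intro: homogeneous_poly_zero)
next
  case (homogeneous_poly_linear_mult d f c)
  have hgl: "has_grad_lap (\<lambda>x. (x \<bullet> c) * f x) x ((x \<bullet> c) *\<^sub>R grad f x + f x *\<^sub>R c)
      ((x \<bullet> c) * laplacian f x + f x * 0 + 2 * (c \<bullet> grad f x))" for x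
    by (intro has_grad_lap_mult has_grad_lap_inner polynomial_has_grad_lap
        homogeneous_poly_imp_polynomial[OF homogeneous_poly_linear_mult.hyps])
  have g: "grad (\<lambda>x. (x \<bullet> c) * f x) = (\<lambda>x. (x \<bullet> c) *\<^sub>R grad f x + f x *\<^sub>R c)"
    using has_grad_lap_unique(1)[OF hgl] by blast
  have l: "laplacian (\<lambda>x. (x \<bullet> c) * f x) = (\<lambda>x. (x \<bullet> c) * laplacian f x + 2 * (grad f x \<bullet> c))"
    using has_grad_lap_unique(2)[OF hgl] by (auto simp: inner_commute)
  note IH = homogeneous_poly_linear_mult.IH
  have gb: "homogeneous_poly d (\<lambda>x. (x \<bullet> c) * (grad f x \<bullet> b) + (c \<bullet> b) * f x)" for b
  proof (cases d)
    case 0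
    with IH homogeneous_poly_linear_mult.hyps show ?thesis by (auto intro: homogeneous_poly_cmult)
  next
    case (Suc d')
    with IH homogeneous_poly.homogeneous_poly_linear_mult[of "d - 1" "\<lambda>x. grad f x \<bullet> b" c] homogeneous_poly_linear_mult.hyps
    show ?thesis by (intro homogeneous_poly_add homogeneous_poly_cmult) auto
  qed
  have lb: "homogeneous_poly (Suc d - 2) (\<lambda>x. (x \<bullet> c) * laplacian f x + 2 * (grad f x \<bullet> c))"
  proof (cases "d < 2")
    case True
    with IH show ?thesis by (auto intro!: homogeneous_poly_cmult)
  next
    case False
    then have "Suc d - 2 = Suc (d - 2)" "d - 1 = Suc (d - 2)" by auto
    with IH homogeneous_poly.homogeneous_poly_linear_mult[of "d - 2" "laplacian f" c]
    show ?thesis by (intro homogeneous_poly_add homogeneous_poly_cmult) (auto simp: )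
  qed
  show ?case
    unfolding g l using IH gb lb
    by (auto simp: inner_add_left inner_add_right algebra_simps)
next
  case (homogeneous_poly_add d f g)
  have hgl: "has_grad_lap (\<lambda>x. f x + g x) x (grad f x + grad g x) (laplacian f x + laplacian g x)" for x
    by (intro has_grad_lap_add polynomial_has_grad_lap homogeneous_poly_imp_polynomial[OF homogeneous_poly_add.hyps(1)]
        homogeneous_poly_imp_polynomial[OF homogeneous_poly_add.hyps(2)])
  have g: "grad (\<lambda>x. f x + g x) = (\<lambda>x. grad f x + grad g x)"
    using has_grad_lap_unique(1)[OF hgl] by blast
  have l: "laplacian (\<lambda>x. f x + g x) = (\<lambda>x. laplacian f x + laplacian g x)"
    using has_grad_lap_unique(2)[OF hgl] by blast
  show ?case
    unfolding g l using homogeneous_poly_add.IH by (auto simp: inner_add_left inner_add_right algebra_simps intro: homogeneous_poly.homogeneous_poly_add)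
qed

text \<open>Thanks to Euler's identity the mixed term is a multiple of \<open>|x|\<^sup>2\<^sup>i f\<close>. The formula expresses this
function as the Laplacian of a multiple of \<open>|x|\<^sup>2\<close>, up to a term in which \<open>f\<close> is replaced by its
Laplacian, of lower degree.\<close>

lemma laplacian_dot_power_mult:
  fixes f :: "'a::euclidean_space \<Rightarrow> real"
  assumes f: "homogeneous_poly d f"
  shows "laplacian (\<lambda>x. (x \<bullet> x) ^ Suc i * f x) x =
    (x \<bullet> x) ^ Suc i * laplacian f x + real (Suc i) * (2 * DIM('a) + 4 * i + 4 * d) * ((x \<bullet> x) ^ i * f x)"
proof -
  have "has_grad_lap (\<lambda>y. (y \<bullet> y) ^ Suc i) x
     ((real (Suc i) * (x \<bullet> x) ^ i) *\<^sub>R 2 *\<^sub>R x)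
     ((real (Suc i) * (x \<bullet> x) ^ i) * (2 * DIM('a)) + (real (Suc i) * (real i * (x \<bullet> x) ^ (i - Suc 0))) * (2 *\<^sub>R x \<bullet> 2 *\<^sub>R x))"
    by (rule has_grad_lap_compose[OF has_grad_lap_dot_self])
      (auto intro!: always_eventually derivative_eq_intros simp del: power_Suc of_nat_Suc)
  from has_grad_lap_mult[OF this polynomial_has_grad_lap[OF homogeneous_poly_imp_polynomial[OF f]]]
  have "laplacian (\<lambda>x. (x \<bullet> x) ^ Suc i * f x) x =
     (x \<bullet> x) ^ Suc i * laplacian f x +
     f x * ((real (Suc i) * (x \<bullet> x) ^ i) * (2 * DIM('a)) + (real (Suc i) * (real i * (x \<bullet> x) ^ (i - Suc 0))) * (2 *\<^sub>R x \<bullet> 2 *\<^sub>R x))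
     + 2 * (((real (Suc i) * (x \<bullet> x) ^ i) *\<^sub>R 2 *\<^sub>R x) \<bullet> grad f x)"
    by (rule has_grad_lap_unique(2))
  moreover have "x \<bullet> grad f x = d * f x" using homogeneous_poly_derivatives[OF f] by blast
  ultimately show ?thesis by (cases i) (simp_all add: algebra_simps)
qed

lemma laplacian_linear_combination:
  fixes f g :: "'a::euclidean_space \<Rightarrow> real"
  assumes "real_polynomial_function f" "real_polynomial_function g"
  shows "laplacian (\<lambda>x. a * f x + b * g x) x = a * laplacian f x + b * laplacian g x"
  by (rule has_grad_lap_unique(2)[OF has_grad_lap_add[OF has_grad_lap_cmult[OF polynomial_has_grad_lap]
          has_grad_lap_cmult[OF polynomial_has_grad_lap]]]) (rule assms)+

text \<open>Induction on the degree of \<open>f\<close>, for all \<open>i\<close> at once: in \<open>laplacian_dot_power_mult\<close> the degree of the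
polynomial factor drops by two while the power of \<open>|x|\<^sup>2\<close> grows by one.\<close>

lemma laplacian_dot_mult_solve:
  fixes f :: "'a::euclidean_space \<Rightarrow> real"
  assumes "homogeneous_poly d f"
  shows "\<exists>q. homogeneous_poly (d + 2 * i) q \<and> (\<forall>x. laplacian (\<lambda>x. (x \<bullet> x) * q x) x = (x \<bullet> x) ^ i * f x)"
  using assms
proof (induction d arbitrary: f i rule: less_induct)
  case (less d)
  note f = less.prems
  define c where "c = real (Suc i) * (2 * DIM('a) + 4 * i + 4 * d)"
  have "real DIM('a) > 0" by (simp add: DIM_positive)
  then have "2 * real DIM('a) + 4 * real i + 4 * real d > 0" by linarith
  then have "c > 0" unfolding c_def by simp
  then have c: "c \<noteq> 0" by simp
  have "\<exists>q'. homogeneous_poly (d + 2 * i) q' \<and> (\<forall>x. laplacian (\<lambda>x. (x \<bullet> x) * q' x) x = (x \<bullet> x) ^ Suc i * laplacian f x)"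
  proof (cases "d < 2")
    case True
    then show ?thesis
      using homogeneous_poly_derivatives[OF f] homogeneous_poly_zero has_grad_lap_unique(2)[OF has_grad_lap_const[of 0]]
      by (intro exI[where x="\<lambda>_. 0"]) auto
  next
    case False
    then have "d - 2 < d" "d - 2 + 2 * Suc i = d + 2 * i" by auto
    with less.IH[of "d - 2" "laplacian f" "Suc i"] homogeneous_poly_derivatives[OF f] show ?thesis by metis
  qed
  then obtain q' where q': "homogeneous_poly (d + 2 * i) q'"
    "\<And>x. laplacian (\<lambda>x. (x \<bullet> x) * q' x) x = (x \<bullet> x) ^ Suc i * laplacian f x" by blast
  define q where "q = (\<lambda>x. (1 / c) * ((x \<bullet> x) ^ i * f x) + (- 1 / c) * q' x)"
  have "homogeneous_poly (d + 2 * i) q"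
    unfolding q_def by (intro homogeneous_poly_add homogeneous_poly_cmult homogeneous_poly_dot_power q' f)
  moreover have "laplacian (\<lambda>x. (x \<bullet> x) * q x) x = (x \<bullet> x) ^ i * f x" for x
  proof -
    have "(\<lambda>x. (x \<bullet> x) * q x) = (\<lambda>x. (1 / c) * ((x \<bullet> x) ^ Suc i * f x) + (- 1 / c) * ((x \<bullet> x) * q' x))"
      unfolding q_def by (auto simp: algebra_simps)
    then have "laplacian (\<lambda>x. (x \<bullet> x) * q x) x =
       (1 / c) * laplacian (\<lambda>x. (x \<bullet> x) ^ Suc i * f x) x + (- 1 / c) * laplacian (\<lambda>x. (x \<bullet> x) * q' x) x"
      using laplacian_linear_combination[OF homogeneous_poly_imp_polynomial[OF homogeneous_poly_dot_power[OF f, of "Suc i"]]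
          homogeneous_poly_imp_polynomial[OF homogeneous_poly_dot_power[OF q'(1), of 1]], of "1 / c" "- 1 / c" x]
      by (simp only: power_one_right)
    also have "\<dots> = (x \<bullet> x) ^ i * f x"
      unfolding laplacian_dot_power_mult[OF f] q'(2) c_def[symmetric] using c
      by (simp add: field_simps)
    finally show ?thesis .
  qed
  ultimately show ?case by blast
qed

text \<open>A solution \<open>q\<close> for the factor \<open>|x|\<^sup>2\<close> has the degree of \<open>f\<close>. Replacing \<open>|x|\<^sup>2\<close> by \<open>|x|\<^sup>2 - s\<close> makes an
error \<open>s \<Delta>q\<close> of lower degree, which is corrected by induction.\<close>

lemma laplacian_sphere_mult_solve:
  fixes f :: "'a::euclidean_space \<Rightarrow> real"
  assumes "homogeneous_poly d f"
  shows "\<exists>q. real_polynomial_function q \<and> (\<forall>x. laplacian (\<lambda>x. (x \<bullet> x - s) * q x) x = f x)"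
  using assms
proof (induction d arbitrary: f rule: less_induct)
  case (less d)
  obtain q1 where q1: "homogeneous_poly d q1" "\<And>x. laplacian (\<lambda>x. (x \<bullet> x) * q1 x) x = f x"
    using laplacian_dot_mult_solve[OF less.prems, of 0] by auto
  have "\<exists>q2. real_polynomial_function q2 \<and> (\<forall>x. laplacian (\<lambda>x. (x \<bullet> x - s) * q2 x) x = laplacian q1 x)"
  proof (cases "d < 2")
    case True
    then show ?thesis
      using homogeneous_poly_derivatives[OF q1(1)] has_grad_lap_unique(2)[OF has_grad_lap_const[of 0]]
      by (intro exI[where x="\<lambda>_. 0"]) (auto intro: real_polynomial_function.intros)
  next
    case False
    with less.IH[of "d - 2" "laplacian q1"] homogeneous_poly_derivatives[OF q1(1)] show ?thesis by auto
  qed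
  then obtain q2 where q2: "real_polynomial_function q2"
    "\<And>x. laplacian (\<lambda>x. (x \<bullet> x - s) * q2 x) x = laplacian q1 x" by blast
  note P = homogeneous_poly_imp_polynomial[OF q1(1)] q2(1) polynomial_dot_self
    real_polynomial_function.intros real_polynomial_function_diff
  have "laplacian (\<lambda>x. (x \<bullet> x - s) * (q1 x + s * q2 x)) x = f x" for x
  proof -
    have "(\<lambda>x. (x \<bullet> x - s) * (q1 x + s * q2 x)) =
       (\<lambda>x. 1 * (1 * ((x \<bullet> x) * q1 x) + (- s) * q1 x) + s * ((x \<bullet> x - s) * q2 x))"
      by (auto simp: algebra_simps)
    then show ?thesis
      using laplacian_linear_combination[of "\<lambda>x. 1 * ((x \<bullet> x) * q1 x) + (- s) * q1 x" "\<lambda>x. (x \<bullet> x - s) * q2 x" 1 s x]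
        laplacian_linear_combination[of "\<lambda>x. (x \<bullet> x) * q1 x" q1 1 "- s" x] q1(2) q2(2)
      by (simp add: P del: mult_1)
  qed
  then show ?case
    by (intro exI[where x="\<lambda>x. q1 x + s * q2 x"]) (auto intro!: real_polynomial_function.intros(2,3,4) P(1,2))
qed

inductive sum_of_homogeneous :: "('a::euclidean_space \<Rightarrow> real) \<Rightarrow> bool" where
  sum_of_homogeneous_single: "homogeneous_poly d f \<Longrightarrow> sum_of_homogeneous f"
| sum_of_homogeneous_add: "sum_of_homogeneous f \<Longrightarrow> sum_of_homogeneous g \<Longrightarrow> sum_of_homogeneous (\<lambda>x. f x + g x)"

lemma sum_of_homogeneous_mult:
  assumes "sum_of_homogeneous f" "sum_of_homogeneous g"
  shows "sum_of_homogeneous (\<lambda>x. f x * g x)"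
  using assms(1)
proof (induction rule: sum_of_homogeneous.induct)
  case f: (sum_of_homogeneous_single d f)
  show ?case
    using assms(2)
  proof (induction rule: sum_of_homogeneous.induct)
    case (sum_of_homogeneous_single e g)
    then show ?case using f homogeneous_poly_mult sum_of_homogeneous.intros(1) by blast
  next
    case (sum_of_homogeneous_add g h)
    from sum_of_homogeneous.sum_of_homogeneous_add[OF sum_of_homogeneous_add.IH] show ?case by (simp add: algebra_simps)
  qed
next
  case (sum_of_homogeneous_add f h)
  from sum_of_homogeneous.sum_of_homogeneous_add[OF sum_of_homogeneous_add.IH] show ?case by (simp add: algebra_simps)
qed

lemma real_polynomial_sum_of_homogeneous:
  fixes f :: "'a::euclidean_space \<Rightarrow> real"
  shows "real_polynomial_function f \<Longrightarrow> sum_of_homogeneous f"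
proof (induction rule: real_polynomial_function.induct)
  case (linear f)
  have "f = (\<lambda>x. \<Sum>b\<in>Basis. (x \<bullet> b) * f b)"
  proof
    fix x
    have "f x = f (\<Sum>b\<in>Basis. (x \<bullet> b) *\<^sub>R b)" by (simp add: euclidean_representation)
    also have "\<dots> = (\<Sum>b\<in>Basis. (x \<bullet> b) * f b)"
      using linear by (simp add: bounded_linear.linear linear_sum linear_scale)
    finally show "f x = (\<Sum>b\<in>Basis. (x \<bullet> b) * f b)" .
  qed
  moreover have "homogeneous_poly (Suc 0) (\<lambda>x. \<Sum>b\<in>Basis. (x \<bullet> b) * f b)"
    by (intro homogeneous_poly_sum homogeneous_poly.intros)
  ultimately show ?case using sum_of_homogeneous_single by metis
qed (auto intro: sum_of_homogeneous.intros homogeneous_poly_const sum_of_homogeneous_mult)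

lemma polynomial_laplacian_sphere_solve:
  fixes f :: "'a::euclidean_space \<Rightarrow> real"
  assumes "real_polynomial_function f"
  shows "\<exists>q. real_polynomial_function q \<and> (\<forall>x. laplacian (\<lambda>x. (x \<bullet> x - s) * q x) x = f x)"
  using real_polynomial_sum_of_homogeneous[OF assms]
proof (induction rule: sum_of_homogeneous.induct)
  case (sum_of_homogeneous_single d f)
  then show ?case by (rule laplacian_sphere_mult_solve)
next
  case (sum_of_homogeneous_add f g)
  then obtain p q where pq: "real_polynomial_function p" "\<And>x. laplacian (\<lambda>x. (x \<bullet> x - s) * p x) x = f x"
    "real_polynomial_function q" "\<And>x. laplacian (\<lambda>x. (x \<bullet> x - s) * q x) x = g x" by blast
  have "laplacian (\<lambda>x. 1 * ((x \<bullet> x - s) * p x) + 1 * ((x \<bullet> x - s) * q x)) x = 1 * f x + 1 * g x" for x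
    unfolding pq(2,4)[symmetric]
    by (intro laplacian_linear_combination real_polynomial_function.intros(4) real_polynomial_function_diff
        real_polynomial_function.intros(2) polynomial_dot_self pq)
  moreover have "(\<lambda>x. 1 * ((x \<bullet> x - s) * p x) + 1 * ((x \<bullet> x - s) * q x)) = (\<lambda>x. (x \<bullet> x - s) * (p x + q x))"
    by (auto simp: algebra_simps)
  ultimately show ?case
    by (intro exI[where x="\<lambda>x. p x + q x"]) (use pq in \<open>auto intro: real_polynomial_function.intros\<close>)
qed

text \<open>Solving \<open>\<Delta>((|x|\<^sup>2 - s\<^sup>2) q) = \<Delta>p\<close> for a polynomial \<open>q\<close> makes \<open>p - (|x|\<^sup>2 - s\<^sup>2) q\<close> harmonic without changing
\<open>p\<close> on the sphere.\<close>

lemma harmonic_polynomial_extension: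
  fixes p :: "'a::euclidean_space \<Rightarrow> real"
  assumes p: "real_polynomial_function p"
  shows "\<exists>H. real_polynomial_function H \<and> (\<forall>x. laplacian H x = 0) \<and> (\<forall>x. norm x = s \<longrightarrow> H x = p x)"
proof -
  obtain q where q: "real_polynomial_function q"
    "\<And>x. laplacian (\<lambda>x. (x \<bullet> x - s\<^sup>2) * q x) x = laplacian p x"
    using polynomial_laplacian_sphere_solve[OF real_polynomial_function_laplacian[OF p], of "s\<^sup>2"] by blast
  define H where "H = (\<lambda>x. 1 * p x + (- 1) * ((x \<bullet> x - s\<^sup>2) * q x))"
  have P: "real_polynomial_function (\<lambda>x. (x \<bullet> x - s\<^sup>2) * q x)"
    by (intro real_polynomial_function.intros(4) real_polynomial_function_diff
        real_polynomial_function.intros(2) polynomial_dot_self q)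
  have "laplacian H x = 0" for x
    unfolding H_def laplacian_linear_combination[OF p P] q by simp
  moreover have "real_polynomial_function H"
    unfolding H_def by (intro real_polynomial_function.intros(2,3,4) p P)
  moreover have "norm x = s \<longrightarrow> H x = p x" for x
    by (auto simp: H_def dot_square_norm)
  ultimately show ?thesis by blast
qed

lemma real_polynomial_function_translate:
  fixes f :: "'a::euclidean_space \<Rightarrow> real"
  shows "real_polynomial_function f \<Longrightarrow> real_polynomial_function (\<lambda>x. f (x + a))"
proof (induction rule: real_polynomial_function.induct)
  case (linear f)
  then have "(\<lambda>x. f (x + a)) = (\<lambda>x. f x + f a)" by (simp add: bounded_linear.linear linear_add)
  with linear show ?case by (auto intro: real_polynomial_function.intros)
qed (auto intro: real_polynomial_function.intros)

lemma harmonic_polynomial_approx: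
  fixes f :: "'a::euclidean_space \<Rightarrow> real"
  assumes f: "continuous_on (sphere a s) f" and e: "e > 0"
  obtains H where "real_polynomial_function H" "\<And>x. laplacian H x = 0"
    "\<And>x. x \<in> sphere a s \<Longrightarrow> \<bar>H x - f x\<bar> < e"
proof -
  have "continuous_on (sphere 0 s) (\<lambda>x. f (x + a))"
    by (intro continuous_on_compose2[OF f] continuous_intros) (auto simp: dist_norm)
  then obtain p where p: "real_polynomial_function p" "\<And>x. x \<in> sphere 0 s \<Longrightarrow> \<bar>f (x + a) - p x\<bar> < e"
    using Stone_Weierstrass_real_polynomial_function[of "sphere 0 s" "\<lambda>x. f (x + a)" e] e by auto
  obtain H where H: "real_polynomial_function H" "\<And>x. laplacian H x = 0"
    "\<And>x. norm x = s \<Longrightarrow> H x = p x"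
    using harmonic_polynomial_extension[OF p(1), of s] by blast
  show thesis
  proof
    show "real_polynomial_function (\<lambda>x. H (x + - a))"
      by (rule real_polynomial_function_translate[OF H(1)])
    show "laplacian (\<lambda>x. H (x + - a)) x = 0" for x
      by (rule trans[OF has_grad_lap_unique(2)[OF has_grad_lap_translate[OF polynomial_has_grad_lap[OF H(1)]]] H(2)])
    show "\<bar>H (x + - a) - f x\<bar> < e" if "x \<in> sphere a s" for x
      using p(2)[of "x - a"] H(3)[of "x - a"] that by (simp add: dist_norm norm_minus_commute abs_minus_commute)
  qed
qed


section \<open>A comparison principle for Poisson's equation\<close>

lemma polynomial_paraboloid:
  fixes a :: "'a::euclidean_space" and s :: real
  defines "q \<equiv> \<lambda>x. (1 / (2 * DIM('a))) * (s\<^sup>2 - (x - a) \<bullet> (x - a))"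
  shows "real_polynomial_function q" "laplacian q x = - 1"
proof -
  have P: "real_polynomial_function (\<lambda>x::'a. (x - a) \<bullet> (x - a))"
    using real_polynomial_function_translate[OF polynomial_dot_self, of "- a"] by simp
  then show "real_polynomial_function q"
    unfolding q_def by (intro real_polynomial_function.intros(2,4) real_polynomial_function_diff)
  have "has_grad_lap (\<lambda>x::'a. (x + - a) \<bullet> (x + - a)) x (2 *\<^sub>R (x + - a)) (2 * DIM('a))"
    by (rule has_grad_lap_translate[OF has_grad_lap_dot_self])
  from has_grad_lap_unique(2)[OF has_grad_lap_cmult[OF has_grad_lap_diff[OF has_grad_lap_const this]]]
  have "laplacian q x = (1 / real (2 * DIM('a))) * (0 - real (2 * DIM('a)))"
    unfolding q_def diff_conv_add_uminus[of _ a] .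
  then show "laplacian q x = - 1" by simp
qed

lemma polynomial_interior_max:
  fixes f :: "'a::euclidean_space \<Rightarrow> real"
  assumes f: "real_polynomial_function f" and "open S" "x \<in> S" "\<And>y. y \<in> S \<Longrightarrow> f y \<le> f x"
  shows "laplacian f x \<le> 0"
proof -
  have "\<forall>\<^sub>F y in nhds x. (- 1) * f x \<le> (- 1) * f y"
    unfolding eventually_nhds using assms by auto
  from has_grad_lap_local_min_0(2)[OF has_grad_lap_cmult[OF polynomial_has_grad_lap[OF f]] this]
  show ?thesis by simp
qed

text \<open>The maximum principle in viscosity form: at an interior maximum of \<open>V - h\<close> a vertical shift of \<open>h\<close>
would be a forbidden test function.\<close>

lemma le_of_le_on_sphere:
  fixes V h :: "'a::euclidean_space \<Rightarrow> real"
  assumes V: "continuous_on (cball a s) V"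
    and sub: "\<And>\<phi> x. real_polynomial_function \<phi> \<Longrightarrow> x \<in> ball a s \<Longrightarrow> V x = \<phi> x \<Longrightarrow>
        (\<And>y. y \<in> ball a s \<Longrightarrow> V y \<le> \<phi> y) \<Longrightarrow> - laplacian \<phi> x \<le> A"
    and h: "real_polynomial_function h" "\<And>x. - laplacian h x > A"
    and bd: "\<And>x. x \<in> sphere a s \<Longrightarrow> V x \<le> h x"
    and x: "x \<in> cball a s"
  shows "V x \<le> h x"
proof -
  have "continuous_on (cball a s) h"
    using h(1) real_polynomial_function_eq continuous_on_polymonial_function by metis
  then have "continuous_on (cball a s) (\<lambda>x. V x - h x)" using V by (intro continuous_on_diff)
  from continuous_attains_sup[OF compact_cball _ this] x
  obtain \<xi> where \<xi>: "\<xi> \<in> cball a s" "\<And>y. y \<in> cball a s \<Longrightarrow> V y - h y \<le> V \<xi> - h \<xi>" by blast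
  have "\<xi> \<notin> ball a s"
  proof
    assume b: "\<xi> \<in> ball a s"
    define \<phi> where "\<phi> = (\<lambda>y. h y + (V \<xi> - h \<xi>))"
    have "- laplacian \<phi> \<xi> \<le> A"
    proof (rule sub)
      show "real_polynomial_function \<phi>" unfolding \<phi>_def by (intro real_polynomial_function.intros(2,3) h)
      show "V y \<le> \<phi> y" if "y \<in> ball a s" for y using \<xi>(2)[of y] that unfolding \<phi>_def by auto
    qed (use b in \<open>auto simp: \<phi>_def\<close>)
    moreover have "laplacian \<phi> \<xi> = laplacian h \<xi> + 0"
      unfolding \<phi>_def
      by (rule has_grad_lap_unique(2)[OF has_grad_lap_add[OF polynomial_has_grad_lap[OF h(1)] has_grad_lap_const]])
    ultimately show False using h(2)[of \<xi>] by simp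
  qed
  then have "\<xi> \<in> sphere a s" using \<xi>(1) by auto
  with bd \<xi>(2)[OF x] show ?thesis by force
qed

text \<open>In viscosity form \<open>- \<Delta>V \<le> A < B \<le> - \<Delta>W\<close>. If the functions were smooth, \<open>V - W\<close> would be strictly
subharmonic. In general \<open>V\<close> and \<open>- W\<close> are bounded from above by polynomials of constant Laplacian that
are accurate up to \<open>\<epsilon>\<close> on the sphere. The sum of the bounds is strictly subharmonic with a margin
independent of \<open>\<epsilon>\<close>.\<close>

lemma no_interior_max:
  fixes V W :: "'a::euclidean_space \<Rightarrow> real"
  assumes s: "s > 0" and V: "continuous_on (cball a s) V" and W: "continuous_on (cball a s) W"
    and max: "\<And>x. x \<in> cball a s \<Longrightarrow> V x - W x \<le> V a - W a"
    and sub: "\<And>\<phi> x. real_polynomial_function \<phi> \<Longrightarrow> x \<in> ball a s \<Longrightarrow> V x = \<phi> x \<Longrightarrow>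
        (\<And>y. y \<in> ball a s \<Longrightarrow> V y \<le> \<phi> y) \<Longrightarrow> - laplacian \<phi> x \<le> A"
    and super: "\<And>\<phi> x. real_polynomial_function \<phi> \<Longrightarrow> x \<in> ball a s \<Longrightarrow> W x = \<phi> x \<Longrightarrow>
        (\<And>y. y \<in> ball a s \<Longrightarrow> \<phi> y \<le> W y) \<Longrightarrow> B \<le> - laplacian \<phi> x"
    and AB: "A < B"
  shows False
proof -
  define n where "n = real DIM('a)"
  have n: "n > 0" unfolding n_def by (simp add: DIM_positive)
  \<comment> \<open>The gap \<open>B - A\<close> is shared: one part each makes the bounds on \<open>V\<close> and \<open>- W\<close> strict, one
    is the final gain, and two keep their sum strictly subharmonic.\<close>
  define \<gamma> where "\<gamma> = (B - A) / 5"
  have \<gamma>: "\<gamma> > 0" "B - A = 5 * \<gamma>" using AB by (auto simp: \<gamma>_def)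
  define \<epsilon> where "\<epsilon> = \<gamma> * s\<^sup>2 / (2 * n) / 5"
  have \<epsilon>: "\<epsilon> > 0" unfolding \<epsilon>_def using \<gamma> s n by simp
  define q where "q = (\<lambda>x. (1 / (2 * n)) * (s\<^sup>2 - (x - a) \<bullet> (x - a)))"
  have q: "real_polynomial_function q" "\<And>x. laplacian q x = - 1"
    unfolding q_def n_def using polynomial_paraboloid[of s a] by simp_all
  have q0: "q x = 0" if "x \<in> sphere a s" for x
    using that by (simp add: q_def dot_square_norm dist_norm norm_minus_commute)
  have qa: "q a = s\<^sup>2 / (2 * n)" by (simp add: q_def)
  obtain H1 where H1: "real_polynomial_function H1" "\<And>x. laplacian H1 x = 0"
    "\<And>x. x \<in> sphere a s \<Longrightarrow> \<bar>H1 x - V x\<bar> < \<epsilon>"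
    using harmonic_polynomial_approx[OF continuous_on_subset[OF V sphere_cball] \<epsilon>] by metis
  obtain H2 where H2: "real_polynomial_function H2" "\<And>x. laplacian H2 x = 0"
    "\<And>x. x \<in> sphere a s \<Longrightarrow> \<bar>H2 x - W x\<bar> < \<epsilon>"
    using harmonic_polynomial_approx[OF continuous_on_subset[OF W sphere_cball] \<epsilon>] by metis
  have P: "real_polynomial_function (\<lambda>x. c * h x + (d * q x + e))" if "real_polynomial_function h" for c d e h
    by (intro real_polynomial_function.intros(2,3,4) that q)
  have L: "laplacian (\<lambda>x. c * h x + (d * q x + e)) x = c * laplacian h x - d" if "real_polynomial_function h" for c d e h x
  proof -
    have "has_grad_lap (\<lambda>x. c * h x + (d * q x + e)) x (c *\<^sub>R grad h x + (d *\<^sub>R grad q x + 0))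
        (c * laplacian h x + (d * laplacian q x + 0))"
      by (intro has_grad_lap_add has_grad_lap_cmult has_grad_lap_const polynomial_has_grad_lap that q)
    from has_grad_lap_unique(2)[OF this] show ?thesis using q(2) by simp
  qed
  have V1: "V x \<le> 1 * H1 x + ((A + \<gamma>) * q x + \<epsilon>)" if "x \<in> cball a s" for x
  proof (rule le_of_le_on_sphere[OF V sub _ _ _ that])
    show "V y \<le> 1 * H1 y + ((A + \<gamma>) * q y + \<epsilon>)" if "y \<in> sphere a s" for y
      using H1(3)[OF that] q0[OF that] by simp
    show "real_polynomial_function (\<lambda>x. 1 * H1 x + ((A + \<gamma>) * q x + \<epsilon>))" by (rule P[OF H1(1)])
    show "A < - laplacian (\<lambda>x. 1 * H1 x + ((A + \<gamma>) * q x + \<epsilon>)) x" for x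
      unfolding L[OF H1(1)] using H1(2) \<gamma> by simp
  qed
  have W1: "- W x \<le> (- 1) * H2 x + ((- B + \<gamma>) * q x + \<epsilon>)" if "x \<in> cball a s" for x
  proof (rule le_of_le_on_sphere[of a s "\<lambda>x. - W x" "- B", OF _ _ _ _ _ that])
    show "- W y \<le> (- 1) * H2 y + ((- B + \<gamma>) * q y + \<epsilon>)" if "y \<in> sphere a s" for y
      using H2(3)[OF that] q0[OF that] by simp
    show "continuous_on (cball a s) (\<lambda>x. - W x)" using W by (intro continuous_on_minus)
    fix \<phi> x assume \<phi>: "real_polynomial_function \<phi>" "x \<in> ball a s" "- W x = \<phi> x"
      "\<And>y. y \<in> ball a s \<Longrightarrow> - W y \<le> \<phi> y"
    have "B \<le> - laplacian (\<lambda>x. (- 1) * \<phi> x) x"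
    proof (rule super)
      show "real_polynomial_function (\<lambda>x. (- 1) * \<phi> x)" by (intro real_polynomial_function.intros \<phi>)
      show "(- 1) * \<phi> y \<le> W y" if "y \<in> ball a s" for y using \<phi>(4)[OF that] by simp
    qed (use \<phi> in auto)
    also have "laplacian (\<lambda>x. (- 1) * \<phi> x) x = (- 1) * laplacian \<phi> x"
      by (rule has_grad_lap_unique(2)[OF has_grad_lap_cmult[OF polynomial_has_grad_lap[OF \<phi>(1)]]])
    finally show "- laplacian \<phi> x \<le> - B" by simp
  qed (use \<gamma> P[OF H2(1), of "- 1" "- B + \<gamma>" \<epsilon>] L[OF H2(1), of "- 1" "- B + \<gamma>" \<epsilon>] H2(2) in auto)
  \<comment> \<open>The sum of the two bounds is strictly subharmonic, even after adding \<open>\<gamma> q\<close>.\<close>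
  define k where "k = (\<lambda>x. 1 * (1 * H1 x + (-1) * H2 x) + ((A - B + 3 * \<gamma>) * q x + 2 * \<epsilon>))"
  have kp: "real_polynomial_function (\<lambda>x. 1 * H1 x + (-1) * H2 x)"
    by (intro real_polynomial_function.intros(2,3,4) H1 H2)
  have k: "real_polynomial_function k" "\<And>x. laplacian k x = B - A - 3 * \<gamma>"
    unfolding k_def L[OF kp] laplacian_linear_combination[OF H1(1) H2(1)] H1(2) H2(2) by (rule P[OF kp], simp)
  have "V a - W a + \<gamma> * q a \<le> k a"
    using V1[of a] W1[of a] s by (simp add: k_def algebra_simps)
  also have "k a \<le> V a - W a + 4 * \<epsilon>"
  proof (rule le_of_le_on_sphere[of a s k "- (2 * \<gamma>)" "\<lambda>_. V a - W a + 4 * \<epsilon>"])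
    show "continuous_on (cball a s) k"
      using k(1) real_polynomial_function_eq continuous_on_polymonial_function by metis
    show "k x \<le> V a - W a + 4 * \<epsilon>" if "x \<in> sphere a s" for x
      using H1(3)[OF that] H2(3)[OF that] q0[OF that] max[of x] that by (simp add: k_def)
    fix \<phi> x assume \<phi>: "real_polynomial_function \<phi>" "x \<in> ball a s" "k x = \<phi> x"
      "\<And>y. y \<in> ball a s \<Longrightarrow> k y \<le> \<phi> y"
    have "laplacian (\<lambda>x. 1 * k x + (-1) * \<phi> x) x \<le> 0"
      by (rule polynomial_interior_max[where S="ball a s"])
        (use \<phi> k in \<open>auto intro!: real_polynomial_function.intros(2) real_polynomial_function_diff\<close>)
    then show "- laplacian \<phi> x \<le> - (2 * \<gamma>)"
      unfolding laplacian_linear_combination[OF k(1) \<phi>(1)] using k(2) \<gamma>(2) by simp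
  next
    fix x :: 'a
    show "- (2 * \<gamma>) < - laplacian (\<lambda>_. V a - W a + 4 * \<epsilon>) x"
      using has_grad_lap_unique(2)[OF has_grad_lap_const, of _ x] \<gamma>(1) by simp
  qed (use s in \<open>auto intro: real_polynomial_function.intros\<close>)
  finally have "\<gamma> * (s\<^sup>2 / (2 * n)) \<le> 4 * \<epsilon>" unfolding qa by simp
  then show False using \<epsilon> by (simp add: \<epsilon>_def)
qed

section \<open>Viscosity tests\<close>

lemma viscosity_subsolution_test:
  assumes "viscosity_subsolution r \<Omega> u" "open \<Omega>" "x \<in> \<Omega>" "\<rho> > 0" "smooth_on (ball x \<rho>) \<phi>"
    "u x = \<phi> x" "\<forall>\<^sub>F y in nhds x. u y \<le> \<phi> y"
  shows "pde_op r \<phi> x \<le> 0"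
proof -
  obtain e where e: "e > 0" "ball x e \<subseteq> \<Omega>" using assms(2,3) openE by blast
  obtain d where d: "d > 0" "\<And>y. dist y x < d \<Longrightarrow> u y \<le> \<phi> y"
    using assms(7) unfolding eventually_nhds_metric by blast
  define s where "s = min \<rho> (min e d)"
  have s: "s > 0" "ball x s \<subseteq> ball x \<rho>" "ball x s \<subseteq> \<Omega>" "\<And>y. y \<in> ball x s \<Longrightarrow> u y \<le> \<phi> y"
    using e d assms(4) by (auto simp: s_def dist_commute)
  show ?thesis
    using assms(1) s smooth_on_subset[OF assms(5) s(2)] assms(6)
    unfolding viscosity_subsolution_def by (metis diff_self diff_le_0_iff_le)
qed

lemma viscosity_supersolution_test:
  assumes "viscosity_supersolution r \<Omega> u" "open \<Omega>" "x \<in> \<Omega>" "\<rho> > 0" "smooth_on (ball x \<rho>) \<phi>"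
    "u x = \<phi> x" "\<forall>\<^sub>F y in nhds x. \<phi> y \<le> u y"
  shows "pde_op r \<phi> x \<ge> 0"
proof -
  obtain e where e: "e > 0" "ball x e \<subseteq> \<Omega>" using assms(2,3) openE by blast
  obtain d where d: "d > 0" "\<And>y. dist y x < d \<Longrightarrow> \<phi> y \<le> u y"
    using assms(7) unfolding eventually_nhds_metric by blast
  define s where "s = min \<rho> (min e d)"
  have s: "s > 0" "ball x s \<subseteq> ball x \<rho>" "ball x s \<subseteq> \<Omega>" "\<And>y. y \<in> ball x s \<Longrightarrow> \<phi> y \<le> u y"
    using e d assms(4) by (auto simp: s_def dist_commute)
  show ?thesis
    using assms(1) s smooth_on_subset[OF assms(5) s(2)] assms(6)
    unfolding viscosity_supersolution_def by (metis diff_self diff_ge_0_iff_ge)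
qed

section \<open>Sup-convolutions\<close>

lemma sup_convolution:
  fixes v :: "'a::euclidean_space \<Rightarrow> real"
  assumes K: "compact K" "K \<noteq> {}" and v: "continuous_on K v" and k: "k \<ge> 0"
  obtains V where "\<And>x. \<exists>y\<in>K. V x = v y - k * (norm (x - y))\<^sup>2"
    "\<And>x y. y \<in> K \<Longrightarrow> v y - k * (norm (x - y))\<^sup>2 \<le> V x" "\<And>a s. continuous_on (cball a s) V"
proof -
  have "\<exists>y\<in>K. \<forall>z\<in>K. v z - k * (norm (x - z))\<^sup>2 \<le> v y - k * (norm (x - y))\<^sup>2" for x
    by (intro continuous_attains_sup K continuous_intros v)
  then obtain Y where Y: "\<And>x. Y x \<in> K"
    "\<And>x z. z \<in> K \<Longrightarrow> v z - k * (norm (x - z))\<^sup>2 \<le> v (Y x) - k * (norm (x - Y x))\<^sup>2" by metis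
  define V where "V x = v (Y x) - k * (norm (x - Y x))\<^sup>2" for x
  show thesis
  proof
    show "\<exists>y\<in>K. V x = v y - k * (norm (x - y))\<^sup>2" for x using Y V_def by blast
    show Vge: "v y - k * (norm (x - y))\<^sup>2 \<le> V x" if "y \<in> K" for x y using Y(2)[OF that] V_def by simp
    show "continuous_on (cball a s) V" for a s
    proof -
      obtain R where R: "R > 0" "\<And>x. x \<in> K \<Longrightarrow> norm (a - x) \<le> R"
      proof -
        obtain R0 where "R0 > 0" "\<And>x. x \<in> K \<Longrightarrow> norm x \<le> R0"
          using compact_imp_bounded[OF K(1)] unfolding bounded_pos by blast
        then show thesis
          using that[of "norm a + R0"] norm_triangle_ineq4[of a] by (smt (verit) norm_ge_zero)
      qed
      have one: "V x - V y \<le> (k * (2 * (R + s))) * dist x y" if x: "x \<in> cball a s" and y: "y \<in> cball a s" for x y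
      proof -
        have "V x - V y \<le> k * ((norm (y - Y x))\<^sup>2 - (norm (x - Y x))\<^sup>2)"
          using Vge[OF Y(1), of x y] by (simp add: V_def algebra_simps)
        also have "(norm (y - Y x))\<^sup>2 - (norm (x - Y x))\<^sup>2
            = (norm (y - Y x) + norm (x - Y x)) * (norm (y - Y x) - norm (x - Y x))"
          by (simp add: power2_eq_square algebra_simps)
        also have "\<dots> \<le> (2 * (R + s)) * dist x y"
        proof (rule order_trans[OF mult_left_mono mult_right_mono])
          have a: "norm (z - Y x) \<le> R + s" if "z \<in> cball a s" for z
          proof -
            have "norm (z - Y x) \<le> norm (a - z) + norm (a - Y x)"
              using norm_triangle_ineq[of "- (a - z)" "a - Y x"] by (simp add: norm_minus_commute)
            then show ?thesis using R(2)[OF Y(1), of x] that by (auto simp: dist_norm)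
          qed
          show "norm (y - Y x) + norm (x - Y x) \<le> 2 * (R + s)" using a[OF x] a[OF y] by simp
          show "norm (y - Y x) - norm (x - Y x) \<le> dist x y"
            using norm_triangle_ineq2[of "y - Y x" "x - Y x"] by (simp add: dist_norm norm_minus_commute)
        qed auto
        finally show ?thesis using k by (simp add: mult_left_mono mult.assoc)
      qed
      have "(k * (2 * (R + s)))-lipschitz_on (cball a s) V" if "s \<ge> 0"
      proof (rule lipschitz_onI)
        show "dist (V x) (V y) \<le> k * (2 * (R + s)) * dist x y" if "x \<in> cball a s" "y \<in> cball a s" for x y
          using one[OF that] one[OF that(2,1)] by (simp add: dist_real_def dist_commute)
        show "0 \<le> k * (2 * (R + s))" using k R that by simp
      qed
      then show ?thesis by (cases "s \<ge> 0") (auto intro: lipschitz_on_continuous_on)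
    qed
  qed
qed

text \<open>Testing from above at \<open>x\<close> transfers to testing \<open>v\<close> at the point \<open>y\<close> where the supremum is attained,
by translation. Moreover \<open>V\<close> lies above a paraboloid centred at \<open>y\<close> that it meets at \<open>x\<close>; this leaves only
one possible gradient, and it shows how far \<open>y\<close> is from \<open>x\<close>.\<close>

lemma sup_convolution_test:
  fixes v V :: "'a::euclidean_space \<Rightarrow> real"
  assumes V: "\<And>x y. y \<in> K \<Longrightarrow> v y - k * (norm (x - y))\<^sup>2 \<le> V x"
    and y: "y \<in> \<Omega>" "open \<Omega>" "\<Omega> \<subseteq> K" "V x = v y - k * (norm (x - y))\<^sup>2"
    and \<phi>: "real_polynomial_function \<phi>" and S: "open S" "x \<in> S" "V x = \<phi> x" "\<And>z. z \<in> S \<Longrightarrow> V z \<le> \<phi> z"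
    and v: "\<And>\<psi>. real_polynomial_function \<psi> \<Longrightarrow> v y = \<psi> y \<Longrightarrow> \<forall>\<^sub>F z in nhds y. v z \<le> \<psi> z \<Longrightarrow>
       Q (grad \<psi> y) (laplacian \<psi> y)"
  shows "Q (grad \<phi> x) (laplacian \<phi> x)" "grad \<phi> x = (2 * k) *\<^sub>R (y - x)"
proof -
  define \<psi> where "\<psi> = (\<lambda>z. \<phi> (z + (x - y)) + k * (norm (x - y))\<^sup>2)"
  have hgl: "has_grad_lap \<psi> y (grad \<phi> x + 0) (laplacian \<phi> x + 0)"
    unfolding \<psi>_def
    by (intro has_grad_lap_add has_grad_lap_const has_grad_lap_translate)
      (use polynomial_has_grad_lap[OF \<phi>, of x] in simp)
  have "Q (grad \<psi> y) (laplacian \<psi> y)"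
  proof (rule v)
    show "real_polynomial_function \<psi>"
      unfolding \<psi>_def by (intro real_polynomial_function.intros(2,3) real_polynomial_function_translate \<phi>)
    show "v y = \<psi> y" using y S by (simp add: \<psi>_def)
    have "filterlim (\<lambda>z. z + (x - y)) (nhds (y + (x - y))) (nhds y)"
      by (intro tendsto_add filterlim_ident tendsto_const)
    moreover have "\<forall>\<^sub>F z in nhds (y + (x - y)). z \<in> S"
      using S eventually_nhds by auto
    ultimately have "\<forall>\<^sub>F z in nhds y. z + (x - y) \<in> S"
      by (rule eventually_compose_filterlim[rotated])
    moreover have "\<forall>\<^sub>F z in nhds y. z \<in> \<Omega>" using y eventually_nhds by blast
    ultimately show "\<forall>\<^sub>F z in nhds y. v z \<le> \<psi> z"
    proof eventually_elim
      case (elim z)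
      then show ?case using V[of z "z + (x - y)"] S(4)[of "z + (x - y)"] y(3) by (auto simp: \<psi>_def)
    qed
  qed
  then show "Q (grad \<phi> x) (laplacian \<phi> x)" using has_grad_lap_unique[OF hgl] by simp
  have t: "has_grad_lap (\<lambda>z. (z + - y) \<bullet> (z + - y)) x (2 *\<^sub>R (x + - y)) (2 * DIM('a))"
    by (rule has_grad_lap_translate[OF has_grad_lap_dot_self])
  have "grad \<phi> x + k *\<^sub>R (2 *\<^sub>R (x + - y)) = 0"
  proof (rule has_grad_lap_local_min_0(1)[OF has_grad_lap_add[OF polynomial_has_grad_lap[OF \<phi>] has_grad_lap_cmult[OF t]]])
    have "\<forall>\<^sub>F z in nhds x. z \<in> S" using S eventually_nhds by blast
    then show "\<forall>\<^sub>F z in nhds x. \<phi> x + k * ((x + - y) \<bullet> (x + - y)) \<le> \<phi> z + k * ((z + - y) \<bullet> (z + - y))"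
    proof eventually_elim
      case (elim z)
      then show ?case using V[of y z] S(3) S(4)[of z] y by (auto simp: power2_norm_eq_inner)
    qed
  qed
  then show "grad \<phi> x = (2 * k) *\<^sub>R (y - x)" by (simp add: algebra_simps add_eq_0_iff2)
qed

section \<open>The comparison principle\<close>

text \<open>The hypothesis is what remains of the maximality of \<open>(y0, z0)\<close> for the doubled function and of \<open>y\<close> for
the sup-convolution at \<open>x\<close> when the values of the two functions are eliminated; \<open>a\<close> is the midpoint
of \<open>y0\<close> and \<open>z0\<close>. So the maximizers depend on the base point in a Lipschitz way near \<open>a\<close>.\<close>

lemma maximizer_displacement_le:
  fixes x y a :: "'a::euclidean_space"
  assumes "2 * (norm (x - y))\<^sup>2 - (norm (y - z0))\<^sup>2 \<le> 2 * (norm (x - y0))\<^sup>2 - (norm (y0 - z0))\<^sup>2"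
    and a: "z0 = 2 *\<^sub>R a - y0"
  shows "norm (y - y0) \<le> 4 * norm (x - a)"
proof -
  define b h where "b = y - y0" and "h = x - a"
  have e: "y = y0 + b" "x = a + h" by (auto simp: b_def h_def)
  have "b \<bullet> b \<le> 4 * (b \<bullet> h)"
    using assms(1) unfolding a e power2_norm_eq_inner
    by (simp add: inner_add_left inner_add_right inner_diff_left inner_diff_right inner_commute algebra_simps)
  also have "b \<bullet> h \<le> norm b * norm h" by (rule norm_cauchy_schwarz)
  finally have "norm b * norm b \<le> norm b * (4 * norm h)" by (simp add: dot_square_norm power2_eq_square)
  then have "norm b \<le> 4 * norm h" by (cases "norm b = 0") auto
  then show ?thesis by (simp add: b_def h_def)
qed

text \<open>Equality holds at the midpoint \<open>x\<close>: minimising the two quadratic penalties over \<open>x\<close> gives the penalty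
of the doubled variables.\<close>

lemma parallelogram_ge:
  fixes x y z :: "'a::euclidean_space"
  shows "(norm (y - z))\<^sup>2 \<le> 2 * ((norm (x - y))\<^sup>2 + (norm (x - z))\<^sup>2)"
proof -
  have "2 * ((norm (x - y))\<^sup>2 + (norm (x - z))\<^sup>2) - (norm (y - z))\<^sup>2 = (norm ((x - y) + (x - z)))\<^sup>2"
    unfolding power2_norm_eq_inner
    by (simp add: inner_add_left inner_add_right inner_diff_left inner_diff_right inner_commute algebra_simps)
  then show ?thesis by (smt (verit) zero_le_power2)
qed

text \<open>The sup-convolution of \<open>v\<close> minus the inf-convolution of \<open>w\<close> has its maximum at the midpoint of a
maximizing pair of the doubled function. Near that midpoint the slopes of the sup-convolution
exceed one, so both convolutions satisfy Poisson inequalities there, and \<open>no_interior_max\<close> applies.\<close>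

lemma comparison_strict:
  fixes v w :: "'a::euclidean_space \<Rightarrow> real"
  assumes \<Omega>: "open \<Omega>" "bounded \<Omega>"
    and v: "continuous_on (closure \<Omega>) v" and w: "continuous_on (closure \<Omega>) w"
    and sub: "\<And>\<phi> x. real_polynomial_function \<phi> \<Longrightarrow> x \<in> \<Omega> \<Longrightarrow> v x = \<phi> x \<Longrightarrow> \<forall>\<^sub>F y in nhds x. v y \<le> \<phi> y \<Longrightarrow>
        - laplacian \<phi> x \<le> A \<or> norm (grad \<phi> x) \<le> 1"
    and super: "\<And>\<phi> x. real_polynomial_function \<phi> \<Longrightarrow> x \<in> \<Omega> \<Longrightarrow> w x = \<phi> x \<Longrightarrow> \<forall>\<^sub>F y in nhds x. \<phi> y \<le> w y \<Longrightarrow>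
        B \<le> - laplacian \<phi> x \<and> norm (grad \<phi> x) \<ge> 1 + \<delta>"
    and AB: "A < B" and \<delta>: "\<delta> > 0"
    and x0: "x0 \<in> closure \<Omega>" and max: "\<And>y. y \<in> closure \<Omega> \<Longrightarrow> v y - w y \<le> v x0 - w x0"
    and bd: "\<And>y. y \<in> frontier \<Omega> \<Longrightarrow> v y - w y < v x0 - w x0"
  shows False
proof -
  define K where "K = closure \<Omega>"
  have K: "compact K" "K \<noteq> {}" "K = \<Omega> \<union> frontier \<Omega>" "\<Omega> \<subseteq> K"
  proof -
    show "compact K" using \<Omega> by (simp add: K_def)
    show "K \<noteq> {}" using x0 unfolding K_def by (metis empty_iff)
  qed (simp_all add: K_def closure_subset flip: closure_Un_frontier)
  define m where "m = v x0 - w x0"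
  \<comment> \<open>the boundary values stay away from the maximum\<close>
  obtain \<sigma> where \<sigma>: "\<sigma> > 0" "\<And>y. y \<in> frontier \<Omega> \<Longrightarrow> v y - w y \<le> m - \<sigma>"
  proof (cases "frontier \<Omega> = {}")
    case True
    then show thesis using that[of 1] by simp
  next
    case False
    have "compact (frontier \<Omega>)" using \<Omega> by (simp add: compact_frontier_bounded)
    moreover have "continuous_on (frontier \<Omega>) (\<lambda>y. v y - w y)"
      by (intro continuous_on_diff continuous_on_subset[OF v] continuous_on_subset[OF w]) (auto simp: frontier_def)
    ultimately obtain \<xi> where \<xi>: "\<xi> \<in> frontier \<Omega>" "\<forall>y\<in>frontier \<Omega>. v y - w y \<le> v \<xi> - w \<xi>"
      using continuous_attains_sup[OF _ False] by blast
    show thesis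
    proof (rule that[of "m - (v \<xi> - w \<xi>)"])
      show "m - (v \<xi> - w \<xi>) > 0" using bd[OF \<xi>(1)] by (simp add: m_def)
      show "v y - w y \<le> m - (m - (v \<xi> - w \<xi>))" if "y \<in> frontier \<Omega>" for y using \<xi>(2) that by simp
    qed
  qed
  obtain \<tau>1 where \<tau>1: "\<tau>1 > 0" "\<And>y z. y \<in> K \<Longrightarrow> z \<in> K \<Longrightarrow> dist z y < \<tau>1 \<Longrightarrow> dist (v z) (v y) < \<sigma>"
    using compact_uniformly_continuous[OF v] K(1) \<sigma>(1) unfolding K_def uniformly_continuous_on_def by metis
  obtain \<tau>2 where \<tau>2: "\<tau>2 > 0" "\<And>y z. y \<in> K \<Longrightarrow> z \<in> K \<Longrightarrow> dist z y < \<tau>2 \<Longrightarrow> dist (w z) (w y) < \<sigma>"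
    using compact_uniformly_continuous[OF w] K(1) \<sigma>(1) unfolding K_def uniformly_continuous_on_def by metis
  define \<tau> where "\<tau> = min \<tau>1 \<tau>2"
  have \<tau>: "\<tau> > 0" "\<And>y z. y \<in> K \<Longrightarrow> z \<in> K \<Longrightarrow> dist y z < \<tau> \<Longrightarrow> \<bar>v y - v z\<bar> < \<sigma> \<and> \<bar>w y - w z\<bar> < \<sigma>"
    using \<tau>1 \<tau>2 unfolding \<tau>_def dist_real_def by auto
  have "bounded (v ` K)" "bounded (w ` K)"
    using v w K(1) unfolding K_def by (auto intro!: compact_imp_bounded compact_continuous_image)
  then obtain M1 M2 where M: "\<And>y. y \<in> K \<Longrightarrow> \<bar>v y\<bar> \<le> M1" "\<And>y. y \<in> K \<Longrightarrow> \<bar>w y\<bar> \<le> M2"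
    unfolding bounded_iff by auto
  define N where "N = \<bar>M1\<bar> + \<bar>M2\<bar> + \<bar>m\<bar> + 1"
  have N: "N > 0" unfolding N_def by simp
  \<comment> \<open>a penalty so large that maximizing pairs are closer than \<open>\<tau>\<close>\<close>
  define k where "k = 4 * N / \<tau>\<^sup>2"
  have k: "k > 0" "k * \<tau>\<^sup>2 = 4 * N" unfolding k_def using N \<tau> by auto
  have "\<exists>p\<in>K \<times> K. \<forall>q\<in>K \<times> K. (v (fst q) - w (snd q)) - k / 2 * (norm (fst q - snd q))\<^sup>2
      \<le> (v (fst p) - w (snd p)) - k / 2 * (norm (fst p - snd p))\<^sup>2"
    using v w K unfolding K_def[symmetric]
    by (intro continuous_attains_sup compact_Times continuous_intros
        continuous_on_compose2[of K v _ fst] continuous_on_compose2[of K w _ snd]) auto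
  then obtain y0 z0 where yz: "y0 \<in> K" "z0 \<in> K"
    "\<And>y z. y \<in> K \<Longrightarrow> z \<in> K \<Longrightarrow> v y - w z - k / 2 * (norm (y - z))\<^sup>2 \<le> v y0 - w z0 - k / 2 * (norm (y0 - z0))\<^sup>2"
    by fastforce
  have ge: "v y0 - w z0 \<ge> m + k / 2 * (norm (y0 - z0))\<^sup>2"
    using yz(3)[of x0 x0] x0 unfolding K_def m_def by simp
  have "dist y0 z0 < \<tau>"
  proof (rule ccontr)
    assume "\<not> dist y0 z0 < \<tau>"
    then have "\<tau>\<^sup>2 \<le> (norm (y0 - z0))\<^sup>2" using \<tau>(1) by (intro power_mono) (auto simp: dist_norm)
    then have "k * \<tau>\<^sup>2 \<le> k * (norm (y0 - z0))\<^sup>2" using k(1) by (simp add: mult_left_mono)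
    then show False using ge M[OF yz(1)] M(2)[OF yz(2)] k(2) N_def by simp
  qed
  note near = \<tau>(2)[OF yz(1,2) this]
  have kn: "k / 2 * (norm (y0 - z0))\<^sup>2 \<ge> 0" using k by simp
  have y0: "y0 \<in> \<Omega>"
  proof (rule ccontr)
    assume "y0 \<notin> \<Omega>"
    then have "v y0 - w y0 \<le> m - \<sigma>" using \<sigma>(2) yz(1) K(3) by blast
    then show False using near ge kn by linarith
  qed
  have z0: "z0 \<in> \<Omega>"
  proof (rule ccontr)
    assume "z0 \<notin> \<Omega>"
    then have "v z0 - w z0 \<le> m - \<sigma>" using \<sigma>(2) yz(2) K(3) by blast
    then show False using near ge kn by linarith
  qed
  \<comment> \<open>the test at \<open>z0\<close> shows that the common slope exceeds one\<close>
  define \<phi> where "\<phi> = (\<lambda>z. (- (k / 2)) * ((z + - y0) \<bullet> (z + - y0)) + (w z0 + k / 2 * (norm (y0 - z0))\<^sup>2))"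
  have \<phi>_hgl: "has_grad_lap \<phi> z0 ((- (k / 2)) *\<^sub>R (2 *\<^sub>R (z0 + - y0)) + 0) ((- (k / 2)) * (2 * DIM('a)) + 0)"
    unfolding \<phi>_def
    by (intro has_grad_lap_add has_grad_lap_cmult has_grad_lap_const has_grad_lap_translate[OF has_grad_lap_dot_self])
  have "norm (grad \<phi> z0) \<ge> 1 + \<delta>"
  proof (rule conjunct2[OF super])
    show "real_polynomial_function \<phi>" unfolding \<phi>_def
      by (intro real_polynomial_function.intros(2,3,4) real_polynomial_function_translate[OF polynomial_dot_self])
    show "w z0 = \<phi> z0" by (simp add: \<phi>_def power2_norm_eq_inner norm_minus_commute[of y0])
    have "\<forall>\<^sub>F y in nhds z0. y \<in> \<Omega>" using \<Omega> z0 eventually_nhds by blast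
    then show "\<forall>\<^sub>F y in nhds z0. \<phi> y \<le> w y"
    proof eventually_elim
      case (elim y)
      then show ?case using yz(3)[OF yz(1), of y] K(4)
        by (auto simp: \<phi>_def power2_norm_eq_inner inner_diff_left inner_diff_right inner_commute algebra_simps)
    qed
  qed (rule z0)
  then have slope: "k * norm (z0 - y0) \<ge> 1 + \<delta>"
    using has_grad_lap_unique(1)[OF \<phi>_hgl] k by simp
  define a where "a = (1 / 2) *\<^sub>R (y0 + z0)"
  have a: "z0 = 2 *\<^sub>R a - y0" "y0 = 2 *\<^sub>R a - z0" "2 *\<^sub>R (a - y0) = z0 - y0"
    by (auto simp: a_def algebra_simps scaleR_2)
  have nay: "2 * norm (a - y0) = norm (z0 - y0)" "2 * norm (a - z0) = norm (z0 - y0)"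
  proof -
    show "2 * norm (a - y0) = norm (z0 - y0)" using arg_cong[OF a(3), of norm] by simp
    have "2 *\<^sub>R (a - z0) = - (z0 - y0)" by (simp add: a_def algebra_simps scaleR_2)
    from arg_cong[OF this, of norm] show "2 * norm (a - z0) = norm (z0 - y0)"
      by (simp add: norm_minus_commute)
  qed
  obtain e1 where e1: "e1 > 0" "ball y0 e1 \<subseteq> \<Omega>" using \<Omega> y0 openE by blast
  obtain e2 where e2: "e2 > 0" "ball z0 e2 \<subseteq> \<Omega>" using \<Omega> z0 openE by blast
  \<comment> \<open>the maximizers move by at most \<open>4 s\<close>, so they stay inside \<open>\<Omega>\<close> and lose less than \<open>\<delta>\<close> of the slope\<close>
  define s where "s = min (min e1 e2 / 4) (\<delta> / (20 * k))"
  have s: "s > 0" "4 * s \<le> e1" "4 * s \<le> e2" "10 * k * s < \<delta>"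
  proof -
    show "s > 0" unfolding s_def using e1 e2 \<delta> k by simp
    show "4 * s \<le> e1" "4 * s \<le> e2" unfolding s_def by auto
    have "10 * k * s \<le> 10 * k * (\<delta> / (20 * k))" unfolding s_def using k by (intro mult_left_mono) auto
    also have "\<dots> < \<delta>" using k \<delta> by (simp add: field_simps)
    finally show "10 * k * s < \<delta>" .
  qed
  have w': "continuous_on K (\<lambda>x. - w x)" using w unfolding K_def by (intro continuous_on_minus)
  obtain V where V: "\<And>x. \<exists>y\<in>K. V x = v y - k * (norm (x - y))\<^sup>2"
    "\<And>x y. y \<in> K \<Longrightarrow> v y - k * (norm (x - y))\<^sup>2 \<le> V x" "\<And>a s. continuous_on (cball a s) V"
    using sup_convolution[OF K(1,2) v[folded K_def], of k] k by auto
  obtain U where U: "\<And>x. \<exists>y\<in>K. U x = - w y - k * (norm (x - y))\<^sup>2"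
    "\<And>x y. y \<in> K \<Longrightarrow> - w y - k * (norm (x - y))\<^sup>2 \<le> U x" "\<And>a s. continuous_on (cball a s) U"
    using sup_convolution[OF K(1,2) w', of k] k by auto
  show False
  proof (rule no_interior_max[OF s(1) V(3), where W="\<lambda>x. - U x" and A=A and B=B])
    show "continuous_on (cball a s) (\<lambda>x. - U x)" using U(3) by (intro continuous_on_minus)
    show "A < B" by (rule AB)
  next
    fix x
    obtain y z where y: "y \<in> K" "V x = v y - k * (norm (x - y))\<^sup>2" and z: "z \<in> K" "U x = - w z - k * (norm (x - z))\<^sup>2"
      using V(1) U(1) by metis
    have "V x + U x = v y - w z - k * ((norm (x - y))\<^sup>2 + (norm (x - z))\<^sup>2)"
      using y z by (simp add: algebra_simps)
    also have "\<dots> \<le> v y - w z - k / 2 * (norm (y - z))\<^sup>2"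
      using mult_left_mono[OF parallelogram_ge[of y z x], of "k / 2"] k(1) by (simp add: algebra_simps)
    also have "\<dots> \<le> v y0 - w z0 - k / 2 * (norm (y0 - z0))\<^sup>2" by (rule yz(3)[OF y(1) z(1)])
    also have "\<dots> = v y0 - w z0 - k * ((norm (a - y0))\<^sup>2 + (norm (a - z0))\<^sup>2)"
    proof -
      have "norm (a - z0) = norm (a - y0)" "norm (y0 - z0) = 2 * norm (a - y0)"
        using nay by (simp_all add: norm_minus_commute)
      then show ?thesis by (simp add: power_mult_distrib)
    qed
    also have "\<dots> \<le> V a + U a" using V(2)[OF yz(1), of a] U(2)[OF yz(2), of a] by (simp add: algebra_simps)
    finally show "V x - - U x \<le> V a - - U a" by simp
  next
    fix \<phi> x assume \<phi>: "real_polynomial_function \<phi>" "x \<in> ball a s" "V x = \<phi> x" "\<And>y. y \<in> ball a s \<Longrightarrow> V y \<le> \<phi> y"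
    obtain y where y: "y \<in> K" "V x = v y - k * (norm (x - y))\<^sup>2" using V(1) by metis
    have "k * (2 * (norm (x - y))\<^sup>2 - (norm (y - z0))\<^sup>2) \<le> k * (2 * (norm (x - y0))\<^sup>2 - (norm (y0 - z0))\<^sup>2)"
      using V(2)[OF yz(1), of x] y(2) yz(3)[OF y(1) yz(2)] by (simp add: algebra_simps)
    then have ny: "norm (y - y0) \<le> 4 * norm (x - a)"
      using k by (intro maximizer_displacement_le[OF _ a(1)]) simp
    have nx: "norm (x - a) < s" using \<phi>(2) by (simp add: dist_norm norm_minus_commute)
    have "y \<in> ball y0 e1" using ny nx s by (simp add: dist_norm norm_minus_commute)
    then have y\<Omega>: "y \<in> \<Omega>" using e1 by blast
    note test = sup_convolution_test[OF V(2) y\<Omega> \<Omega>(1) K(4) y(2) \<phi>(1) open_ball \<phi>(2,3,4),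
          where Q="\<lambda>p L. - L \<le> A \<or> norm p \<le> 1"]
    have "- laplacian \<phi> x \<le> A \<or> norm (grad \<phi> x) \<le> 1" "grad \<phi> x = (2 * k) *\<^sub>R (y - x)"
      by (rule test; (assumption | rule sub[OF _ y\<Omega>]; assumption))+
    moreover have "norm ((2 * k) *\<^sub>R (y - x)) > 1"
    proof -
      have "norm (a - y0) \<le> norm (y - x) + norm (x - a) + norm (y - y0)"
        using norm_triangle_ineq4[of "y - y0" "(y - x) + (x - a)"] norm_triangle_ineq[of "y - x" "x - a"]
        by (simp add: algebra_simps)
      then have "norm (a - y0) \<le> norm (y - x) + 5 * s" using ny nx by linarith
      then have "2 * k * norm (a - y0) \<le> 2 * k * (norm (y - x) + 5 * s)" using k by (intro mult_left_mono) auto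
      moreover have "2 * k * norm (a - y0) \<ge> 1 + \<delta>" using slope nay(1) by (simp add: mult.assoc mult.left_commute)
      ultimately have "1 < 2 * k * norm (y - x)" using s(4) by (simp add: algebra_simps)
      then show ?thesis using k(1) by simp
    qed
    ultimately show "- laplacian \<phi> x \<le> A" by auto
  next
    fix \<phi> x assume \<phi>: "real_polynomial_function \<phi>" "x \<in> ball a s" "- U x = \<phi> x" "\<And>y. y \<in> ball a s \<Longrightarrow> \<phi> y \<le> - U y"
    have neg: "grad (\<lambda>x. - 1 * \<psi> x) y = - 1 *\<^sub>R grad \<psi> y" "laplacian (\<lambda>x. - 1 * \<psi> x) y = - 1 * laplacian \<psi> y"
      if "real_polynomial_function \<psi>" for \<psi> :: "'a \<Rightarrow> real" and y
      using has_grad_lap_unique[OF has_grad_lap_cmult[OF polynomial_has_grad_lap[OF that]]] by blast+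
    have P: "real_polynomial_function (\<lambda>x. - 1 * \<psi> x)" if "real_polynomial_function \<psi>" for \<psi> :: "'a \<Rightarrow> real"
      by (intro real_polynomial_function.intros(2,4) that)
    obtain y where y: "y \<in> K" "U x = - w y - k * (norm (x - y))\<^sup>2" using U(1) by metis
    have "k * (2 * (norm (x - y))\<^sup>2 - (norm (y - y0))\<^sup>2) \<le> k * (2 * (norm (x - z0))\<^sup>2 - (norm (z0 - y0))\<^sup>2)"
      using U(2)[OF yz(2), of x] y(2) yz(3)[OF yz(1) y(1)] by (simp add: norm_minus_commute algebra_simps)
    then have ny: "norm (y - z0) \<le> 4 * norm (x - a)"
      using k by (intro maximizer_displacement_le[OF _ a(2)]) simp
    have nx: "norm (x - a) < s" using \<phi>(2) by (simp add: dist_norm norm_minus_commute)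
    have "y \<in> ball z0 e2" using ny nx s by (simp add: dist_norm norm_minus_commute)
    then have y\<Omega>: "y \<in> \<Omega>" using e2 by blast
    have "B \<le> laplacian (\<lambda>x. - 1 * \<phi> x) x"
    proof (rule sup_convolution_test(1)[OF U(2) y\<Omega> \<Omega>(1) K(4) y(2) P[OF \<phi>(1)] open_ball \<phi>(2),
          where Q="\<lambda>p L. B \<le> L"])
      show "U x = - 1 * \<phi> x" using \<phi>(3) by simp
      show "U z \<le> - 1 * \<phi> z" if "z \<in> ball a s" for z using \<phi>(4)[OF that] by simp
      fix \<psi> assume \<psi>: "real_polynomial_function \<psi>" "- w y = \<psi> y" "\<forall>\<^sub>F z in nhds y. - w z \<le> \<psi> z"
      have "\<forall>\<^sub>F z in nhds y. - 1 * \<psi> z \<le> w z" using \<psi>(3) by eventually_elim simp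
      then show "B \<le> laplacian \<psi> y"
        using super[OF P[OF \<psi>(1)] y\<Omega>] \<psi>(2) neg(2)[OF \<psi>(1)] by auto
    qed
    then show "B \<le> - laplacian \<phi> x" unfolding neg[OF \<phi>(1)] by simp
  qed
qed

text \<open>It suffices to make \<open>w\<close> strict. Multiplying by \<open>1 + \<kappa>\<close> raises all slopes but gives no margin for the
Laplacian if \<open>r = 0\<close>; subtracting \<open>\<eta> |x|\<^sup>2\<close> supplies that margin and costs at most \<open>2 \<eta> R\<close> in the slope.\<close>

lemma comparison:
  fixes v w :: "'a::euclidean_space \<Rightarrow> real"
  assumes r: "r \<ge> 0" and \<Omega>: "open \<Omega>" "bounded \<Omega>"
    and v: "continuous_on (closure \<Omega>) v" and w: "continuous_on (closure \<Omega>) w"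
    and sub: "viscosity_subsolution r \<Omega> v" and super: "viscosity_supersolution r \<Omega> w"
    and bd: "\<And>x. x \<in> frontier \<Omega> \<Longrightarrow> v x \<le> w x + c"
    and x: "x \<in> closure \<Omega>"
  shows "v x \<le> w x + c"
proof (rule ccontr)
  assume "\<not> v x \<le> w x + c"
  define \<mu> where "\<mu> = v x - w x - c"
  have \<mu>: "\<mu> > 0" using \<open>\<not> v x \<le> w x + c\<close> by (simp add: \<mu>_def)
  have K: "compact (closure \<Omega>)" "closure \<Omega> \<noteq> {}" "\<Omega> \<subseteq> closure \<Omega>" using \<Omega> x closure_subset by auto
  have "bounded (w ` closure \<Omega>)"
    by (intro compact_imp_bounded compact_continuous_image w K)
  then obtain M where M: "M > 0" "\<And>y. y \<in> closure \<Omega> \<Longrightarrow> \<bar>w y\<bar> \<le> M"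
    unfolding bounded_pos by auto
  obtain R where R: "R > 0" "\<And>y. y \<in> closure \<Omega> \<Longrightarrow> norm y \<le> R"
    using compact_imp_bounded[OF K(1)] unfolding bounded_pos by auto
  define \<kappa> where "\<kappa> = \<mu> / (5 * M)"
  have \<kappa>: "\<kappa> > 0" "\<kappa> * M = \<mu> / 5" using \<mu> M by (auto simp: \<kappa>_def)
  define \<eta> where "\<eta> = min (\<kappa> / (4 * R)) (\<mu> / (5 * R\<^sup>2))"
  have \<eta>: "\<eta> > 0" "2 * \<eta> * R \<le> \<kappa> / 2" "\<eta> * R\<^sup>2 \<le> \<mu> / 5"
  proof -
    show "\<eta> > 0" using \<kappa> \<mu> R by (simp add: \<eta>_def)
    have "2 * \<eta> * R \<le> 2 * (\<kappa> / (4 * R)) * R" unfolding \<eta>_def using R by (intro mult_left_mono mult_right_mono) auto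
    then show "2 * \<eta> * R \<le> \<kappa> / 2" using R by simp
    have "\<eta> * R\<^sup>2 \<le> \<mu> / (5 * R\<^sup>2) * R\<^sup>2" unfolding \<eta>_def by (intro mult_right_mono) auto
    then show "\<eta> * R\<^sup>2 \<le> \<mu> / 5" using R by simp
  qed
  define w' where "w' = (\<lambda>y. (1 + \<kappa>) * w y - \<eta> * (y \<bullet> y))"
  have w'_near: "\<bar>w' y - w y\<bar> \<le> 2 * \<mu> / 5" if y: "y \<in> closure \<Omega>" for y
  proof -
    have "\<bar>\<kappa> * w y\<bar> \<le> \<mu> / 5"
      using mult_left_mono[OF M(2)[OF y], of \<kappa>] \<kappa> by (simp add: abs_mult)
    then have "\<kappa> * w y \<le> \<mu> / 5" "- (\<kappa> * w y) \<le> \<mu> / 5" by linarith+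
    moreover have "(norm y)\<^sup>2 \<le> R\<^sup>2" using R(2)[OF y] by (intro power_mono) auto
    then have "\<eta> * (y \<bullet> y) \<le> \<eta> * R\<^sup>2" using \<eta>(1) by (intro mult_left_mono) (auto simp: power2_norm_eq_inner)
    moreover have "\<eta> * (y \<bullet> y) \<ge> 0" using \<eta>(1) by simp
    ultimately have "\<bar>\<kappa> * w y - \<eta> * (y \<bullet> y)\<bar> \<le> 2 * \<mu> / 5" using \<eta>(3) by linarith
    then show ?thesis by (simp add: w'_def distrib_right)
  qed
  have w'_cont: "continuous_on (closure \<Omega>) w'"
    unfolding w'_def by (intro continuous_intros w)
  obtain x0 where x0: "x0 \<in> closure \<Omega>" "\<And>y. y \<in> closure \<Omega> \<Longrightarrow> v y - w' y \<le> v x0 - w' x0"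
    using continuous_attains_sup[OF K(1,2) continuous_on_diff[OF v w'_cont]] by metis
  show False
  proof (rule comparison_strict[OF \<Omega> v w'_cont _ _ _ _ x0, of r "r + 2 * \<eta> * DIM('a)" "\<kappa> / 2"])
    show "v y - w' y < v x0 - w' x0" if "y \<in> frontier \<Omega>" for y
    proof -
      have y: "y \<in> closure \<Omega>" using that by (simp add: frontier_def)
      have "v y - w' y \<le> c + 2 * \<mu> / 5" using bd[OF that] w'_near[OF y] by linarith
      also have "\<dots> < v x - w' x" using w'_near[OF x] \<mu> \<mu>_def by linarith
      also have "\<dots> \<le> v x0 - w' x0" by (rule x0(2)[OF x])
      finally show ?thesis .
    qed
    show "r < r + 2 * \<eta> * DIM('a)" using \<eta>(1) DIM_positive[where 'a='a] by simp
    show "\<kappa> / 2 > 0" using \<kappa> by simp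
  next
    fix \<phi> y assume \<phi>: "real_polynomial_function \<phi>" "y \<in> \<Omega>" "v y = \<phi> y" "\<forall>\<^sub>F z in nhds y. v z \<le> \<phi> z"
    have "pde_op r \<phi> y \<le> 0"
      by (rule viscosity_subsolution_test[OF sub \<Omega>(1) \<phi>(2) zero_less_one smooth_on_polynomial[OF \<phi>(1)] \<phi>(3,4)])
    then show "- laplacian \<phi> y \<le> r \<or> norm (grad \<phi> y) \<le> 1" unfolding pde_op_def by linarith
  next
    fix \<phi> y assume \<phi>: "real_polynomial_function \<phi>" "y \<in> \<Omega>" "w' y = \<phi> y" "\<forall>\<^sub>F z in nhds y. \<phi> z \<le> w' z"
    define \<psi> where "\<psi> = (\<lambda>z. (1 / (1 + \<kappa>)) * (\<phi> z + \<eta> * (z \<bullet> z)))"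
    have hgl: "has_grad_lap \<psi> y ((1 / (1 + \<kappa>)) *\<^sub>R (grad \<phi> y + \<eta> *\<^sub>R (2 *\<^sub>R y)))
        ((1 / (1 + \<kappa>)) * (laplacian \<phi> y + \<eta> * (2 * DIM('a))))"
      unfolding \<psi>_def
      by (intro has_grad_lap_cmult has_grad_lap_add polynomial_has_grad_lap[OF \<phi>(1)] has_grad_lap_dot_self)
    have "real_polynomial_function \<psi>" unfolding \<psi>_def
      by (intro real_polynomial_function.intros(2,3,4) \<phi> polynomial_dot_self)
    then have "smooth_on (ball y 1) \<psi>" by (rule smooth_on_polynomial)
    moreover have "w y = \<psi> y" using \<phi>(3)[symmetric] \<kappa> by (simp add: \<psi>_def w'_def)
    moreover have "\<forall>\<^sub>F z in nhds y. \<psi> z \<le> w z"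
      using \<phi>(4) by eventually_elim (use \<kappa> in \<open>simp add: \<psi>_def w'_def field_simps\<close>)
    ultimately have "pde_op r \<psi> y \<ge> 0"
      by (intro viscosity_supersolution_test[OF super \<Omega>(1) \<phi>(2) zero_less_one])
    then have 1: "r \<le> - ((1 / (1 + \<kappa>)) * (laplacian \<phi> y + \<eta> * (2 * DIM('a))))"
      and 2: "1 \<le> norm ((1 / (1 + \<kappa>)) *\<^sub>R (grad \<phi> y + \<eta> *\<^sub>R (2 *\<^sub>R y)))"
      unfolding pde_op_def has_grad_lap_unique[OF hgl] by auto
    have "r \<le> r * (1 + \<kappa>)" using r \<kappa> by (simp add: algebra_simps)
    also have "\<dots> \<le> - (laplacian \<phi> y + \<eta> * (2 * DIM('a)))"
      using 1 \<kappa> by (simp add: field_simps)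
    finally have "r + 2 * \<eta> * DIM('a) \<le> - laplacian \<phi> y" by simp
    moreover have "norm (grad \<phi> y) \<ge> 1 + \<kappa> / 2"
    proof -
      have "1 + \<kappa> \<le> norm (grad \<phi> y + \<eta> *\<^sub>R (2 *\<^sub>R y))"
        using 2 \<kappa> unfolding norm_scaleR by (simp add: pos_le_divide_eq)
      also have "\<dots> \<le> norm (grad \<phi> y) + 2 * \<eta> * norm y"
        using norm_triangle_ineq[of "grad \<phi> y" "\<eta> *\<^sub>R (2 *\<^sub>R y)"] \<eta>(1) by simp
      also have "2 * \<eta> * norm y \<le> 2 * \<eta> * R" using R(2)[of y] \<phi>(2) K(3) \<eta>(1) by (intro mult_left_mono) auto
      finally show ?thesis using \<eta>(2) by simp
    qed
    ultimately show "r + 2 * \<eta> * DIM('a) \<le> - laplacian \<phi> y \<and> 1 + \<kappa> / 2 \<le> norm (grad \<phi> y)" by simp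
  qed
qed

section \<open>Barriers at exterior cones\<close>

lemma has_grad_lap_isCont: "has_grad_lap f x p L \<Longrightarrow> isCont f x"
  unfolding has_grad_lap_def by (blast dest: eventually_nhds_x_imp_x has_derivative_continuous)

lemma has_grad_lap_norm_powr:
  fixes x :: "'a::euclidean_space"
  assumes x: "x \<noteq> 0"
  shows "has_grad_lap (\<lambda>y. norm y powr a) x ((a * norm x powr (a - 2)) *\<^sub>R x)
    (a * (a + DIM('a) - 2) * norm x powr (a - 2))"
proof -
  have p: "x \<bullet> x > 0" using x by simp
  have e: "\<forall>\<^sub>F s in nhds (x \<bullet> x). s > 0" using p
    by (metis eventually_nhds greaterThan_iff open_greaterThan)
  have h: "has_grad_lap (\<lambda>y. (y \<bullet> y) powr (a / 2)) x
     ((a / 2 * (x \<bullet> x) powr (a / 2 - 1)) *\<^sub>R (2 *\<^sub>R x))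
     ((a / 2 * (x \<bullet> x) powr (a / 2 - 1)) * (2 * DIM('a)) +
      (a / 2 * ((a / 2 - 1) * (x \<bullet> x) powr (a / 2 - 1 - 1))) * ((2 *\<^sub>R x) \<bullet> (2 *\<^sub>R x)))"
  proof (rule has_grad_lap_compose[OF has_grad_lap_dot_self])
    show "\<forall>\<^sub>F s in nhds (x \<bullet> x). ((\<lambda>s. s powr (a / 2)) has_real_derivative a / 2 * s powr (a / 2 - 1)) (at s)"
      using e by eventually_elim (rule has_real_derivative_powr)
    show "((\<lambda>s. a / 2 * s powr (a / 2 - 1)) has_real_derivative a / 2 * ((a / 2 - 1) * (x \<bullet> x) powr (a / 2 - 1 - 1))) (at (x \<bullet> x))"
      using p by (intro DERIV_cmult has_real_derivative_powr)
  qed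
  have q: "(y \<bullet> y) powr b = norm y powr (2 * b)" for b and y :: 'a
    by (simp add: norm_eq_sqrt_inner powr_half_sqrt[symmetric] powr_powr)
  have m: "norm x powr (a - 4) * (x \<bullet> x) = norm x powr (a - 2)"
    using x powr_add[of "norm x" "a - 4" 2] by (simp add: dot_square_norm powr_numeral)
  have e1: "(x \<bullet> x) powr (a / 2 - 1) = norm x powr (a - 2)" "(x \<bullet> x) powr (a / 2 - 1 - 1) = norm x powr (a - 4)"
    unfolding q by (simp_all add: algebra_simps)
  have "a / 2 * norm x powr (a - 2) * (2 * DIM('a)) + a / 2 * ((a / 2 - 1) * norm x powr (a - 4)) * ((2 *\<^sub>R x) \<bullet> (2 *\<^sub>R x))
     = a * DIM('a) * norm x powr (a - 2) + a * (a - 2) * (norm x powr (a - 4) * (x \<bullet> x))"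
    by (simp add: field_simps)
  also have "\<dots> = a * (a + DIM('a) - 2) * norm x powr (a - 2)"
    unfolding m by (simp add: algebra_simps)
  finally show ?thesis
    using has_grad_lap_cong[OF h] unfolding e1 by (simp add: q)
qed

text \<open>The cosine of the angle with \<open>e\<close> is homogeneous of degree zero, hence its gradient is tangential.\<close>

lemma has_grad_lap_angle:
  fixes x e :: "'a::euclidean_space" and \<tau> :: real
  assumes x: "x \<noteq> 0" and e: "norm e = 1"
  defines "\<tau> \<equiv> (x \<bullet> e) / norm x"
  shows "\<exists>p. has_grad_lap (\<lambda>y. (y \<bullet> e) / norm y) x p (- (DIM('a) - 1) * \<tau> / (norm x)\<^sup>2) \<and>
    p \<bullet> p = (1 - \<tau>\<^sup>2) / (norm x)\<^sup>2 \<and> x \<bullet> p = 0"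
proof -
  define R where "R = norm x"
  have R: "R > 0" using x by (simp add: R_def)
  define s where "s = x \<bullet> e"
  have h: "has_grad_lap (\<lambda>y. (y \<bullet> e) * norm y powr (- 1)) x
    ((x \<bullet> e) *\<^sub>R ((- 1 * norm x powr (- 1 - 2)) *\<^sub>R x) + norm x powr (- 1) *\<^sub>R e)
    ((x \<bullet> e) * (- 1 * (- 1 + real DIM('a) - 2) * norm x powr (- 1 - 2)) + norm x powr (- 1) * 0
       + 2 * (e \<bullet> ((- 1 * norm x powr (- 1 - 2)) *\<^sub>R x)))"
    by (intro has_grad_lap_mult has_grad_lap_inner has_grad_lap_norm_powr x)
  have 1: "norm y powr (- 1) = 1 / norm y" for y :: 'a
    by (simp add: powr_minus_divide)
  have 3: "norm x powr (- 1 - 2) = 1 / R ^ 3"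
    using R powr_minus_divide[of R 3] by (simp add: R_def powr_numeral)
  define p where "p = (- (s / R ^ 3)) *\<^sub>R x + (1 / R) *\<^sub>R e"
  have xx: "x \<bullet> x = R\<^sup>2" "e \<bullet> e = 1" "x \<bullet> e = s" "e \<bullet> x = s"
    using e by (simp_all add: R_def s_def dot_square_norm inner_commute)
  have "has_grad_lap (\<lambda>y. (y \<bullet> e) / norm y) x p (- (DIM('a) - 1) * \<tau> / (norm x)\<^sup>2)"
  proof -
    have "(s * (- 1 * (- 1 + real DIM('a) - 2) * (1 / R ^ 3)) + (1 / R) * 0 + 2 * (- 1 * (1 / R ^ 3) * s))
        = - (real DIM('a) - 1) * (s / R) / R\<^sup>2"
      using R by (simp add: field_simps power3_eq_cube power2_eq_square)
    moreover have "real (DIM('a) - 1) = real DIM('a) - 1"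
      using DIM_positive[where 'a='a] by (simp add: of_nat_diff Suc_le_eq)
    ultimately show ?thesis
      using h unfolding 1 3 p_def \<tau>_def xx inner_scaleR_right by (simp add: xx flip: R_def)
  qed
  moreover have "p \<bullet> p = (1 - \<tau>\<^sup>2) / (norm x)\<^sup>2"
  proof -
    have gen: "(a *\<^sub>R x + b *\<^sub>R e) \<bullet> (a *\<^sub>R x + b *\<^sub>R e) = a * a * (x \<bullet> x) + 2 * a * b * (x \<bullet> e) + b * b * (e \<bullet> e)"
      for a b by (simp add: inner_add_left inner_add_right inner_commute algebra_simps)
    have "p \<bullet> p = (s / R ^ 3)\<^sup>2 * R\<^sup>2 - 2 * (s / R ^ 3) * (1 / R) * s + (1 / R)\<^sup>2"
      unfolding p_def gen xx by (simp add: power2_eq_square)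
    also have "\<dots> = (1 - (s / R)\<^sup>2) / R\<^sup>2"
      using R by (simp add: field_simps power2_eq_square power3_eq_cube)
    finally show ?thesis by (simp add: \<tau>_def s_def R_def)
  qed
  moreover have "x \<bullet> p = 0"
    unfolding p_def inner_add_right inner_scaleR_right xx using R
    by (simp add: field_simps power2_eq_square power3_eq_cube)
  ultimately show ?thesis by blast
qed

text \<open>Separation of variables: since the gradient of the angular factor is tangential, the product rule has
no mixed term. The radial derivative bounds the slope from below.\<close>

lemma has_grad_lap_cone_function:
  fixes x e :: "'a::euclidean_space" and \<tau> K \<alpha> \<beta> :: real
  assumes x: "x \<noteq> 0" and e: "norm e = 1"
  defines "\<tau> \<equiv> (x \<bullet> e) / norm x" and "n \<equiv> real DIM('a)"
  defines "f \<equiv> K - exp (\<beta> * \<tau>)"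
  shows "\<exists>p. has_grad_lap (\<lambda>y. norm y powr \<alpha> * (K - exp (\<beta> * ((y \<bullet> e) / norm y)))) x p
     (norm x powr (\<alpha> - 2) * (\<alpha> * (\<alpha> + n - 2) * f - \<beta> * exp (\<beta> * \<tau>) * (\<beta> * (1 - \<tau>\<^sup>2) - (n - 1) * \<tau>))) \<and>
     x \<bullet> p = \<alpha> * norm x powr \<alpha> * f"
proof -
  define R where "R = norm x"
  have R: "R > 0" using x by (simp add: R_def)
  obtain q where q: "has_grad_lap (\<lambda>y. (y \<bullet> e) / norm y) x q (- (n - 1) * \<tau> / R\<^sup>2)"
    "q \<bullet> q = (1 - \<tau>\<^sup>2) / R\<^sup>2" "x \<bullet> q = 0"
    using has_grad_lap_angle[OF x e] DIM_positive[where 'a='a]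
    unfolding \<tau>_def R_def n_def by (auto simp: of_nat_diff Suc_le_eq)
  define E where "E = exp (\<beta> * \<tau>)"
  have fg: "has_grad_lap (\<lambda>y. K - exp (\<beta> * ((y \<bullet> e) / norm y))) x ((- \<beta> * E) *\<^sub>R q)
     ((- \<beta> * E) * (- (n - 1) * \<tau> / R\<^sup>2) + (- \<beta> * (E * \<beta>)) * (q \<bullet> q))"
    unfolding E_def \<tau>_def
    by (rule has_grad_lap_compose[where \<phi>="\<lambda>s. K - exp (\<beta> * s)" and \<phi>'="\<lambda>s. - \<beta> * exp (\<beta> * s)",
          OF q(1)[unfolded \<tau>_def]])
      (auto intro!: always_eventually derivative_eq_intros)
  from has_grad_lap_mult[OF has_grad_lap_norm_powr[OF x, of \<alpha>] fg]
  have h: "has_grad_lap (\<lambda>y. norm y powr \<alpha> * (K - exp (\<beta> * ((y \<bullet> e) / norm y)))) x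
     (R powr \<alpha> *\<^sub>R ((- \<beta> * E) *\<^sub>R q) + f *\<^sub>R ((\<alpha> * R powr (\<alpha> - 2)) *\<^sub>R x))
     (R powr \<alpha> * ((- \<beta> * E) * (- (n - 1) * \<tau> / R\<^sup>2) + (- \<beta> * (E * \<beta>)) * (q \<bullet> q)) +
      f * (\<alpha> * (\<alpha> + n - 2) * R powr (\<alpha> - 2)) +
      2 * (((\<alpha> * R powr (\<alpha> - 2)) *\<^sub>R x) \<bullet> ((- \<beta> * E) *\<^sub>R q)))"
    unfolding R_def f_def \<tau>_def n_def .
  have pw: "R powr \<alpha> = R powr (\<alpha> - 2) * R\<^sup>2"
    using R powr_add[of R "\<alpha> - 2" 2] by (simp add: powr_numeral)
  have L: "R powr \<alpha> * ((- \<beta> * E) * (- (n - 1) * \<tau> / R\<^sup>2) + (- \<beta> * (E * \<beta>)) * (q \<bullet> q)) +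
      f * (\<alpha> * (\<alpha> + n - 2) * R powr (\<alpha> - 2)) +
      2 * (((\<alpha> * R powr (\<alpha> - 2)) *\<^sub>R x) \<bullet> ((- \<beta> * E) *\<^sub>R q)) =
     R powr (\<alpha> - 2) * (\<alpha> * (\<alpha> + n - 2) * f - \<beta> * E * (\<beta> * (1 - \<tau>\<^sup>2) - (n - 1) * \<tau>))"
    unfolding pw q(2) inner_scaleR_left inner_scaleR_right q(3) using R
    by (simp add: field_simps)
  have "x \<bullet> x = R\<^sup>2" by (simp add: R_def dot_square_norm)
  then have "x \<bullet> (R powr \<alpha> *\<^sub>R ((- \<beta> * E) *\<^sub>R q) + f *\<^sub>R ((\<alpha> * R powr (\<alpha> - 2)) *\<^sub>R x)) = \<alpha> * R powr \<alpha> * f"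
    unfolding pw inner_add_right inner_scaleR_right q(3) by simp
  then show ?thesis using h[unfolded L] unfolding R_def E_def by blast
qed

text \<open>The angular factor \<open>K - exp (\<beta> \<tau>)\<close> is chosen so that, for large \<open>\<beta>\<close>, its spherical Laplacian is bounded
above by a negative constant on the set \<open>\<tau> < cos \<theta>\<close>, the complement of the cone; at \<open>\<tau> = - 1\<close> the
first-order term provides this, in dimension at least two. A small \<open>\<alpha>\<close> then keeps the radial part
from spoiling the sign. In dimension one the radial part itself is negative, because \<open>\<alpha> < 1\<close>.\<close>

lemma cone_barrier:
  fixes \<theta> :: real
  assumes \<theta>: "0 < \<theta>" "\<theta> < pi / 2"
  shows "\<exists>\<alpha> K \<kappa>. 0 < \<alpha> \<and> \<alpha> < 1 \<and> 0 < K \<and> 0 < \<kappa> \<and>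
    (\<forall>e::'a::euclidean_space. norm e = 1 \<longrightarrow> (\<exists>w. continuous_on UNIV w \<and>
      (\<forall>x. norm x powr \<alpha> \<le> w x \<and> w x \<le> K * norm x powr \<alpha>) \<and>
      (\<forall>x. x \<noteq> 0 \<and> x \<bullet> e < norm x * cos \<theta> \<longrightarrow>
         (\<exists>p L. has_grad_lap w x p L \<and> L \<le> - \<kappa> * norm x powr (\<alpha> - 2) \<and> \<alpha> * norm x powr (\<alpha> - 1) \<le> norm p))))"
proof -
  define c where "c = cos \<theta>"
  have c: "0 < c" "c < 1"
    unfolding c_def using \<theta> cos_gt_zero[of \<theta>] cos_monotone_0_pi[of 0 \<theta>] by auto
  have c2: "0 < 1 - c\<^sup>2" using c by (simp add: power_less_one_iff)
  define n where "n = real DIM('a)"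
  have n: "n \<ge> 1" unfolding n_def using DIM_positive[where 'a='a] by (simp add: Suc_le_eq)
  define \<beta> where "\<beta> = n / (1 - c\<^sup>2)"
  have \<beta>: "\<beta> * (1 - c\<^sup>2) = n" "\<beta> \<ge> 1"
  proof -
    show "\<beta> * (1 - c\<^sup>2) = n" using c2 by (simp add: \<beta>_def)
    show "\<beta> \<ge> 1" unfolding \<beta>_def using c2 n by (simp add: pos_le_divide_eq) (smt (verit) zero_le_power2)
  qed
  define K where "K = exp \<beta> + 1"
  define \<gamma> where "\<gamma> = \<beta> * exp (- \<beta>)"
  have K: "K > 0" unfolding K_def by (simp add: add_pos_pos)
  have \<gamma>: "\<gamma> > 0" unfolding \<gamma>_def using \<beta> by simp
  define \<alpha> where "\<alpha> = min (1/2) (\<gamma> / (2 * n * K))"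
  have \<alpha>: "\<alpha> > 0" "\<alpha> \<le> 1 / 2" "\<alpha> * n * K \<le> \<gamma> / 2"
  proof -
    show "\<alpha> > 0" "\<alpha> \<le> 1 / 2" unfolding \<alpha>_def using \<gamma> n K by auto
    have "\<alpha> * (n * K) \<le> \<gamma> / (2 * n * K) * (n * K)"
      unfolding \<alpha>_def using n K by (intro mult_right_mono) auto
    then show "\<alpha> * n * K \<le> \<gamma> / 2" using n K by (simp add: mult.assoc)
  qed
  define \<kappa> where "\<kappa> = min (\<gamma> / 2) (\<alpha> / 2)"
  have \<kappa>: "\<kappa> > 0" unfolding \<kappa>_def using \<gamma> \<alpha> by simp
  have "\<exists>w. continuous_on UNIV w \<and>
      (\<forall>x. norm x powr \<alpha> \<le> w x \<and> w x \<le> K * norm x powr \<alpha>) \<and>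
      (\<forall>x. x \<noteq> 0 \<and> x \<bullet> e < norm x * cos \<theta> \<longrightarrow>
         (\<exists>p L. has_grad_lap w x p L \<and> L \<le> - \<kappa> * norm x powr (\<alpha> - 2) \<and> \<alpha> * norm x powr (\<alpha> - 1) \<le> norm p))"
    if e: "norm e = 1" for e :: 'a
  proof -
    define \<tau> where "\<tau> = (\<lambda>x. (x \<bullet> e) / norm x)"
    define w where "w = (\<lambda>x. norm x powr \<alpha> * (K - exp (\<beta> * \<tau> x)))"
    have \<tau>: "\<bar>\<tau> x\<bar> \<le> 1" for x
      using Cauchy_Schwarz_ineq2[of x e] e by (cases "x = 0") (auto simp: \<tau>_def)
    have f: "1 \<le> K - exp (\<beta> * \<tau> x)" "K - exp (\<beta> * \<tau> x) \<le> K" "exp (\<beta> * \<tau> x) \<ge> exp (- \<beta>)" for x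
    proof -
      have "\<beta> * \<tau> x \<le> \<beta> * 1" "\<beta> * (- 1) \<le> \<beta> * \<tau> x"
        using \<tau>[of x] \<beta>(2) by (intro mult_left_mono; linarith)+
      then show "1 \<le> K - exp (\<beta> * \<tau> x)" "K - exp (\<beta> * \<tau> x) \<le> K" "exp (\<beta> * \<tau> x) \<ge> exp (- \<beta>)"
        unfolding K_def by auto
    qed
    have bounds: "norm x powr \<alpha> \<le> w x" "w x \<le> K * norm x powr \<alpha>" for x
      unfolding w_def using mult_left_mono[OF f(1)[of x], of "norm x powr \<alpha>"]
        mult_left_mono[OF f(2)[of x], of "norm x powr \<alpha>"] by (simp_all add: mult.commute)
    have hgl: "\<exists>p. has_grad_lap w x p
        (norm x powr (\<alpha> - 2) * (\<alpha> * (\<alpha> + n - 2) * (K - exp (\<beta> * \<tau> x)) - \<beta> * exp (\<beta> * \<tau> x) * (\<beta> * (1 - (\<tau> x)\<^sup>2) - (n - 1) * \<tau> x))) \<and>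
        x \<bullet> p = \<alpha> * norm x powr \<alpha> * (K - exp (\<beta> * \<tau> x))" if "x \<noteq> 0" for x
      using has_grad_lap_cone_function[OF that e, of \<alpha> K \<beta>] unfolding w_def \<tau>_def n_def by blast
    have "continuous_on UNIV w"
    proof (intro continuous_at_imp_continuous_on ballI)
      fix x :: 'a
      show "isCont w x"
      proof (cases "x = 0")
        case False
        then show ?thesis using hgl has_grad_lap_isCont by blast
      next
        case True
        have "((\<lambda>y::'a. norm y powr \<alpha>) \<longlongrightarrow> 0 powr \<alpha>) (at 0)"
          using \<alpha>(1) by (intro tendsto_powr' tendsto_norm_zero tendsto_ident_at tendsto_const) auto
        from tendsto_mult_left[OF this, of K] have "((\<lambda>y. K * norm y powr \<alpha>) \<longlongrightarrow> 0) (at (0::'a))" by simp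
        then have "(w \<longlongrightarrow> 0) (at 0)"
        proof (rule Lim_null_comparison[rotated])
          have "w y \<ge> 0" for y using order_trans[OF _ bounds(1)[of y]] by simp
          then show "\<forall>\<^sub>F y in at 0. norm (w y) \<le> K * norm y powr \<alpha>"
            using bounds(2) by (auto intro!: always_eventually)
        qed
        then show ?thesis using True by (simp add: isCont_def w_def)
      qed
    qed
    moreover have "\<exists>p L. has_grad_lap w x p L \<and> L \<le> - \<kappa> * norm x powr (\<alpha> - 2) \<and> \<alpha> * norm x powr (\<alpha> - 1) \<le> norm p"
      if x: "x \<noteq> 0" and cone: "x \<bullet> e < norm x * cos \<theta>" for x
    proof -
      define t f' where "t = \<tau> x" and "f' = K - exp (\<beta> * \<tau> x)"
      have t: "t < c" "- 1 \<le> t" "t \<le> 1"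
        using cone x \<tau>[of x] unfolding t_def \<tau>_def c_def by (auto simp: field_simps)
      have t2: "t\<^sup>2 \<le> 1" using t by (simp add: abs_square_le_1)
      have f'1: "1 \<le> f'" "f' \<le> K" using f[of x] unfolding f'_def by auto
      obtain p where p: "has_grad_lap w x p
        (norm x powr (\<alpha> - 2) * (\<alpha> * (\<alpha> + n - 2) * f' - \<beta> * exp (\<beta> * t) * (\<beta> * (1 - t\<^sup>2) - (n - 1) * t)))"
        "x \<bullet> p = \<alpha> * norm x powr \<alpha> * f'"
        using hgl[OF x] unfolding t_def f'_def by blast
      have "\<alpha> * (\<alpha> + n - 2) * f' - \<beta> * exp (\<beta> * t) * (\<beta> * (1 - t\<^sup>2) - (n - 1) * t) \<le> - \<kappa>"
      proof (cases "DIM('a) = 1")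
        case True
        then have n1: "n = 1" by (simp add: n_def)
        have "\<alpha> * (1 - \<alpha>) * f' \<ge> \<alpha> * (1 / 2) * 1" using \<alpha> f'1 by (intro mult_mono) auto
        moreover have "\<beta> * exp (\<beta> * t) * (\<beta> * (1 - t\<^sup>2)) \<ge> 0" using \<beta> t2 by simp
        moreover have "\<kappa> \<le> \<alpha> / 2" by (simp add: \<kappa>_def)
        ultimately show ?thesis unfolding n1 by (simp add: algebra_simps)
      next
        case False
        then have n2: "n \<ge> 2" using DIM_positive[where 'a='a] unfolding n_def by linarith
        have "\<beta> * (1 - t\<^sup>2) - (n - 1) * t \<ge> 1"
        proof (cases "t \<ge> 0")
          case True
          then have "t\<^sup>2 \<le> c\<^sup>2" using t by (intro power_mono) auto
          then have "\<beta> * (1 - t\<^sup>2) \<ge> \<beta> * (1 - c\<^sup>2)" using \<beta>(2) by (intro mult_left_mono) auto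
          then have "\<beta> * (1 - t\<^sup>2) \<ge> n" unfolding \<beta>(1) .
          moreover have "(n - 1) * t \<le> n - 1" using n t mult_left_mono[of t 1 "n - 1"] by simp
          ultimately show ?thesis by linarith
        next
          case False
          have "\<beta> * (1 - t\<^sup>2) \<ge> 1 * (1 - t\<^sup>2)" using \<beta> t2 by (intro mult_right_mono) auto
          moreover have "(n - 1) * (- t) \<ge> 1 * (- t)" using n2 False by (intro mult_right_mono) auto
          moreover have "t\<^sup>2 \<le> - t" using False t mult_right_mono[of "-t" 1 "-t"] by (simp add: power2_eq_square)
          ultimately show ?thesis by simp
        qed
        then have "\<beta> * exp (\<beta> * t) * (\<beta> * (1 - t\<^sup>2) - (n - 1) * t) \<ge> \<beta> * exp (- \<beta>) * 1"
          using f(3)[of x] \<beta> unfolding t_def by (intro mult_mono) auto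
        moreover have "\<alpha> * (\<alpha> + n - 2) * f' \<le> \<alpha> * n * K"
          using \<alpha> n2 f'1 by (intro mult_mono) auto
        moreover have "\<kappa> \<le> \<gamma> / 2" by (simp add: \<kappa>_def)
        ultimately show ?thesis using \<alpha>(3) unfolding \<gamma>_def by linarith
      qed
      then have "norm x powr (\<alpha> - 2) * (\<alpha> * (\<alpha> + n - 2) * f' - \<beta> * exp (\<beta> * t) * (\<beta> * (1 - t\<^sup>2) - (n - 1) * t))
          \<le> - \<kappa> * norm x powr (\<alpha> - 2)"
        by (metis mult.commute mult_left_mono powr_ge_zero)
      moreover have "\<alpha> * norm x powr (\<alpha> - 1) \<le> norm p"
      proof -
        have "\<alpha> * norm x powr \<alpha> * 1 \<le> \<alpha> * norm x powr \<alpha> * f'" using \<alpha> f'1 by (intro mult_left_mono) auto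
        also have "\<dots> \<le> norm x * norm p" using norm_cauchy_schwarz[of x p] p(2) by simp
        finally have "\<alpha> * norm x powr \<alpha> \<le> norm x * norm p" by simp
        moreover have "norm x powr \<alpha> = norm x powr (\<alpha> - 1) * norm x"
          using x powr_add[of "norm x" "\<alpha> - 1" 1] by simp
        ultimately have "norm x * (\<alpha> * norm x powr (\<alpha> - 1)) \<le> norm x * norm p" by (simp add: algebra_simps)
        then show ?thesis using x by simp
      qed
      ultimately show ?thesis using p(1) by blast
    qed
    ultimately show ?thesis using bounds by blast
  qed
  then show ?thesis using \<alpha> K \<kappa> by (intro exI[of _ \<alpha>] exI[of _ K] exI[of _ \<kappa>]) auto
qed

lemma continuous_on_imp_lsc_on: "continuous_on S u \<Longrightarrow> lsc_on S u"
  unfolding lsc_on_def continuous_on_def using order_tendstoD(1) by blast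

lemma continuous_on_imp_usc_on: "continuous_on S u \<Longrightarrow> usc_on S u"
  unfolding usc_on_def continuous_on_def using order_tendstoD(2) by blast

text \<open>A minimum of finitely many classical supersolutions is covered by taking for \<open>F\<close> an active one.\<close>

lemma supersolution_of_touching:
  fixes W :: "'a::euclidean_space \<Rightarrow> real"
  assumes W: "continuous_on \<Omega> W"
    and touch: "\<And>x. x \<in> \<Omega> \<Longrightarrow> \<exists>F p L. F x = W x \<and> (\<forall>y. W y \<le> F y) \<and> has_grad_lap F x p L \<and> L \<le> - r \<and> 1 \<le> norm p"
  shows "viscosity_supersolution r \<Omega> W"
  unfolding viscosity_supersolution_def
proof (intro conjI allI impI continuous_on_imp_lsc_on W)
  fix x \<rho> \<phi>
  assume *: "0 < \<rho> \<and> ball x \<rho> \<subseteq> \<Omega> \<and> smooth_on (ball x \<rho>) \<phi> \<and> W x - \<phi> x = 0 \<and> (\<forall>y\<in>ball x \<rho>. W x - \<phi> x \<le> W y - \<phi> y)"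
  then have x: "x \<in> ball x \<rho>" "x \<in> \<Omega>" by auto
  obtain F p L where F: "F x = W x" "\<And>y. W y \<le> F y" "has_grad_lap F x p L" "L \<le> - r" "1 \<le> norm p"
    using touch[OF x(2)] by blast
  have \<phi>: "has_grad_lap \<phi> x (grad \<phi> x) (laplacian \<phi> x)"
    using smooth_on_has_grad_lap[OF open_ball _ x(1)] * by blast
  have "\<forall>\<^sub>F y in nhds x. y \<in> ball x \<rho>" using x(1) eventually_nhds open_ball by blast
  then have "\<forall>\<^sub>F y in nhds x. F x - \<phi> x \<le> F y - \<phi> y"
  proof eventually_elim
    case (elim y)
    then have "W x - \<phi> x \<le> W y - \<phi> y" using * by blast
    then show ?case using F(1) F(2)[of y] by linarith
  qed
  from has_grad_lap_local_min[OF F(3) \<phi> this] show "0 \<le> pde_op r \<phi> x"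
    using F(4,5) unfolding pde_op_def by auto
qed

text \<open>Near \<open>y\<close> the cone function is used, away from \<open>y\<close> a concave paraboloid \<open>D\<close> with values in \<open>[M, N]\<close>, whose
vertex lies outside the domain so that its slope stays above one. The multiple \<open>C\<close> of the cone function
is so large that \<open>D\<close> is the smaller of the two before the cone condition ceases to hold. The
constants do not depend on the domain or on \<open>y\<close>.\<close>

lemma barrier_exists:
  fixes \<theta> \<rho> d r \<delta> M :: real
  assumes r: "r \<ge> 0" and \<theta>: "0 < \<theta>" "\<theta> < pi / 2" and \<rho>: "0 < \<rho>" and d: "d \<ge> 0" and \<delta>: "0 < \<delta>" and M: "0 \<le> M"
  shows "\<exists>N \<alpha> C. 0 < \<alpha> \<and> 0 \<le> N \<and> 0 \<le> C \<and> (\<forall>(\<Omega>::'a::euclidean_space set) y.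
    open \<Omega> \<and> (\<forall>x\<in>closure \<Omega>. dist x y \<le> d) \<and> y \<notin> \<Omega> \<and> exterior_cone_at \<theta> \<rho> \<Omega> y \<longrightarrow>
    (\<exists>W. continuous_on UNIV W \<and> viscosity_supersolution r \<Omega> W \<and> W y \<le> 0 \<and>
      (\<forall>x\<in>closure \<Omega>. 0 \<le> W x \<and> W x \<le> N \<and> W x \<le> C * dist x y powr \<alpha> \<and> (\<delta> \<le> dist x y \<longrightarrow> M \<le> W x))))"
proof -
  obtain \<alpha> K \<kappa> where \<alpha>: "0 < \<alpha>" "\<alpha> < 1" and K: "0 < K" and \<kappa>: "0 < \<kappa>"
    and cb: "\<And>e::'a. norm e = 1 \<Longrightarrow> \<exists>w. continuous_on UNIV w \<and>
      (\<forall>x. norm x powr \<alpha> \<le> w x \<and> w x \<le> K * norm x powr \<alpha>) \<and>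
      (\<forall>x. x \<noteq> 0 \<and> x \<bullet> e < norm x * cos \<theta> \<longrightarrow>
         (\<exists>p L. has_grad_lap w x p L \<and> L \<le> - \<kappa> * norm x powr (\<alpha> - 2) \<and> \<alpha> * norm x powr (\<alpha> - 1) \<le> norm p))"
    using cone_barrier[OF \<theta>, where 'a='a] by blast
  define A where "A = (r + 1) / 2"
  define N where "N = M + A * (2 * d + 1)\<^sup>2"
  define \<delta>' where "\<delta>' = min \<delta> (\<rho> / 2)"
  have A: "A > 0" unfolding A_def using r by simp
  have N: "N \<ge> 0" unfolding N_def using M A by simp
  have \<delta>': "\<delta>' > 0" "\<delta>' \<le> \<delta>" "\<delta>' < \<rho>" unfolding \<delta>'_def using \<delta> \<rho> by auto
  define C where "C = N / \<delta>' powr \<alpha> + r / (\<kappa> * \<rho> powr (\<alpha> - 2)) + 1 / (\<alpha> * \<rho> powr (\<alpha> - 1))"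
  have Cp: "N / \<delta>' powr \<alpha> \<ge> 0" "r / (\<kappa> * \<rho> powr (\<alpha> - 2)) \<ge> 0" "1 / (\<alpha> * \<rho> powr (\<alpha> - 1)) > 0"
    using N r \<kappa> \<alpha> \<rho> by auto
  have C: "C > 0" "C * \<delta>' powr \<alpha> \<ge> N" "C * (\<kappa> * \<rho> powr (\<alpha> - 2)) \<ge> r" "C * (\<alpha> * \<rho> powr (\<alpha> - 1)) \<ge> 1"
  proof -
    show "C > 0" unfolding C_def using Cp by linarith
    have "N / \<delta>' powr \<alpha> * \<delta>' powr \<alpha> \<le> C * \<delta>' powr \<alpha>"
      unfolding C_def using Cp by (intro mult_right_mono) (linarith, simp)
    then show "C * \<delta>' powr \<alpha> \<ge> N" using \<delta>' by simp
    have "r / (\<kappa> * \<rho> powr (\<alpha> - 2)) * (\<kappa> * \<rho> powr (\<alpha> - 2)) \<le> C * (\<kappa> * \<rho> powr (\<alpha> - 2))"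
      unfolding C_def using Cp \<kappa> by (intro mult_right_mono) (linarith, simp)
    then show "C * (\<kappa> * \<rho> powr (\<alpha> - 2)) \<ge> r" using \<kappa> \<rho> by simp
    have "1 / (\<alpha> * \<rho> powr (\<alpha> - 1)) * (\<alpha> * \<rho> powr (\<alpha> - 1)) \<le> C * (\<alpha> * \<rho> powr (\<alpha> - 1))"
      unfolding C_def using Cp \<alpha> by (intro mult_right_mono) (linarith, simp)
    then show "C * (\<alpha> * \<rho> powr (\<alpha> - 1)) \<ge> 1" using \<alpha> \<rho> by simp
  qed
  have "\<exists>W. continuous_on UNIV W \<and> viscosity_supersolution r \<Omega> W \<and> W y \<le> 0 \<and>
      (\<forall>x\<in>closure \<Omega>. 0 \<le> W x \<and> W x \<le> N \<and> W x \<le> C * K * dist x y powr \<alpha> \<and> (\<delta> \<le> dist x y \<longrightarrow> M \<le> W x))"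
    if \<Omega>: "open \<Omega>" and diam: "\<And>x. x \<in> closure \<Omega> \<Longrightarrow> dist x y \<le> d" and y: "y \<notin> \<Omega>" and cone: "exterior_cone_at \<theta> \<rho> \<Omega> y"
    for \<Omega> :: "'a set" and y
  proof -
    obtain e where e: "norm e = 1" "((+) y ` circular_cone \<theta> e) \<inter> ball y \<rho> - {y} \<subseteq> - closure \<Omega>"
      using cone unfolding exterior_cone_at_def by blast
    obtain w where w: "continuous_on UNIV w" "\<And>x. norm x powr \<alpha> \<le> w x" "\<And>x. w x \<le> K * norm x powr \<alpha>"
      "\<And>x. x \<noteq> 0 \<Longrightarrow> x \<bullet> e < norm x * cos \<theta> \<Longrightarrow>
         (\<exists>p L. has_grad_lap w x p L \<and> L \<le> - \<kappa> * norm x powr (\<alpha> - 2) \<and> \<alpha> * norm x powr (\<alpha> - 1) \<le> norm p)"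
      using cb[OF e(1)] by blast
    \<comment> \<open>any point at distance \<open>d + 1\<close> from \<open>y\<close> would do as vertex\<close>
    define z where "z = y + (d + 1) *\<^sub>R e"
    define D where "D = (\<lambda>x. (- A) * ((x + - z) \<bullet> (x + - z)) + N)"
    define W where "W = (\<lambda>x. min (C * w (x + - y)) (D x))"
    have dz: "1 \<le> norm (x - z)" "norm (x - z) \<le> 2 * d + 1" if "x \<in> closure \<Omega>" for x
    proof -
      have "norm (x - y) \<le> d" "norm ((d + 1) *\<^sub>R e) = d + 1" using diam[OF that] e d by (auto simp: dist_norm)
      moreover have xz: "x - z = (x - y) - (d + 1) *\<^sub>R e" by (simp add: z_def)
      ultimately show "1 \<le> norm (x - z)" "norm (x - z) \<le> 2 * d + 1"
        using norm_triangle_ineq4[of "x - y" "(d + 1) *\<^sub>R e"] norm_triangle_ineq3[of "x - y" "(d + 1) *\<^sub>R e"] d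
        unfolding xz by linarith+
    qed
    have D: "M \<le> D x" "D x \<le> N" if "x \<in> closure \<Omega>" for x
    proof -
      have "(norm (x - z))\<^sup>2 \<le> (2 * d + 1)\<^sup>2" using dz[OF that] by (intro power_mono) auto
      then have "A * (norm (x - z))\<^sup>2 \<le> A * (2 * d + 1)\<^sup>2" using A by (intro mult_left_mono) auto
      then show "M \<le> D x" by (simp add: D_def N_def dot_square_norm)
      show "D x \<le> N" using A by (simp add: D_def)
    qed
    have Dc: "continuous_on UNIV D" unfolding D_def by (intro continuous_intros)
    have wc: "continuous_on UNIV (\<lambda>x. C * w (x + - y))"
      by (intro continuous_intros continuous_on_compose2[OF w(1)]) auto
    have Wc: "continuous_on UNIV W" unfolding W_def by (rule continuous_on_min[OF wc Dc])
    have w0: "w x \<ge> 0" for x using order_trans[OF _ w(2)[of x]] by simp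
    have far: "N \<le> C * w (x + - y)" if "dist x y \<ge> \<delta>'" for x
    proof -
      have "\<delta>' powr \<alpha> \<le> norm (x + - y) powr \<alpha>" using that \<delta>' \<alpha> by (intro powr_mono2) (auto simp: dist_norm)
      also have "\<dots> \<le> w (x + - y)" by (rule w(2))
      finally have "C * \<delta>' powr \<alpha> \<le> C * w (x + - y)" using C(1) by (intro mult_left_mono) auto
      then show ?thesis using C(2) by linarith
    qed
    have "viscosity_supersolution r \<Omega> W"
    proof (rule supersolution_of_touching[OF continuous_on_subset[OF Wc]])
      fix x assume x: "x \<in> \<Omega>"
      then have xc: "x \<in> closure \<Omega>" using closure_subset by blast
      show "\<exists>F p L. F x = W x \<and> (\<forall>y. W y \<le> F y) \<and> has_grad_lap F x p L \<and> L \<le> - r \<and> 1 \<le> norm p"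
      proof (cases "D x \<le> C * w (x + - y)")
        case True
        have h: "has_grad_lap D x ((- A) *\<^sub>R (2 *\<^sub>R (x + - z)) + 0) ((- A) * (2 * DIM('a)) + 0)"
          unfolding D_def
          by (intro has_grad_lap_add has_grad_lap_cmult has_grad_lap_const has_grad_lap_translate[OF has_grad_lap_dot_self])
        have "real DIM('a) \<ge> 1" using DIM_positive[where 'a='a] by (simp add: Suc_le_eq)
        then have "(r + 1) * 1 \<le> (r + 1) * real DIM('a)" using r by (intro mult_left_mono) auto
        then have "(- A) * (2 * DIM('a)) + 0 \<le> - r" by (simp add: A_def)
        moreover have "1 \<le> norm ((- A) *\<^sub>R (2 *\<^sub>R (x + - z)) + 0)"
        proof -
          have "1 * 1 \<le> (r + 1) * norm (x - z)" using r dz[OF xc] by (intro mult_mono) auto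
          moreover have "norm ((- A) *\<^sub>R (2 *\<^sub>R (x + - z)) + 0) = 2 * A * norm (x - z)"
            using A by simp
          moreover have "2 * A = r + 1" by (simp add: A_def)
          ultimately show ?thesis by (simp only: mult_1_right)
        qed
        ultimately have "\<exists>p L. has_grad_lap D x p L \<and> L \<le> - r \<and> 1 \<le> norm p" using h by blast
        moreover have "D x = W x" "\<forall>y. W y \<le> D y" using True by (auto simp: W_def)
        ultimately show ?thesis by blast
      next
        case False
        then have nf: "dist x y < \<delta>'" using far[of x] D(2)[OF xc] by linarith
        have xy: "x + - y \<noteq> 0" using x y by auto
        have "(x + - y) \<bullet> e < norm (x + - y) * cos \<theta>"
        proof (rule ccontr)
          assume "\<not> (x + - y) \<bullet> e < norm (x + - y) * cos \<theta>"
          then have "x + - y \<in> circular_cone \<theta> e" by (simp add: circular_cone_def)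
          then have "y + (x + - y) \<in> (+) y ` circular_cone \<theta> e" by blast
          moreover have "x \<in> ball y \<rho>" using nf \<delta>' by (simp add: dist_commute)
          ultimately show False using e(2) xc xy by auto
        qed
        from w(4)[OF xy this] obtain p L where pL: "has_grad_lap w (x + - y) p L"
          "L \<le> - \<kappa> * norm (x + - y) powr (\<alpha> - 2)" "\<alpha> * norm (x + - y) powr (\<alpha> - 1) \<le> norm p" by blast
        have h: "has_grad_lap (\<lambda>x. C * w (x + - y)) x (C *\<^sub>R p) (C * L)"
          by (intro has_grad_lap_cmult has_grad_lap_translate pL)
        have nb: "0 < norm (x + - y)" "norm (x + - y) \<le> \<rho>" using xy nf \<delta>' by (auto simp: dist_norm)
        have "\<rho> powr (\<alpha> - 2) \<le> norm (x + - y) powr (\<alpha> - 2)" "\<rho> powr (\<alpha> - 1) \<le> norm (x + - y) powr (\<alpha> - 1)"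
          using nb \<alpha> by (auto intro!: powr_mono2')
        then have "\<kappa> * \<rho> powr (\<alpha> - 2) \<le> - L" "\<alpha> * \<rho> powr (\<alpha> - 1) \<le> norm p"
          using pL(2,3) \<kappa> \<alpha> mult_left_mono[of "\<rho> powr (\<alpha> - 2)" "norm (x + - y) powr (\<alpha> - 2)" \<kappa>]
            mult_left_mono[of "\<rho> powr (\<alpha> - 1)" "norm (x + - y) powr (\<alpha> - 1)" \<alpha>] by linarith+
        then have "C * (\<kappa> * \<rho> powr (\<alpha> - 2)) \<le> C * (- L)" "C * (\<alpha> * \<rho> powr (\<alpha> - 1)) \<le> C * norm p"
          using C(1) by (intro mult_left_mono; simp)+
        moreover have "norm (C *\<^sub>R p) = C * norm p" using C(1) by simp
        ultimately have "C * L \<le> - r" "1 \<le> norm (C *\<^sub>R p)" using C(3,4) by linarith+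
        moreover have "C * w (x + - y) = W x" "\<forall>x. W x \<le> C * w (x + - y)" using False by (auto simp: W_def)
        ultimately show ?thesis using h
          by (intro exI[of _ "\<lambda>x. C * w (x + - y)"] exI[of _ "C *\<^sub>R p"] exI[of _ "C * L"] conjI)
      qed
    qed simp
    moreover have "W y \<le> 0"
      using w(3)[of 0] C(1) \<alpha>(1) by (simp add: W_def min_le_iff_disj mult_le_0_iff)
    moreover have "0 \<le> W x \<and> W x \<le> N \<and> W x \<le> C * K * dist x y powr \<alpha> \<and> (\<delta> \<le> dist x y \<longrightarrow> M \<le> W x)"
      if x: "x \<in> closure \<Omega>" for x
    proof (intro conjI impI)
      show "0 \<le> W x" using w0 C(1) D(1)[OF x] M by (auto simp: W_def)
      show "W x \<le> N" using D(2)[OF x] by (auto simp: W_def)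
      have "C * w (x + - y) \<le> C * (K * norm (x + - y) powr \<alpha>)" using w(3) C(1) by (intro mult_left_mono) auto
      then show "W x \<le> C * K * dist x y powr \<alpha>" by (auto simp: W_def dist_norm mult.assoc)
      assume "\<delta> \<le> dist x y"
      then have "D x \<le> C * w (x + - y)" using far[of x] D(2)[OF x] \<delta>' by linarith
      then show "M \<le> W x" using D(1)[OF x] by (simp add: W_def)
    qed
    ultimately show ?thesis using Wc by blast
  qed
  then show ?thesis using \<alpha> N C(1) K by (intro exI[of _ N] exI[of _ \<alpha>] exI[of _ "C * K"]) (auto)
qed

section \<open>The subsolution property at a point\<close>

text \<open>Being a subsolution is a local property; in this form it can be transferred between functions that
touch each other, and between points by translation.\<close>

definition subsolution_at :: "real \<Rightarrow> ('a::euclidean_space \<Rightarrow> real) \<Rightarrow> 'a \<Rightarrow> bool" where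
  "subsolution_at r u x \<longleftrightarrow> (\<forall>\<rho> \<phi>. 0 < \<rho> \<and> smooth_on (ball x \<rho>) \<phi> \<and> u x = \<phi> x \<and> (\<forall>\<^sub>F y in nhds x. u y \<le> \<phi> y)
     \<longrightarrow> pde_op r \<phi> x \<le> 0)"

lemma subsolution_imp_at:
  "viscosity_subsolution r \<Omega> u \<Longrightarrow> open \<Omega> \<Longrightarrow> x \<in> \<Omega> \<Longrightarrow> subsolution_at r u x"
  unfolding subsolution_at_def using viscosity_subsolution_test by blast

lemma subsolution_of_at:
  assumes "continuous_on \<Omega> u" "\<And>x. x \<in> \<Omega> \<Longrightarrow> subsolution_at r u x"
  shows "viscosity_subsolution r \<Omega> u"
  unfolding viscosity_subsolution_def
proof (intro conjI allI impI continuous_on_imp_usc_on assms(1))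
  fix x \<rho> \<phi>
  assume *: "0 < \<rho> \<and> ball x \<rho> \<subseteq> \<Omega> \<and> smooth_on (ball x \<rho>) \<phi> \<and> u x - \<phi> x = 0 \<and> (\<forall>y\<in>ball x \<rho>. u y - \<phi> y \<le> u x - \<phi> x)"
  then have x: "x \<in> ball x \<rho>" "x \<in> \<Omega>" by auto
  have "\<forall>\<^sub>F y in nhds x. y \<in> ball x \<rho>" using x(1) eventually_nhds open_ball by blast
  then have "\<forall>\<^sub>F y in nhds x. u y \<le> \<phi> y" by eventually_elim (use * in force)
  then show "pde_op r \<phi> x \<le> 0" using assms(2)[OF x(2)] * unfolding subsolution_at_def by auto
qed

lemma subsolution_at_le:
  assumes "subsolution_at r v x" "v x = u x" "\<forall>\<^sub>F y in nhds x. v y \<le> u y"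
  shows "subsolution_at r u x"
  unfolding subsolution_at_def
proof (intro allI impI)
  fix \<rho> \<phi>
  assume *: "0 < \<rho> \<and> smooth_on (ball x \<rho>) \<phi> \<and> u x = \<phi> x \<and> (\<forall>\<^sub>F y in nhds x. u y \<le> \<phi> y)"
  then have "\<forall>\<^sub>F y in nhds x. u y \<le> \<phi> y" by blast
  with assms(3) have "\<forall>\<^sub>F y in nhds x. v y \<le> \<phi> y" by eventually_elim simp
  then show "pde_op r \<phi> x \<le> 0" using assms(1,2) * unfolding subsolution_at_def by auto
qed

lemma subsolution_at_le_everywhere:
  "subsolution_at r v x \<Longrightarrow> v x = u x \<Longrightarrow> (\<And>y. v y \<le> u y) \<Longrightarrow> subsolution_at r u x"
  by (rule subsolution_at_le[of r v x u]) simp_all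

lemma subsolution_at_shift:
  assumes v: "subsolution_at r v (x + h)"
  shows "subsolution_at r (\<lambda>y. v (y + h) + c) x"
  unfolding subsolution_at_def
proof (intro allI impI)
  fix \<rho> \<phi>
  assume *: "0 < \<rho> \<and> smooth_on (ball x \<rho>) \<phi> \<and> v (x + h) + c = \<phi> x \<and> (\<forall>\<^sub>F y in nhds x. v (y + h) + c \<le> \<phi> y)"
  define \<psi> where "\<psi> = (\<lambda>y. \<phi> (y + - h) + - c)"
  have "smooth_on (ball (x + h) \<rho>) (\<lambda>y. \<phi> (y + - h))"
    by (rule smooth_on_translate) (use * in simp)
  then have sm: "smooth_on (ball (x + h) \<rho>) \<psi>"
    unfolding \<psi>_def by (intro smooth_on_add open_ball smooth_on_const)
  have "filterlim (\<lambda>y. y + - h) (nhds (x + h + - h)) (nhds (x + h))"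
    by (intro tendsto_add filterlim_ident tendsto_const)
  then have "filterlim (\<lambda>y. y + - h) (nhds x) (nhds (x + h))" by simp
  with * have "\<forall>\<^sub>F y in nhds (x + h). v ((y + - h) + h) + c \<le> \<phi> (y + - h)"
    using eventually_compose_filterlim[of "\<lambda>y. v (y + h) + c \<le> \<phi> y" "nhds x" "\<lambda>y. y + - h" "nhds (x + h)"] by blast
  then have "\<forall>\<^sub>F y in nhds (x + h). v y \<le> \<psi> y"
    by eventually_elim (simp add: \<psi>_def)
  then have "pde_op r \<psi> (x + h) \<le> 0"
    using v * sm unfolding subsolution_at_def \<psi>_def by (auto simp: algebra_simps)
  moreover have "has_grad_lap \<psi> (x + h) (grad \<phi> x + 0) (laplacian \<phi> x + 0)"
    unfolding \<psi>_def
    by (intro has_grad_lap_add has_grad_lap_const has_grad_lap_translate)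
      (use smooth_on_has_grad_lap[OF open_ball, of x \<rho> \<phi> x] * in simp)
  ultimately show "pde_op r \<phi> x \<le> 0"
    using has_grad_lap_unique unfolding pde_op_def by fastforce
qed

text \<open>The Laplacian of a test of \<open>c - W\<close> is at least \<open>r\<close>, hence at least \<open>- r\<close>. The lower barriers come from
the upper ones in this way.\<close>

lemma subsolution_at_neg_supersolution:
  assumes r: "r \<ge> 0" and W: "viscosity_supersolution r \<Omega> W" "open \<Omega>" "x \<in> \<Omega>"
  shows "subsolution_at r (\<lambda>y. c - W y) x"
  unfolding subsolution_at_def
proof (intro allI impI)
  fix \<rho> \<phi>
  assume *: "0 < \<rho> \<and> smooth_on (ball x \<rho>) \<phi> \<and> c - W x = \<phi> x \<and> (\<forall>\<^sub>F y in nhds x. c - W y \<le> \<phi> y)"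
  define \<psi> where "\<psi> = (\<lambda>y. - 1 * \<phi> y + c)"
  have "pde_op r \<psi> x \<ge> 0"
  proof (rule viscosity_supersolution_test[OF W])
    show "0 < \<rho>" using * by blast
    show "smooth_on (ball x \<rho>) \<psi>" unfolding \<psi>_def
      using * by (intro smooth_on_add smooth_on_cmult open_ball smooth_on_const) auto
    show "W x = \<psi> x" unfolding \<psi>_def using * by simp
    have "\<forall>\<^sub>F y in nhds x. c - W y \<le> \<phi> y" using * by blast
    then show "\<forall>\<^sub>F y in nhds x. \<psi> y \<le> W y" by eventually_elim (simp add: \<psi>_def)
  qed
  moreover have "has_grad_lap \<psi> x (- 1 *\<^sub>R grad \<phi> x + 0) (- 1 * laplacian \<phi> x + 0)"
    unfolding \<psi>_def
    by (intro has_grad_lap_add has_grad_lap_const has_grad_lap_cmult smooth_on_has_grad_lap[OF open_ball]) (use * in auto)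
  ultimately have "laplacian \<phi> x \<ge> r" using has_grad_lap_unique[of \<psi> x] unfolding pde_op_def by simp
  then show "pde_op r \<phi> x \<le> 0" using r unfolding pde_op_def by simp
qed

lemma subsolution_at_classical:
  assumes F: "has_grad_lap F x p L" and pL: "- L \<le> r \<or> norm p \<le> 1"
  shows "subsolution_at r F x"
  unfolding subsolution_at_def
proof (intro allI impI)
  fix \<rho> \<phi>
  assume *: "0 < \<rho> \<and> smooth_on (ball x \<rho>) \<phi> \<and> F x = \<phi> x \<and> (\<forall>\<^sub>F y in nhds x. F y \<le> \<phi> y)"
  have \<phi>: "has_grad_lap \<phi> x (grad \<phi> x) (laplacian \<phi> x)"
    using smooth_on_has_grad_lap[OF open_ball, of x \<rho> \<phi> x] * by simp
  have "\<forall>\<^sub>F y in nhds x. F y \<le> \<phi> y" using * by blast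
  then have "\<forall>\<^sub>F y in nhds x. \<phi> x - F x \<le> \<phi> y - F y" by eventually_elim (use * in simp)
  from has_grad_lap_local_min[OF \<phi> F this] show "pde_op r \<phi> x \<le> 0"
    using pL unfolding pde_op_def by auto
qed

section \<open>Control at the boundary\<close>

lemma powr_small:
  fixes C \<alpha> \<epsilon> :: real
  assumes "C \<ge> 0" "\<alpha> > 0" "\<epsilon> > 0"
  shows "\<exists>\<tau>>0. \<forall>t. 0 \<le> t \<and> t < \<tau> \<longrightarrow> C * t powr \<alpha> \<le> \<epsilon>"
proof (intro exI conjI allI impI)
  define \<tau> where "\<tau> = (\<epsilon> / (C + 1)) powr (1 / \<alpha>)"
  show "\<tau> > 0" unfolding \<tau>_def using assms by simp
  fix t assume t: "0 \<le> t \<and> t < \<tau>"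
  then have "t powr \<alpha> \<le> \<tau> powr \<alpha>" using assms by (intro powr_mono2) auto
  also have "\<dots> = \<epsilon> / (C + 1)" unfolding \<tau>_def using assms by (simp add: powr_powr)
  finally have "C * t powr \<alpha> \<le> C * (\<epsilon> / (C + 1))" using assms by (intro mult_left_mono) auto
  also have "\<dots> \<le> \<epsilon>" using assms by (simp add: field_simps)
  finally show "C * t powr \<alpha> \<le> \<epsilon>" .
qed

lemma frontier_open_notin: "open S \<Longrightarrow> y \<in> frontier S \<Longrightarrow> y \<notin> S"
  by (simp add: frontier_def interior_open)

lemma frontier_imp_closure: "y \<in> frontier S \<Longrightarrow> y \<in> closure S"
  by (simp add: frontier_def)

text \<open>The barrier in terms of the boundary data: \<open>g y \<plusminus> (W + \<epsilon>)\<close> bound \<open>g\<close> from both sides on the boundary.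
The order of the quantifiers matters: \<open>N\<close> and \<open>\<tau>\<close> come before the domain and the data.\<close>

lemma boundary_control:
  fixes \<theta> \<rho> d r \<delta> M \<epsilon> :: real
  assumes r: "r \<ge> 0" and \<theta>: "0 < \<theta>" "\<theta> < pi / 2" and \<rho>: "0 < \<rho>" and d: "d \<ge> 0" and \<delta>: "0 < \<delta>" and M: "0 \<le> M"
    and \<epsilon>: "0 < \<epsilon>"
  shows "\<exists>N \<tau>. 0 < \<tau> \<and> (\<forall>(\<Omega>::'a::euclidean_space set) g y.
    open \<Omega> \<and> (\<forall>x\<in>closure \<Omega>. dist x y \<le> d) \<and> y \<in> frontier \<Omega> \<and> exterior_cone_at \<theta> \<rho> \<Omega> y \<and>
    (\<forall>x\<in>frontier \<Omega>. \<bar>g x - g y\<bar> \<le> M \<and> (dist x y < \<delta> \<longrightarrow> \<bar>g x - g y\<bar> \<le> \<epsilon>)) \<longrightarrow>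
    (\<exists>W. continuous_on (closure \<Omega>) W \<and> viscosity_supersolution r \<Omega> W \<and>
      (\<forall>x\<in>frontier \<Omega>. \<bar>g x - g y\<bar> \<le> W x + \<epsilon>) \<and>
      (\<forall>x\<in>closure \<Omega>. W x \<le> N \<and> (dist x y < \<tau> \<longrightarrow> W x \<le> \<epsilon>))))"
proof -
  obtain N \<alpha> C where NC: "0 < \<alpha>" "0 \<le> C" and B: "\<And>(\<Omega>::'a set) y.
    open \<Omega> \<and> (\<forall>x\<in>closure \<Omega>. dist x y \<le> d) \<and> y \<notin> \<Omega> \<and> exterior_cone_at \<theta> \<rho> \<Omega> y \<Longrightarrow>
    (\<exists>W. continuous_on UNIV W \<and> viscosity_supersolution r \<Omega> W \<and> W y \<le> 0 \<and>
      (\<forall>x\<in>closure \<Omega>. 0 \<le> W x \<and> W x \<le> N \<and> W x \<le> C * dist x y powr \<alpha> \<and> (\<delta> \<le> dist x y \<longrightarrow> M \<le> W x)))"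
    using barrier_exists[OF r \<theta> \<rho> d \<delta> M, where 'a='a] by blast
  obtain \<tau> where \<tau>: "\<tau> > 0" "\<And>t. 0 \<le> t \<Longrightarrow> t < \<tau> \<Longrightarrow> C * t powr \<alpha> \<le> \<epsilon>"
    using powr_small[OF NC(2,1) \<epsilon>] by blast
  have "\<exists>W. continuous_on (closure \<Omega>) W \<and> viscosity_supersolution r \<Omega> W \<and>
      (\<forall>x\<in>frontier \<Omega>. \<bar>g x - g y\<bar> \<le> W x + \<epsilon>) \<and>
      (\<forall>x\<in>closure \<Omega>. W x \<le> N \<and> (dist x y < \<tau> \<longrightarrow> W x \<le> \<epsilon>))"
    if *: "open \<Omega> \<and> (\<forall>x\<in>closure \<Omega>. dist x y \<le> d) \<and> y \<in> frontier \<Omega> \<and> exterior_cone_at \<theta> \<rho> \<Omega> y \<and>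
    (\<forall>x\<in>frontier \<Omega>. \<bar>g x - g y\<bar> \<le> M \<and> (dist x y < \<delta> \<longrightarrow> \<bar>g x - g y\<bar> \<le> \<epsilon>))" for \<Omega> :: "'a set" and g y
  proof -
    have "y \<notin> \<Omega>" using * frontier_open_notin by blast
    then obtain W where W: "continuous_on UNIV W" "viscosity_supersolution r \<Omega> W"
      "\<And>x. x \<in> closure \<Omega> \<Longrightarrow> 0 \<le> W x \<and> W x \<le> N \<and> W x \<le> C * dist x y powr \<alpha> \<and> (\<delta> \<le> dist x y \<longrightarrow> M \<le> W x)"
      using B[of \<Omega> y] * by blast
    have "\<bar>g x - g y\<bar> \<le> W x + \<epsilon>" if x: "x \<in> frontier \<Omega>" for x
    proof (cases "dist x y < \<delta>")
      case True
      then show ?thesis using * x W(3)[OF frontier_imp_closure[OF x]] by force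
    next
      case False
      then have "M \<le> W x" using W(3)[OF frontier_imp_closure[OF x]] by auto
      then show ?thesis using * x \<epsilon> by force
    qed
    moreover have "W x \<le> \<epsilon>" if "x \<in> closure \<Omega>" "dist x y < \<tau>" for x
      using W(3)[OF that(1)] \<tau>(2)[OF zero_le_dist that(2)] by linarith
    ultimately show ?thesis using W continuous_on_subset[OF W(1) subset_UNIV] by blast
  qed
  then show ?thesis using \<tau>(1) by blast
qed

lemma upper_estimate:
  fixes v W :: "'a::euclidean_space \<Rightarrow> real"
  assumes "r \<ge> 0" "open \<Omega>" "bounded \<Omega>" "continuous_on (closure \<Omega>) v" "viscosity_subsolution r \<Omega> v"
    "\<And>x. x \<in> frontier \<Omega> \<Longrightarrow> v x \<le> g x"
    "continuous_on (closure \<Omega>) W" "viscosity_supersolution r \<Omega> W" "\<And>x. x \<in> frontier \<Omega> \<Longrightarrow> \<bar>g x - g y\<bar> \<le> W x + \<epsilon>"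
    and x: "x \<in> closure \<Omega>"
  shows "v x \<le> g y + \<epsilon> + W x"
proof -
  have "v x \<le> W x + (g y + \<epsilon>)"
  proof (rule comparison[OF assms(1-4,7,5,8) _ x])
    show "v z \<le> W z + (g y + \<epsilon>)" if "z \<in> frontier \<Omega>" for z
      using assms(6)[OF that] assms(9)[OF that] by linarith
  qed
  then show ?thesis by simp
qed

definition perron_class :: "real \<Rightarrow> 'a::euclidean_space set \<Rightarrow> ('a \<Rightarrow> real) \<Rightarrow> ('a \<Rightarrow> real) set" where
  "perron_class r \<Omega> g = {v. continuous_on (closure \<Omega>) v \<and> viscosity_subsolution r \<Omega> v \<and> (\<forall>x\<in>frontier \<Omega>. v x \<le> g x)}"

lemma lower_barrier:
  fixes W :: "'a::euclidean_space \<Rightarrow> real"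
  assumes r: "r \<ge> 0" and \<Omega>: "open \<Omega>"
    and W: "continuous_on (closure \<Omega>) W" "viscosity_supersolution r \<Omega> W" "\<And>x. x \<in> frontier \<Omega> \<Longrightarrow> \<bar>g x - g y\<bar> \<le> W x + \<epsilon>"
  shows "(\<lambda>x. (g y - \<epsilon>) - W x) \<in> perron_class r \<Omega> g"
  unfolding perron_class_def
proof (intro CollectI conjI ballI)
  show c: "continuous_on (closure \<Omega>) (\<lambda>x. (g y - \<epsilon>) - W x)" by (intro continuous_intros W)
  show "viscosity_subsolution r \<Omega> (\<lambda>x. (g y - \<epsilon>) - W x)"
    by (rule subsolution_of_at[OF continuous_on_subset[OF c closure_subset]
          subsolution_at_neg_supersolution[OF r W(2) \<Omega>]])
  show "(g y - \<epsilon>) - W x \<le> g x" if "x \<in> frontier \<Omega>" for x using W(3)[OF that] by linarith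
qed

lemma perron_classI:
  assumes "continuous_on (closure \<Omega>) v" "\<And>x. x \<in> \<Omega> \<Longrightarrow> subsolution_at r v x" "\<And>x. x \<in> frontier \<Omega> \<Longrightarrow> v x \<le> g x"
  shows "v \<in> perron_class r \<Omega> g"
  using assms subsolution_of_at[OF continuous_on_subset[OF assms(1) closure_subset]]
  unfolding perron_class_def by blast

lemma perron_classD:
  assumes "v \<in> perron_class r \<Omega> g"
  shows "continuous_on (closure \<Omega>) v" "viscosity_subsolution r \<Omega> v" "\<And>x. x \<in> frontier \<Omega> \<Longrightarrow> v x \<le> g x"
    "open \<Omega> \<Longrightarrow> x \<in> \<Omega> \<Longrightarrow> subsolution_at r v x"
  using assms subsolution_imp_at unfolding perron_class_def by blast+

lemma perron_class_max:
  assumes "open \<Omega>" "v \<in> perron_class r \<Omega> g" "w \<in> perron_class r \<Omega> g"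
  shows "(\<lambda>x. max (v x) (w x)) \<in> perron_class r \<Omega> g"
proof (rule perron_classI)
  show "continuous_on (closure \<Omega>) (\<lambda>x. max (v x) (w x))"
    using perron_classD(1) assms by (intro continuous_on_max) blast+
  show "subsolution_at r (\<lambda>x. max (v x) (w x)) x" if x: "x \<in> \<Omega>" for x
  proof (cases "v x \<ge> w x")
    case True
    then show ?thesis
      by (intro subsolution_at_le_everywhere[OF perron_classD(4)[OF assms(2,1) x]]) simp_all
  next
    case False
    then show ?thesis
      by (intro subsolution_at_le_everywhere[OF perron_classD(4)[OF assms(3,1) x]]) simp_all
  qed
  show "max (v x) (w x) \<le> g x" if "x \<in> frontier \<Omega>" for x
    using perron_classD(3)[OF assms(2) that] perron_classD(3)[OF assms(3) that] by simp
qed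

section \<open>Perron's method\<close>

lemma perron_boundary:
  fixes \<Omega> :: "'a::euclidean_space set"
  assumes r: "r \<ge> 0" and \<Omega>: "open \<Omega>" "bounded \<Omega>" and g: "continuous_on (frontier \<Omega>) g"
    and y: "y \<in> frontier \<Omega>" and cone: "exterior_cone_at \<theta> \<rho> \<Omega> y" and \<epsilon>: "\<epsilon> > 0"
  shows "\<exists>\<tau>>0. \<exists>b\<in>perron_class r \<Omega> g. \<exists>N. (\<forall>x\<in>closure \<Omega>. dist x y < \<tau> \<longrightarrow> g y - \<epsilon> \<le> b x) \<and>
    (\<forall>v\<in>perron_class r \<Omega> g. \<forall>x\<in>closure \<Omega>. v x \<le> N \<and> (dist x y < \<tau> \<longrightarrow> v x \<le> g y + \<epsilon>))"
proof -
  have "compact (frontier \<Omega>)" using \<Omega> by (simp add: compact_frontier_bounded)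
  then have "bounded (g ` frontier \<Omega>)" using g by (intro compact_imp_bounded compact_continuous_image)
  then obtain G where G: "G > 0" "\<And>x. x \<in> frontier \<Omega> \<Longrightarrow> \<bar>g x\<bar> \<le> G" unfolding bounded_pos by auto
  have "bounded (closure \<Omega>)" using \<Omega> bounded_closure by blast
  then obtain R where R: "R > 0" "\<And>x. x \<in> closure \<Omega> \<Longrightarrow> norm x \<le> R" unfolding bounded_pos by auto
  have \<epsilon>2: "\<epsilon> / 2 > 0" using \<epsilon> by simp
  obtain \<delta> where \<delta>: "\<delta> > 0" "\<And>x. x \<in> frontier \<Omega> \<Longrightarrow> dist x y < \<delta> \<Longrightarrow> dist (g x) (g y) < \<epsilon> / 2"
    using g y \<epsilon>2 unfolding continuous_on_iff by meson
  have \<theta>: "0 < \<theta>" "\<theta> < pi / 2" "0 < \<rho>" using cone unfolding exterior_cone_at_def by auto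
  have "2 * R \<ge> 0" "2 * G \<ge> 0" using R G by auto
  from boundary_control[OF r \<theta> this(1) \<delta>(1) this(2) \<epsilon>2]
  obtain N \<tau> where \<tau>: "\<tau> > 0" and bc: "\<And>(\<Omega>::'a set) g y.
    open \<Omega> \<and> (\<forall>x\<in>closure \<Omega>. dist x y \<le> 2 * R) \<and> y \<in> frontier \<Omega> \<and> exterior_cone_at \<theta> \<rho> \<Omega> y \<and>
    (\<forall>x\<in>frontier \<Omega>. \<bar>g x - g y\<bar> \<le> 2 * G \<and> (dist x y < \<delta> \<longrightarrow> \<bar>g x - g y\<bar> \<le> \<epsilon> / 2)) \<Longrightarrow>
    (\<exists>W. continuous_on (closure \<Omega>) W \<and> viscosity_supersolution r \<Omega> W \<and>
      (\<forall>x\<in>frontier \<Omega>. \<bar>g x - g y\<bar> \<le> W x + \<epsilon> / 2) \<and>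
      (\<forall>x\<in>closure \<Omega>. W x \<le> N \<and> (dist x y < \<tau> \<longrightarrow> W x \<le> \<epsilon> / 2)))"
    by blast
  have "dist x y \<le> 2 * R" if "x \<in> closure \<Omega>" for x
    using R(2)[OF that] R(2)[OF frontier_imp_closure[OF y]] norm_triangle_ineq4[of x y] by (simp add: dist_norm)
  moreover have "\<bar>g x - g y\<bar> \<le> 2 * G" if "x \<in> frontier \<Omega>" for x
    using G(2)[OF that] G(2)[OF y] by linarith
  moreover have "\<bar>g x - g y\<bar> \<le> \<epsilon> / 2" if "x \<in> frontier \<Omega>" "dist x y < \<delta>" for x
    using \<delta>(2)[OF that] by (simp add: dist_real_def)
  ultimately obtain W where W: "continuous_on (closure \<Omega>) W" "viscosity_supersolution r \<Omega> W"
      "\<And>x. x \<in> frontier \<Omega> \<Longrightarrow> \<bar>g x - g y\<bar> \<le> W x + \<epsilon> / 2"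
      "\<And>x. x \<in> closure \<Omega> \<Longrightarrow> W x \<le> N \<and> (dist x y < \<tau> \<longrightarrow> W x \<le> \<epsilon> / 2)"
    using bc[of \<Omega> y g] \<Omega> y cone by blast
  have "(\<lambda>x. (g y - \<epsilon> / 2) - W x) \<in> perron_class r \<Omega> g" by (rule lower_barrier[OF r \<Omega>(1) W(1-3)])
  moreover have "g y - \<epsilon> \<le> (g y - \<epsilon> / 2) - W x" if "x \<in> closure \<Omega>" "dist x y < \<tau>" for x
    using W(4)[OF that(1)] that(2) by auto
  moreover have "v x \<le> g y + \<epsilon> / 2 + N \<and> (dist x y < \<tau> \<longrightarrow> v x \<le> g y + \<epsilon>)"
    if v: "v \<in> perron_class r \<Omega> g" and x: "x \<in> closure \<Omega>" for v x
  proof -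
    have "v x \<le> g y + \<epsilon> / 2 + W x"
      by (rule upper_estimate[OF r \<Omega> perron_classD(1,2)[OF v] perron_classD(3)[OF v] W(1,2,3) x])
    then show ?thesis using W(4)[OF x] by auto
  qed
  ultimately show ?thesis
    using \<tau> by (intro exI[of _ \<tau>] conjI bexI[of _ "\<lambda>x. (g y - \<epsilon> / 2) - W x"] exI[of _ "g y + \<epsilon> / 2 + N"]) auto
qed

lemma perron_class_finite_max:
  assumes "open \<Omega>" "finite F" "F \<noteq> {}" "\<And>y. y \<in> F \<Longrightarrow> B y \<in> perron_class r \<Omega> g"
  shows "\<exists>b\<in>perron_class r \<Omega> g. \<forall>y\<in>F. \<forall>x. B y x \<le> b x"
  using assms(2-4)
proof (induction F rule: finite_ne_induct)
  case (singleton y)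
  then show ?case by blast
next
  case (insert y F)
  then obtain b where b: "b \<in> perron_class r \<Omega> g" "\<forall>y\<in>F. \<forall>x. B y x \<le> b x" by blast
  show ?case
    by (rule bexI[OF _ perron_class_max[OF assms(1) b(1) insert.prems[of y]]])
      (use b(2) in \<open>auto simp: le_max_iff_disj\<close>)
qed

text \<open>A single member \<open>b\<close> for all boundary points is needed, because \<open>perron_class_shift\<close> glues with one
function; compactness and the closure of the class under maxima provide it.\<close>

lemma perron_boundary_uniform:
  fixes \<Omega> :: "'a::euclidean_space set"
  assumes r: "r \<ge> 0" and \<Omega>: "open \<Omega>" "bounded \<Omega>" "frontier \<Omega> \<noteq> {}" and g: "continuous_on (frontier \<Omega>) g"
    and cone: "exterior_cone_condition \<Omega>" and \<epsilon>: "\<epsilon> > 0"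
  shows "\<exists>\<tau>>0. \<exists>b\<in>perron_class r \<Omega> g. \<forall>y\<in>frontier \<Omega>. \<forall>x\<in>closure \<Omega>. dist x y < \<tau> \<longrightarrow>
    g y - \<epsilon> \<le> b x \<and> (\<forall>v\<in>perron_class r \<Omega> g. v x \<le> g y + \<epsilon>)"
proof -
  have \<epsilon>2: "\<epsilon> / 2 > 0" using \<epsilon> by simp
  define Q where "Q y t b \<longleftrightarrow> 0 < t \<and> b \<in> perron_class r \<Omega> g \<and> (\<forall>x\<in>closure \<Omega>. dist x y < t \<longrightarrow> g y - \<epsilon> / 2 \<le> b x \<and>
      (\<forall>v\<in>perron_class r \<Omega> g. v x \<le> g y + \<epsilon> / 2)) \<and> (\<forall>x\<in>frontier \<Omega>. dist x y < t \<longrightarrow> \<bar>g x - g y\<bar> < \<epsilon> / 2)"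
    for y t b
  have "\<exists>t b. Q y t b" if y: "y \<in> frontier \<Omega>" for y
  proof -
    obtain \<theta> \<rho> where "exterior_cone_at \<theta> \<rho> \<Omega> y" using cone y unfolding exterior_cone_condition_def by blast
    from perron_boundary[OF r \<Omega>(1,2) g y this \<epsilon>2] obtain \<tau> b where b: "\<tau> > 0" "b \<in> perron_class r \<Omega> g"
      "\<And>x. x \<in> closure \<Omega> \<Longrightarrow> dist x y < \<tau> \<Longrightarrow> g y - \<epsilon> / 2 \<le> b x"
      "\<And>v x. v \<in> perron_class r \<Omega> g \<Longrightarrow> x \<in> closure \<Omega> \<Longrightarrow> dist x y < \<tau> \<Longrightarrow> v x \<le> g y + \<epsilon> / 2" by blast
    obtain \<delta> where \<delta>: "\<delta> > 0" "\<And>x. x \<in> frontier \<Omega> \<Longrightarrow> dist x y < \<delta> \<Longrightarrow> dist (g x) (g y) < \<epsilon> / 2"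
      using g y \<epsilon>2 unfolding continuous_on_iff by meson
    have "Q y (min \<tau> \<delta>) b"
      unfolding Q_def using b \<delta> by (auto simp: dist_real_def)
    then show ?thesis by blast
  qed
  then obtain t B where QtB: "\<And>y. y \<in> frontier \<Omega> \<Longrightarrow> Q y (t y) (B y)" by metis
  have tB: "\<And>y. y \<in> frontier \<Omega> \<Longrightarrow> 0 < t y" "\<And>y. y \<in> frontier \<Omega> \<Longrightarrow> B y \<in> perron_class r \<Omega> g"
    "\<And>y x. y \<in> frontier \<Omega> \<Longrightarrow> x \<in> closure \<Omega> \<Longrightarrow> dist x y < t y \<Longrightarrow> g y - \<epsilon> / 2 \<le> B y x"
    "\<And>y x v. y \<in> frontier \<Omega> \<Longrightarrow> x \<in> closure \<Omega> \<Longrightarrow> dist x y < t y \<Longrightarrow> v \<in> perron_class r \<Omega> g \<Longrightarrow> v x \<le> g y + \<epsilon> / 2"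
    "\<And>y x. y \<in> frontier \<Omega> \<Longrightarrow> x \<in> frontier \<Omega> \<Longrightarrow> dist x y < t y \<Longrightarrow> \<bar>g x - g y\<bar> < \<epsilon> / 2"
    using QtB unfolding Q_def by blast+
  have "compact (frontier \<Omega>)" using \<Omega> by (simp add: compact_frontier_bounded)
  then obtain F where F: "F \<subseteq> frontier \<Omega>" "finite F" "frontier \<Omega> \<subseteq> (\<Union>y\<in>F. ball y (t y / 2))"
    by (rule compactE_image[where C="frontier \<Omega>" and f="\<lambda>y. ball y (t y / 2)"]) (use tB(1) in force)+
  have Fne: "F \<noteq> {}" using F(3) \<Omega>(3) by auto
  obtain b where b: "b \<in> perron_class r \<Omega> g" "\<forall>y\<in>F. \<forall>x. B y x \<le> b x"
    using perron_class_finite_max[OF \<Omega>(1) F(2) Fne, of B r g] tB(2) F(1) by blast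
  define \<tau> where "\<tau> = Min ((\<lambda>y. t y / 2) ` F)"
  have \<tau>: "\<tau> > 0" "\<And>y. y \<in> F \<Longrightarrow> \<tau> \<le> t y / 2"
  proof -
    show "\<tau> > 0" unfolding \<tau>_def using F Fne tB(1) by (subst Min_gr_iff) auto
    show "\<tau> \<le> t y / 2" if "y \<in> F" for y unfolding \<tau>_def using F(2) that by (intro Min_le) auto
  qed
  have "g y - \<epsilon> \<le> b x \<and> (\<forall>v\<in>perron_class r \<Omega> g. v x \<le> g y + \<epsilon>)"
    if y: "y \<in> frontier \<Omega>" and x: "x \<in> closure \<Omega>" and xy: "dist x y < \<tau>" for x y
  proof -
    obtain z where z: "z \<in> F" "dist y z < t z / 2" using F(3) y by (auto simp: dist_commute)
    then have zf: "z \<in> frontier \<Omega>" using F(1) by blast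
    have xz: "dist x z < t z" using dist_triangle[of x z y] xy z \<tau>(2)[OF z(1)] by linarith
    have yz: "\<bar>g y - g z\<bar> < \<epsilon> / 2" using tB(5)[OF zf y] z(2) tB(1)[OF zf] by simp
    have "g y - \<epsilon> \<le> b x" using tB(3)[OF zf x xz] b(2) z(1) yz by (smt (verit) field_sum_of_halves)
    moreover have "v x \<le> g y + \<epsilon>" if "v \<in> perron_class r \<Omega> g" for v
      using tB(4)[OF zf x xz that] yz by (smt (verit) field_sum_of_halves)
    ultimately show ?thesis by blast
  qed
  then show ?thesis using \<tau>(1) b(1) by blast
qed

text \<open>The new member is the maximum of \<open>v\<close>, \<open>b\<close> and the lowered translate, as far as the latter is
defined. Near a boundary point \<open>y\<close> all members are at most \<open>g y + \<epsilon>\<close> while \<open>b\<close> is at least \<open>g y - \<epsilon>\<close>.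
Hence lowering by \<open>3 \<epsilon>\<close> makes the translate inactive where \<open>x\<close> or \<open>x + h\<close> is a boundary point, and the
pieces fit together.\<close>

lemma perron_class_shift:
  fixes \<Omega> :: "'a::euclidean_space set"
  assumes \<Omega>: "open \<Omega>" and b: "b \<in> perron_class r \<Omega> g"
    and bd: "\<And>y x. y \<in> frontier \<Omega> \<Longrightarrow> x \<in> closure \<Omega> \<Longrightarrow> dist x y < \<tau> \<Longrightarrow>
      g y - \<epsilon> \<le> b x \<and> (\<forall>v\<in>perron_class r \<Omega> g. v x \<le> g y + \<epsilon>)"
    and \<epsilon>: "\<epsilon> > 0" and h: "norm h < \<tau>" and v: "v \<in> perron_class r \<Omega> g"
  shows "\<exists>w\<in>perron_class r \<Omega> g. \<forall>x\<in>closure \<Omega>. x + h \<in> closure \<Omega> \<longrightarrow> v (x + h) - 3 * \<epsilon> \<le> w x"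
proof -
  define v' where "v' = (\<lambda>x. max (v x) (b x))"
  have v': "v' \<in> perron_class r \<Omega> g" unfolding v'_def by (rule perron_class_max[OF \<Omega> v b])
  have v'b: "b x \<le> v' x" "v x \<le> v' x" for x by (auto simp: v'_def)
  \<comment> \<open>the part of the closed domain where the translate is defined, and the closure of the rest\<close>
  define D where "D = {x \<in> closure \<Omega>. x + h \<in> closure \<Omega>}"
  define E where "E = closure (closure \<Omega> - D)"
  have Dcl: "closed D"
  proof -
    have "D = closure \<Omega> \<inter> (\<lambda>x. x + h) -` closure \<Omega>" by (auto simp: D_def)
    then show ?thesis by (auto intro!: closed_Int closed_vimage continuous_intros)
  qed
  have E: "closed E" "E \<subseteq> closure \<Omega>" "closure \<Omega> = D \<union> E"
    unfolding E_def using closure_minimal[of "closure \<Omega> - D" "closure \<Omega>"] closure_subset[of "closure \<Omega> - D"]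
    by (auto simp: D_def)
  define w where "w = (\<lambda>x. if x \<in> D then max (v' x) (v' (x + h) - 3 * \<epsilon>) else v' x)"
  have wv': "v' x \<le> w x" for x by (auto simp: w_def)
  have fr1: "w x = v' x" if x: "x \<in> frontier \<Omega>" for x
  proof (cases "x \<in> D")
    case True
    then have "x + h \<in> closure \<Omega>" by (simp add: D_def)
    then have "v' (x + h) \<le> g x + \<epsilon>" using bd[OF x, of "x + h"] h v' by (simp add: dist_norm)
    moreover have "g x - \<epsilon> \<le> b x"
      using bd[OF x frontier_imp_closure[OF x]] h norm_ge_zero[of h] by (auto intro: le_less_trans)
    ultimately have "v' (x + h) - 3 * \<epsilon> \<le> v' x" using v'b(1)[of x] \<epsilon> by linarith
    then show ?thesis by (simp add: w_def)
  qed (simp add: w_def)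
  have fr2: "v' (x + h) - 3 * \<epsilon> \<le> v' x" if x: "x \<in> closure \<Omega>" "x + h \<in> frontier \<Omega>" for x
  proof -
    have "v' (x + h) \<le> g (x + h)" using perron_classD(3)[OF v'] x by blast
    moreover have "g (x + h) - \<epsilon> \<le> b x" using bd[OF x(2,1)] h by (simp add: dist_norm)
    ultimately show ?thesis using v'b(1)[of x] \<epsilon> by linarith
  qed
  have "w \<in> perron_class r \<Omega> g"
  proof (rule perron_classI)
    have v'c: "continuous_on (closure \<Omega>) v'" by (rule perron_classD(1)[OF v'])
    have "continuous_on (D \<union> E) (\<lambda>x. if x \<in> D then max (v' x) (v' (x + h) - 3 * \<epsilon>) else v' x)"
    proof (rule continuous_on_cases[OF Dcl E(1)])
      show "continuous_on D (\<lambda>x. max (v' x) (v' (x + h) - 3 * \<epsilon>))"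
        by (intro continuous_on_max continuous_intros continuous_on_subset[OF v'c] continuous_on_compose2[OF v'c])
          (auto simp: D_def)
      show "continuous_on E v'" by (rule continuous_on_subset[OF v'c E(2)])
      show "\<forall>x. x \<in> D \<and> \<not> x \<in> D \<or> x \<in> E \<and> x \<in> D \<longrightarrow> max (v' x) (v' (x + h) - 3 * \<epsilon>) = v' x"
      proof (intro allI impI)
        fix x assume "x \<in> D \<and> \<not> x \<in> D \<or> x \<in> E \<and> x \<in> D"
        then have x: "x \<in> E" "x \<in> D" by auto
        have "x + h \<in> closure (- \<Omega>)"
        proof -
          have "E \<subseteq> (\<lambda>x. x + h) -` closure (- \<Omega>)"
            unfolding E_def
          proof (rule closure_minimal)
            show "closed ((\<lambda>x. x + h) -` closure (- \<Omega>))" by (auto intro!: closed_vimage continuous_intros)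
            show "closure \<Omega> - D \<subseteq> (\<lambda>x. x + h) -` closure (- \<Omega>)"
              using closure_subset[of \<Omega>] closure_subset[of "- \<Omega>"] by (auto simp: D_def)
          qed
          then show ?thesis using x(1) by auto
        qed
        then have "x + h \<in> frontier \<Omega>" using x(2) by (simp add: frontier_closures D_def)
        then show "max (v' x) (v' (x + h) - 3 * \<epsilon>) = v' x" using fr2[of x] x(2) by (simp add: D_def)
      qed
    qed
    then show "continuous_on (closure \<Omega>) w" unfolding w_def E(3)[symmetric] .
    show "w x \<le> g x" if "x \<in> frontier \<Omega>" for x
      using fr1[OF that] perron_classD(3)[OF v' that] by simp
    show "subsolution_at r w x" if x: "x \<in> \<Omega>" for x
    proof (cases "w x = v' x")
      case True
      then show ?thesis 
        by (intro subsolution_at_le_everywhere[OF perron_classD(4)[OF v' \<Omega> x]] wv') simp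
    next
      case False
      then have xD: "x \<in> D" and wx: "w x = v' (x + h) - 3 * \<epsilon>" "v' x < v' (x + h) - 3 * \<epsilon>"
        by (auto simp: w_def max_def split: if_splits)
      have xh: "x + h \<in> \<Omega>"
      proof (rule ccontr)
        assume "x + h \<notin> \<Omega>"
        then have "x + h \<in> frontier \<Omega>" using xD \<Omega> by (simp add: frontier_def D_def interior_open)
        then show False using fr2[of x] xD wx(2) by (auto simp: D_def)
      qed
      have "filterlim (\<lambda>y. y + h) (nhds (x + h)) (nhds x)"
        by (intro tendsto_add filterlim_ident tendsto_const)
      moreover have "\<forall>\<^sub>F y in nhds (x + h). y \<in> \<Omega>" using \<Omega> xh eventually_nhds by blast
      ultimately have "\<forall>\<^sub>F y in nhds x. y + h \<in> \<Omega>" by (rule eventually_compose_filterlim[rotated])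
      moreover have "\<forall>\<^sub>F y in nhds x. y \<in> \<Omega>" using \<Omega> x eventually_nhds by blast
      ultimately have "\<forall>\<^sub>F y in nhds x. v' (y + h) + - (3 * \<epsilon>) \<le> w y"
      proof eventually_elim
        case (elim y)
        then have "y \<in> D" using closure_subset by (auto simp: D_def)
        then show ?case by (simp add: w_def)
      qed
      then show ?thesis
        by (rule subsolution_at_le[OF subsolution_at_shift[OF perron_classD(4)[OF v' \<Omega> xh]], rotated]) (simp add: wx(1))
    qed
  qed
  moreover have "v (x + h) - 3 * \<epsilon> \<le> w x" if "x \<in> closure \<Omega>" "x + h \<in> closure \<Omega>" for x
    using that v'b(2)[of "x + h"] by (auto simp: w_def D_def le_max_iff_disj)
  ultimately show ?thesis by blast
qed

lemma continuous_on_pde_op: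
  fixes \<phi> :: "'a::euclidean_space \<Rightarrow> real"
  shows "smooth_on S \<phi> \<Longrightarrow> continuous_on S (pde_op r \<phi>)"
  unfolding pde_op_def[abs_def] using smooth_on_continuous_grad_lap
  by (intro continuous_on_min continuous_intros) blast+

lemma smooth_on_add_paraboloid:
  fixes \<phi> :: "'a::euclidean_space \<Rightarrow> real" and \<kappa> c :: real
  assumes \<phi>: "smooth_on (ball x0 \<rho>) \<phi>"
  defines "\<psi> \<equiv> \<lambda>x. \<phi> x + (\<kappa> * ((x + - x0) \<bullet> (x + - x0)) + c)"
  shows "smooth_on (ball x0 \<rho>) \<psi>"
    "\<rho> > 0 \<Longrightarrow> pde_op r \<psi> x0 = min (- laplacian \<phi> x0 - 2 * \<kappa> * DIM('a) - r) (norm (grad \<phi> x0) - 1)"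
proof -
  show "smooth_on (ball x0 \<rho>) \<psi>"
    unfolding \<psi>_def
    by (intro smooth_on_add smooth_on_cmult smooth_on_const open_ball \<phi>
        smooth_on_polynomial[OF real_polynomial_function_translate[OF polynomial_dot_self]])
  assume "\<rho> > 0"
  then have "has_grad_lap \<psi> x0 (grad \<phi> x0 + (\<kappa> *\<^sub>R (2 *\<^sub>R (x0 + - x0)) + 0)) (laplacian \<phi> x0 + (\<kappa> * (2 * DIM('a)) + 0))"
    unfolding \<psi>_def
    by (intro has_grad_lap_add has_grad_lap_cmult has_grad_lap_const has_grad_lap_translate[OF has_grad_lap_dot_self]
        smooth_on_has_grad_lap[OF open_ball \<phi>]) simp
  from has_grad_lap_unique[OF this]
  show "pde_op r \<psi> x0 = min (- laplacian \<phi> x0 - 2 * \<kappa> * DIM('a) - r) (norm (grad \<phi> x0) - 1)"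
    unfolding pde_op_def by simp
qed

text \<open>The operator only sees derivatives, so a test function may be shifted vertically until it touches.\<close>

lemma subsolution_test_const:
  fixes v \<psi> :: "'a::euclidean_space \<Rightarrow> real"
  assumes v: "subsolution_at r v x" and S: "open S" "x \<in> S" "smooth_on S \<psi>"
    and max: "\<And>y. y \<in> S \<Longrightarrow> v y - \<psi> y \<le> v x - \<psi> x"
  shows "pde_op r \<psi> x \<le> 0"
proof -
  obtain e where e: "e > 0" "ball x e \<subseteq> S" using S openE by blast
  define \<phi> where "\<phi> = (\<lambda>y. \<psi> y + (v x - \<psi> x))"
  have "smooth_on (ball x e) \<phi>"
    unfolding \<phi>_def by (intro smooth_on_add open_ball smooth_on_subset[OF S(3) e(2)] smooth_on_const)
  moreover have "\<forall>\<^sub>F y in nhds x. y \<in> S" using S eventually_nhds by blast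
  then have "\<forall>\<^sub>F y in nhds x. v y \<le> \<phi> y" by eventually_elim (use max in \<open>force simp: \<phi>_def\<close>)
  ultimately have "pde_op r \<phi> x \<le> 0" using v e(1) unfolding subsolution_at_def by (auto simp: \<phi>_def)
  moreover have "has_grad_lap \<phi> x (grad \<psi> x + 0) (laplacian \<psi> x + 0)"
    unfolding \<phi>_def by (intro has_grad_lap_add has_grad_lap_const smooth_on_has_grad_lap[OF S(1,3,2)])
  ultimately show ?thesis using has_grad_lap_unique unfolding pde_op_def by fastforce
qed

text \<open>A test function that violates the inequality at \<open>x0\<close>, made strict by a small paraboloid, still does
so nearby, and a member close to \<open>u\<close> at \<open>x0\<close> is touched by a vertical shift of it at a nearby point.\<close>

lemma perron_sup_subsolution:
  fixes u :: "'a::euclidean_space \<Rightarrow> real"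
  assumes \<Omega>: "open \<Omega>" and u: "continuous_on \<Omega> u"
    and ge: "\<And>v x. v \<in> perron_class r \<Omega> g \<Longrightarrow> x \<in> \<Omega> \<Longrightarrow> v x \<le> u x"
    and approx: "\<And>x \<eta>. x \<in> \<Omega> \<Longrightarrow> \<eta> > 0 \<Longrightarrow> \<exists>v\<in>perron_class r \<Omega> g. u x - \<eta> < v x"
  shows "viscosity_subsolution r \<Omega> u"
proof (rule subsolution_of_at[OF u])
  fix x0 assume x0: "x0 \<in> \<Omega>"
  show "subsolution_at r u x0"
    unfolding subsolution_at_def
  proof (intro allI impI)
    fix \<rho> \<phi>
    assume *: "0 < \<rho> \<and> smooth_on (ball x0 \<rho>) \<phi> \<and> u x0 = \<phi> x0 \<and> (\<forall>\<^sub>F y in nhds x0. u y \<le> \<phi> y)"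
    show "pde_op r \<phi> x0 \<le> 0"
    proof (rule ccontr)
      assume "\<not> pde_op r \<phi> x0 \<le> 0"
      then have pos: "- laplacian \<phi> x0 - r > 0" "norm (grad \<phi> x0) - 1 > 0" unfolding pde_op_def by auto
      define \<kappa> where "\<kappa> = (- laplacian \<phi> x0 - r) / (4 * DIM('a))"
      have n: "real DIM('a) > 0" by (simp add: DIM_positive)
      have \<kappa>: "\<kappa> > 0" "2 * \<kappa> * DIM('a) = (- laplacian \<phi> x0 - r) / 2" unfolding \<kappa>_def using pos n by auto
      define \<psi> where "\<psi> = (\<lambda>x. \<phi> x + (\<kappa> * ((x + - x0) \<bullet> (x + - x0)) + 0))"
      have \<psi>: "smooth_on (ball x0 \<rho>) \<psi>" "pde_op r \<psi> x0 > 0"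
      proof -
        show "smooth_on (ball x0 \<rho>) \<psi>" unfolding \<psi>_def by (rule smooth_on_add_paraboloid(1)) (use * in blast)
        have "pde_op r \<psi> x0 = min (- laplacian \<phi> x0 - 2 * \<kappa> * DIM('a) - r) (norm (grad \<phi> x0) - 1)"
          unfolding \<psi>_def by (rule smooth_on_add_paraboloid(2)[where \<rho>=\<rho>]) (use * in auto)
        moreover have "- laplacian \<phi> x0 - 2 * \<kappa> * DIM('a) - r = (- laplacian \<phi> x0 - r) / 2"
          unfolding \<kappa>(2) by (simp add: field_simps)
        ultimately show "pde_op r \<psi> x0 > 0" using pos by simp
      qed
      have "isCont (pde_op r \<psi>) x0"
        using continuous_on_pde_op[OF \<psi>(1)] * by (simp add: continuous_on_eq_continuous_at)
      then have "\<forall>\<^sub>F x in nhds x0. pde_op r \<psi> x > 0"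
        using \<psi>(2) by (simp add: isCont_def tendsto_at_iff_tendsto_nhds order_tendstoD(1))
      moreover have "\<forall>\<^sub>F x in nhds x0. x \<in> \<Omega>" using \<Omega> x0 eventually_nhds by blast
      moreover have "x0 \<in> ball x0 \<rho>" using * by simp
      then have "\<forall>\<^sub>F x in nhds x0. x \<in> ball x0 \<rho>" using eventually_nhds open_ball by blast
      moreover have "\<forall>\<^sub>F y in nhds x0. u y \<le> \<phi> y" using * by blast
      ultimately have "\<forall>\<^sub>F x in nhds x0. pde_op r \<psi> x > 0 \<and> x \<in> \<Omega> \<and> x \<in> ball x0 \<rho> \<and> u x \<le> \<phi> x"
        by eventually_elim blast
      then obtain s0 where s0: "s0 > 0"
        "\<And>x. dist x x0 < s0 \<Longrightarrow> pde_op r \<psi> x > 0 \<and> x \<in> \<Omega> \<and> x \<in> ball x0 \<rho> \<and> u x \<le> \<phi> x"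
        unfolding eventually_nhds_metric by blast
      define s where "s = s0 / 2"
      have s: "s > 0" "\<And>x. x \<in> cball x0 s \<Longrightarrow> pde_op r \<psi> x > 0 \<and> x \<in> \<Omega> \<and> x \<in> ball x0 \<rho> \<and> u x \<le> \<phi> x"
      proof -
        show "s > 0" using s0(1) by (simp add: s_def)
        fix x assume "x \<in> cball x0 s"
        then show "pde_op r \<psi> x > 0 \<and> x \<in> \<Omega> \<and> x \<in> ball x0 \<rho> \<and> u x \<le> \<phi> x"
          using s0(1) by (intro s0(2)) (auto simp: s_def dist_commute)
      qed
      obtain v where v: "v \<in> perron_class r \<Omega> g" "u x0 - \<kappa> * s\<^sup>2 < v x0"
        using approx[OF x0, of "\<kappa> * s\<^sup>2"] \<kappa>(1) s(1) by auto
      have sub1: "cball x0 s \<subseteq> \<Omega>" "cball x0 s \<subseteq> ball x0 \<rho>" using s(2) by blast+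
      have "continuous_on (cball x0 s) (\<lambda>x. v x - \<psi> x)"
        using perron_classD(1)[OF v(1)] smooth_on_continuous_grad_lap(3)[OF \<psi>(1)] sub1 closure_subset[of \<Omega>]
        by (intro continuous_on_diff) (blast intro: continuous_on_subset)+
      then obtain x1 where x1: "x1 \<in> cball x0 s" "\<And>y. y \<in> cball x0 s \<Longrightarrow> v y - \<psi> y \<le> v x1 - \<psi> x1"
        using continuous_attains_sup[OF compact_cball, of x0 s "\<lambda>x. v x - \<psi> x"] s(1) by auto
      have "dist x0 x1 \<noteq> s"
      proof
        assume d: "dist x0 x1 = s"
        have "v x1 - \<psi> x1 \<le> u x1 - \<phi> x1 - \<kappa> * s\<^sup>2"
          using ge[OF v(1), of x1] s(2)[OF x1(1)] d
          by (simp add: \<psi>_def dot_square_norm dist_norm norm_minus_commute)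
        also have "\<dots> \<le> - \<kappa> * s\<^sup>2" using s(2)[OF x1(1)] by simp
        also have "\<dots> < v x0 - \<psi> x0" using v(2) * by (simp add: \<psi>_def)
        also have "\<dots> \<le> v x1 - \<psi> x1" using x1(2)[of x0] s(1) by simp
        finally show False by simp
      qed
      then have x1b: "x1 \<in> ball x0 s" using x1(1) by auto
      have x1\<Omega>: "x1 \<in> \<Omega>" using s(2)[OF x1(1)] by blast
      have "pde_op r \<psi> x1 \<le> 0"
      proof (rule subsolution_test_const[OF perron_classD(4)[OF v(1) \<Omega> x1\<Omega>] open_ball x1b])
        show "smooth_on (ball x0 s) \<psi>" using smooth_on_subset[OF \<psi>(1)] sub1(2) ball_subset_cball by blast
        show "v y - \<psi> y \<le> v x1 - \<psi> x1" if "y \<in> ball x0 s" for y using x1(2)[of y] that by auto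
      qed
      then show False using s(2)[OF x1(1)] by simp
    qed
  qed
qed

text \<open>A violating test function from below can be raised a little in a small ball and still be a
subsolution there; gluing it into \<open>u\<close> gives a member of the class exceeding \<open>u\<close> at \<open>x0\<close>.\<close>

lemma perron_sup_supersolution:
  fixes u :: "'a::euclidean_space \<Rightarrow> real"
  assumes \<Omega>: "open \<Omega>" and u: "u \<in> perron_class r \<Omega> g"
    and ge: "\<And>v x. v \<in> perron_class r \<Omega> g \<Longrightarrow> x \<in> \<Omega> \<Longrightarrow> v x \<le> u x"
  shows "viscosity_supersolution r \<Omega> u"
  unfolding viscosity_supersolution_def
proof (intro conjI allI impI)
  have uc: "continuous_on (closure \<Omega>) u" by (rule perron_classD(1)[OF u])
  show "lsc_on \<Omega> u" by (rule continuous_on_imp_lsc_on[OF continuous_on_subset[OF uc closure_subset]])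
  fix x0 \<rho> \<phi>
  assume *: "0 < \<rho> \<and> ball x0 \<rho> \<subseteq> \<Omega> \<and> smooth_on (ball x0 \<rho>) \<phi> \<and> u x0 - \<phi> x0 = 0 \<and> (\<forall>x\<in>ball x0 \<rho>. u x0 - \<phi> x0 \<le> u x - \<phi> x)"
  show "0 \<le> pde_op r \<phi> x0"
  proof (rule ccontr)
    assume neg: "\<not> 0 \<le> pde_op r \<phi> x0"
    define a where "a = - laplacian \<phi> x0 - r"
    \<comment> \<open>The bump changes the Laplacian but not the gradient at \<open>x0\<close>; so its size is restricted only
      if the second-order inequality is the violated one.\<close>
    define \<kappa> where "\<kappa> = (if a < 0 then - a / (4 * DIM('a)) else 1)"
    have n: "real DIM('a) > 0" by (simp add: DIM_positive)
    have \<kappa>: "\<kappa> > 0" "min (a + 2 * \<kappa> * DIM('a)) (norm (grad \<phi> x0) - 1) < 0"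
    proof -
      show "\<kappa> > 0" using n by (simp add: \<kappa>_def divide_neg_pos)
      show "min (a + 2 * \<kappa> * DIM('a)) (norm (grad \<phi> x0) - 1) < 0"
      proof (cases "a < 0")
        case True
        then have "a + 2 * \<kappa> * DIM('a) = a / 2" using n by (simp add: \<kappa>_def)
        then show ?thesis using True by simp
      next
        case False
        then show ?thesis using neg unfolding pde_op_def a_def by auto
      qed
    qed
    define \<psi>0 where "\<psi>0 = (\<lambda>x. \<phi> x + (- \<kappa> * ((x + - x0) \<bullet> (x + - x0)) + 0))"
    have \<psi>0: "smooth_on (ball x0 \<rho>) \<psi>0" "pde_op r \<psi>0 x0 < 0"
    proof -
      show "smooth_on (ball x0 \<rho>) \<psi>0" unfolding \<psi>0_def by (rule smooth_on_add_paraboloid(1)) (use * in blast)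
      have "pde_op r \<psi>0 x0 = min (- laplacian \<phi> x0 - 2 * (- \<kappa>) * DIM('a) - r) (norm (grad \<phi> x0) - 1)"
        unfolding \<psi>0_def by (rule smooth_on_add_paraboloid(2)[where \<rho>=\<rho>]) (use * in auto)
      moreover have "- laplacian \<phi> x0 - 2 * (- \<kappa>) * DIM('a) - r = a + 2 * \<kappa> * DIM('a)" by (simp add: a_def)
      ultimately show "pde_op r \<psi>0 x0 < 0" using \<kappa>(2) by simp
    qed
    have "isCont (pde_op r \<psi>0) x0"
      using continuous_on_pde_op[OF \<psi>0(1)] * by (simp add: continuous_on_eq_continuous_at)
    then have "\<forall>\<^sub>F x in nhds x0. pde_op r \<psi>0 x < 0"
      using \<psi>0(2) by (simp add: isCont_def tendsto_at_iff_tendsto_nhds order_tendstoD(2))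
    moreover have "x0 \<in> ball x0 \<rho>" using * by simp
    then have "\<forall>\<^sub>F x in nhds x0. x \<in> ball x0 \<rho>" using eventually_nhds open_ball by blast
    ultimately have "\<forall>\<^sub>F x in nhds x0. pde_op r \<psi>0 x < 0 \<and> x \<in> ball x0 \<rho>" by eventually_elim blast
    then obtain s0 where s0: "s0 > 0" "\<And>x. dist x x0 < s0 \<Longrightarrow> pde_op r \<psi>0 x < 0 \<and> x \<in> ball x0 \<rho>"
      unfolding eventually_nhds_metric by blast
    define s where "s = s0 / 2"
    have s: "s > 0" "\<And>x. x \<in> cball x0 s \<Longrightarrow> pde_op r \<psi>0 x < 0 \<and> x \<in> ball x0 \<rho>"
    proof -
      show "s > 0" using s0(1) by (simp add: s_def)
      fix x assume "x \<in> cball x0 s"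
      then show "pde_op r \<psi>0 x < 0 \<and> x \<in> ball x0 \<rho>"
        using s0(1) by (intro s0(2)) (auto simp: s_def dist_commute)
    qed
    have sub1: "cball x0 s \<subseteq> ball x0 \<rho>" "cball x0 s \<subseteq> \<Omega>" using s(2) * by blast+
    define \<psi> where "\<psi> = (\<lambda>x. \<psi>0 x + \<kappa> * s\<^sup>2 / 2)"
    have \<psi>hgl: "has_grad_lap \<psi> x (grad \<psi>0 x + 0) (laplacian \<psi>0 x + 0)" if "x \<in> ball x0 \<rho>" for x
      unfolding \<psi>_def by (intro has_grad_lap_add has_grad_lap_const smooth_on_has_grad_lap[OF open_ball \<psi>0(1) that])
    define w where "w = (\<lambda>x. if x \<in> cball x0 s then max (u x) (\<psi> x) else u x)"
    have wu: "u x \<le> w x" for x by (simp add: w_def)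
    have "w \<in> perron_class r \<Omega> g"
    proof (rule perron_classI)
      have cl: "closure \<Omega> = cball x0 s \<union> (closure \<Omega> - ball x0 s)"
        using sub1(2) closure_subset[of \<Omega>] by auto
      have "continuous_on (cball x0 s \<union> (closure \<Omega> - ball x0 s)) (\<lambda>x. if x \<in> cball x0 s then max (u x) (\<psi> x) else u x)"
      proof (rule continuous_on_cases)
        show "continuous_on (cball x0 s) (\<lambda>x. max (u x) (\<psi> x))"
          unfolding \<psi>_def
          using smooth_on_continuous_grad_lap(3)[OF \<psi>0(1)] sub1 closure_subset[of \<Omega>] uc
          by (intro continuous_on_max continuous_on_add continuous_on_const) (blast intro: continuous_on_subset)+
        show "continuous_on (closure \<Omega> - ball x0 s) u" by (rule continuous_on_subset[OF uc]) auto
        show "\<forall>x. x \<in> cball x0 s \<and> \<not> x \<in> cball x0 s \<or> x \<in> closure \<Omega> - ball x0 s \<and> x \<in> cball x0 s \<longrightarrow> max (u x) (\<psi> x) = u x"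
        proof (intro allI impI)
          fix x assume "x \<in> cball x0 s \<and> \<not> x \<in> cball x0 s \<or> x \<in> closure \<Omega> - ball x0 s \<and> x \<in> cball x0 s"
          then have x: "dist x0 x = s" "x \<in> ball x0 \<rho>" using sub1 by auto
          have "\<psi> x = \<phi> x - \<kappa> * s\<^sup>2 / 2"
            using x(1) by (simp add: \<psi>_def \<psi>0_def dot_square_norm dist_norm norm_minus_commute)
          moreover have "\<phi> x \<le> u x" using * x(2) by force
          moreover have "\<kappa> * s\<^sup>2 / 2 \<ge> 0" using \<kappa>(1) by simp
          ultimately have "\<psi> x \<le> u x" by linarith
          then show "max (u x) (\<psi> x) = u x" by (rule max_absorb1)
        qed
      qed auto
      then show "continuous_on (closure \<Omega>) w" unfolding w_def cl[symmetric] .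
      show "w x \<le> g x" if "x \<in> frontier \<Omega>" for x
      proof -
        have "x \<notin> cball x0 s" using that sub1(2) \<Omega> by (auto simp: frontier_def interior_open)
        then show ?thesis using perron_classD(3)[OF u that] by (simp add: w_def)
      qed
      show "subsolution_at r w x" if x: "x \<in> \<Omega>" for x
      proof (cases "w x = u x")
        case True
        then show ?thesis 
          by (intro subsolution_at_le_everywhere[OF perron_classD(4)[OF u \<Omega> x]] wu) simp
      next
        case False
        then have xs: "x \<in> cball x0 s" and gt: "u x < \<psi> x" and wx: "w x = \<psi> x"
          by (auto simp: w_def max_def split: if_splits)
        have "dist x0 x \<noteq> s"
        proof
          assume d: "dist x0 x = s"
          have "\<psi> x = \<phi> x - \<kappa> * s\<^sup>2 / 2"
            using d by (simp add: \<psi>_def \<psi>0_def dot_square_norm dist_norm norm_minus_commute)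
          moreover have "x \<in> ball x0 \<rho>" using xs sub1(1) by blast
          then have "\<phi> x \<le> u x" using * by force
          moreover have "\<kappa> * s\<^sup>2 / 2 \<ge> 0" using \<kappa>(1) by simp
          ultimately show False using gt by linarith
        qed
        then have xb: "x \<in> ball x0 s" using xs by auto
        have "subsolution_at r \<psi> x"
        proof (rule subsolution_at_classical)
          show "has_grad_lap \<psi> x (grad \<psi>0 x + 0) (laplacian \<psi>0 x + 0)"
            using \<psi>hgl xs sub1(1) by blast
          show "- (laplacian \<psi>0 x + 0) \<le> r \<or> norm (grad \<psi>0 x + 0) \<le> 1"
            using s(2)[OF xs] unfolding pde_op_def by auto
        qed
        moreover have "\<forall>\<^sub>F y in nhds x. y \<in> ball x0 s" using xb eventually_nhds open_ball by blast
        then have "\<forall>\<^sub>F y in nhds x. \<psi> y \<le> w y" by eventually_elim (simp add: w_def)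
        ultimately show ?thesis using wx by (intro subsolution_at_le[of r \<psi> x w]) simp_all
      qed
    qed
    then have "w x0 \<le> u x0" using ge sub1(2) s(1) by (metis centre_in_cball less_imp_le subsetD)
    moreover have "w x0 \<ge> \<psi> x0" using s(1) by (simp add: w_def)
    moreover have "\<psi> x0 = \<phi> x0 + \<kappa> * s\<^sup>2 / 2" by (simp add: \<psi>_def \<psi>0_def)
    ultimately show False using * \<kappa>(1) s(1) by (smt (verit) divide_pos_pos mult_pos_pos zero_less_power)
  qed
qed

text \<open>The modulus of continuity of \<open>u\<close> is inherited from the family: each member has, after translation and
lowering by a constant, a member above it.\<close>

lemma dirichlet_problem_solvable:
  fixes \<Omega> :: "'a::euclidean_space set"
  assumes r: "r \<ge> 0" and \<Omega>: "bounded_domain \<Omega>" and cone: "exterior_cone_condition \<Omega>"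
    and g: "continuous_on (frontier \<Omega>) g"
  shows "\<exists>u. solves_dirichlet_problem r \<Omega> g u"
proof -
  have o: "open \<Omega>" "bounded \<Omega>" "\<Omega> \<noteq> {}" using \<Omega> unfolding bounded_domain_def by auto
  have fr: "frontier \<Omega> \<noteq> {}"
    using o not_bounded_UNIV frontier_eq_empty by metis
  let ?P = "perron_class r \<Omega> g"
  obtain y0 where y0: "y0 \<in> frontier \<Omega>" using fr by blast
  then obtain \<theta> \<rho> where "exterior_cone_at \<theta> \<rho> \<Omega> y0" using cone unfolding exterior_cone_condition_def by blast
  from perron_boundary[OF r o(1,2) g y0 this zero_less_one]
  obtain b0 N where b0: "b0 \<in> ?P" and N: "\<And>v x. v \<in> ?P \<Longrightarrow> x \<in> closure \<Omega> \<Longrightarrow> v x \<le> N" by blast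
  define u where "u x = (SUP v\<in>?P. v x)" for x
  have ge: "v x \<le> u x" if "v \<in> ?P" "x \<in> closure \<Omega>" for v x
    unfolding u_def using that N by (intro cSUP_upper) (auto simp: bdd_above_def)
  have le: "u x \<le> B" if "\<And>v. v \<in> ?P \<Longrightarrow> v x \<le> B" for x B
    unfolding u_def using b0 that by (intro cSUP_least) auto
  have approx: "\<exists>v\<in>?P. u x - \<eta> < v x" if "\<eta> > 0" for x \<eta>
  proof (rule ccontr)
    assume "\<not> ?thesis"
    then have "u x \<le> u x - \<eta>" by (intro le) (auto simp: not_less)
    then show False using that by simp
  qed
  note unif = perron_boundary_uniform[OF r o(1,2) fr g cone]
  have bdry: "u y = g y" if y: "y \<in> frontier \<Omega>" for y
  proof (rule antisym)
    show "u y \<le> g y" using perron_classD(3) y by (intro le) blast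
    show "g y \<le> u y"
    proof (rule field_le_epsilon)
      fix \<epsilon> :: real assume "\<epsilon> > 0"
      from unif[OF this] obtain \<tau> b where \<tau>: "\<tau> > 0" and b: "b \<in> ?P" and near: "\<forall>y\<in>frontier \<Omega>. \<forall>x\<in>closure \<Omega>. dist x y < \<tau> \<longrightarrow>
        g y - \<epsilon> \<le> b x \<and> (\<forall>v\<in>?P. v x \<le> g y + \<epsilon>)" by blast
      have "g y - \<epsilon> \<le> b y" using near y frontier_imp_closure[OF y] \<tau> by simp
      with b show "g y \<le> u y + \<epsilon>" using ge[of b y] frontier_imp_closure[OF y] by linarith
    qed
  qed
  have uc: "continuous_on (closure \<Omega>) u"
    unfolding continuous_on_iff
  proof (intro ballI allI impI)
    fix x and e :: real assume x: "x \<in> closure \<Omega>" and e: "e > 0"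
    define \<epsilon> where "\<epsilon> = e / 4"
    have \<epsilon>: "\<epsilon> > 0" using e by (simp add: \<epsilon>_def)
    from unif[OF this] obtain \<tau> b where \<tau>: "\<tau> > 0" "b \<in> ?P" "\<And>y x. y \<in> frontier \<Omega> \<Longrightarrow> x \<in> closure \<Omega> \<Longrightarrow> dist x y < \<tau> \<Longrightarrow>
      g y - \<epsilon> \<le> b x \<and> (\<forall>v\<in>?P. v x \<le> g y + \<epsilon>)" by blast
    have one: "u z \<le> u x + 3 * \<epsilon>" if xz: "x \<in> closure \<Omega>" "z \<in> closure \<Omega>" "dist z x < \<tau>" for x z
    proof (rule le)
      fix v assume v: "v \<in> ?P"
      have "norm (z - x) < \<tau>" using xz(3) by (simp add: dist_norm)
      from perron_class_shift[OF o(1) \<tau>(2,3) \<epsilon> this v] obtain w where w: "w \<in> ?P"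
        "\<forall>y\<in>closure \<Omega>. y + (z - x) \<in> closure \<Omega> \<longrightarrow> v (y + (z - x)) - 3 * \<epsilon> \<le> w y" by blast
      then have "v z - 3 * \<epsilon> \<le> w x" using xz by force
      then show "v z \<le> u x + 3 * \<epsilon>" using ge[OF w(1) xz(1)] by simp
    qed
    show "\<exists>d>0. \<forall>x'\<in>closure \<Omega>. dist x' x < d \<longrightarrow> dist (u x') (u x) < e"
    proof (intro exI[of _ \<tau>] conjI ballI impI \<tau>(1))
      fix x' assume x': "x' \<in> closure \<Omega>" "dist x' x < \<tau>"
      have "u x' \<le> u x + 3 * \<epsilon>" "u x \<le> u x' + 3 * \<epsilon>"
        using one[OF x x'] one[OF x'(1) x] x'(2) by (simp_all add: dist_commute)
      then show "dist (u x') (u x) < e" using e unfolding \<epsilon>_def dist_real_def by linarith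
    qed
  qed
  have ge': "v x \<le> u x" if "v \<in> ?P" "x \<in> \<Omega>" for v x using ge that closure_subset by blast
  have sub: "viscosity_subsolution r \<Omega> u"
    by (rule perron_sup_subsolution[OF o(1) continuous_on_subset[OF uc closure_subset], of r g])
      (use ge' approx in auto)
  then have "u \<in> ?P" unfolding perron_class_def using uc bdry by simp
  then have "viscosity_supersolution r \<Omega> u" using ge' by (rule perron_sup_supersolution[OF o(1)])
  then show ?thesis
    using uc sub bdry continuous_on_subset[OF uc closure_subset]
    unfolding solves_dirichlet_problem_def viscosity_solution_def by blast
qed

section \<open>Uniqueness and the modulus of continuity\<close>

lemma solves_dirichlet_problemD:
  assumes "solves_dirichlet_problem r \<Omega> g u"
  shows "continuous_on (closure \<Omega>) u" "viscosity_subsolution r \<Omega> u" "viscosity_supersolution r \<Omega> u"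
    "\<And>x. x \<in> frontier \<Omega> \<Longrightarrow> u x = g x"
  using assms unfolding solves_dirichlet_problem_def viscosity_solution_def by auto

lemma dirichlet_solutions_le:
  fixes \<Omega> :: "'a::euclidean_space set"
  assumes "r \<ge> 0" "open \<Omega>" "bounded \<Omega>" "solves_dirichlet_problem r \<Omega> g u" "solves_dirichlet_problem r \<Omega> g v"
    "x \<in> closure \<Omega>"
  shows "u x \<le> v x"
  using comparison[OF assms(1-3), of u v 0 x] solves_dirichlet_problemD[OF assms(4)]
    solves_dirichlet_problemD[OF assms(5)] assms(6) by auto

text \<open>The translate of \<open>u\<close> by \<open>h = z - x\<close> is compared with \<open>u\<close> on \<open>\<Omega> \<inter> (\<Omega> - h)\<close>. At each boundary point of that
set, one of the two points whose values are compared lies on the boundary of \<open>\<Omega>\<close>.\<close>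

lemma interior_modulus:
  fixes \<Omega> :: "'a::euclidean_space set"
  assumes r: "r \<ge> 0" and \<Omega>: "open \<Omega>" "bounded \<Omega>" and u: "continuous_on (closure \<Omega>) u"
    "viscosity_subsolution r \<Omega> u" "viscosity_supersolution r \<Omega> u"
    and bd: "\<And>y x. y \<in> frontier \<Omega> \<Longrightarrow> x \<in> closure \<Omega> \<Longrightarrow> dist x y < \<tau> \<Longrightarrow> \<bar>u x - u y\<bar> \<le> \<epsilon>"
    and x: "x \<in> closure \<Omega>" "z \<in> closure \<Omega>" "dist x z < \<tau>"
  shows "u z \<le> u x + \<epsilon>"
proof -
  define h where "h = z - x"
  have h: "norm h < \<tau>" "z = x + h" using x(3) by (simp_all add: h_def dist_norm norm_minus_commute)
  define \<Omega>' where "\<Omega>' = \<Omega> \<inter> (\<lambda>y. y + h) -` \<Omega>"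
  have \<Omega>': "open \<Omega>'" "bounded \<Omega>'" "\<Omega>' \<subseteq> \<Omega>"
    unfolding \<Omega>'_def using \<Omega> by (auto intro!: open_Int open_vimage continuous_intros bounded_Int)
  have clos: "y \<in> closure \<Omega> \<and> y + h \<in> closure \<Omega>" if "y \<in> closure \<Omega>'" for y
  proof -
    have "closure \<Omega>' \<subseteq> closure \<Omega> \<inter> (\<lambda>y. y + h) -` closure \<Omega>"
      using closure_subset[of \<Omega>]
      by (intro closure_minimal closed_Int closed_closure closed_vimage continuous_intros) (auto simp: \<Omega>'_def)
    then show ?thesis using that by blast
  qed
  have edge: "u (y + h) \<le> u y + \<epsilon>" if y: "y \<in> closure \<Omega>" "y + h \<in> closure \<Omega>" and n: "y \<notin> \<Omega> \<or> y + h \<notin> \<Omega>" for y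
  proof -
    have "y \<in> frontier \<Omega> \<or> y + h \<in> frontier \<Omega>" using y n \<Omega>(1) by (auto simp: frontier_def interior_open)
    then show ?thesis
    proof
      assume "y \<in> frontier \<Omega>"
      from bd[OF this y(2)] h show ?thesis by (simp add: dist_norm)
    next
      assume "y + h \<in> frontier \<Omega>"
      from bd[OF this y(1)] h show ?thesis by (simp add: dist_norm abs_le_iff)
    qed
  qed
  show ?thesis
  proof (cases "x \<in> \<Omega> \<and> z \<in> \<Omega>")
    case False
    then show ?thesis using edge[of x] x h by auto
  next
    case True
    have uh: "continuous_on (closure \<Omega>') (\<lambda>y. u (y + h) + 0)"
      by (intro continuous_intros continuous_on_compose2[OF u(1)]) (use clos in auto)
    have u': "continuous_on (closure \<Omega>') u"
      by (rule continuous_on_subset[OF u(1)]) (use clos in blast)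
    have "(\<lambda>y. u (y + h) + 0) x \<le> u x + \<epsilon>"
    proof (rule comparison[OF r \<Omega>'(1,2) uh u'])
      show "viscosity_subsolution r \<Omega>' (\<lambda>y. u (y + h) + 0)"
      proof (rule subsolution_of_at[OF continuous_on_subset[OF uh closure_subset]])
        fix y assume "y \<in> \<Omega>'"
        then have "y + h \<in> \<Omega>" by (simp add: \<Omega>'_def)
        from subsolution_at_shift[OF subsolution_imp_at[OF u(2) \<Omega>(1) this]]
        show "subsolution_at r (\<lambda>y. u (y + h) + 0) y" .
      qed
      show "viscosity_supersolution r \<Omega>' u"
        using u(3) \<Omega>'(3) continuous_on_imp_lsc_on[OF continuous_on_subset[OF u' closure_subset]]
        unfolding viscosity_supersolution_def by (meson subset_trans)
      show "u (y + h) + 0 \<le> u y + \<epsilon>" if "y \<in> frontier \<Omega>'" for y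
      proof -
        have "y \<notin> \<Omega>'" using that \<Omega>'(1) by (simp add: frontier_def interior_open)
        then show ?thesis using edge[of y] clos[OF frontier_imp_closure[OF that]] by (auto simp: \<Omega>'_def)
      qed
      show "x \<in> closure \<Omega>'" using True h closure_subset[of \<Omega>'] by (auto simp: \<Omega>'_def)
    qed
    then show ?thesis using h by simp
  qed
qed

text \<open>Applied to the pairs (distance of two points, difference of the values there) of all solutions.\<close>

lemma common_modulus:
  fixes T :: "(real \<times> real) set"
  assumes bound: "\<And>t s. (t, s) \<in> T \<Longrightarrow> s \<le> N" and nonneg: "\<And>t s. (t, s) \<in> T \<Longrightarrow> 0 \<le> t"
    and small: "\<And>\<epsilon>. \<epsilon> > 0 \<Longrightarrow> \<exists>\<tau>>0. \<forall>t s. (t, s) \<in> T \<and> t < \<tau> \<longrightarrow> s \<le> \<epsilon>"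
  shows "\<exists>\<omega>. modulus \<omega> \<and> (\<forall>t s. (t, s) \<in> T \<longrightarrow> s \<le> \<omega> t)"
proof -
  \<comment> \<open>The zero keeps the supremum meaningful when no pair is that close.\<close>
  define A where "A t = insert 0 {s. \<exists>t'. (t', s) \<in> T \<and> t' \<le> t}" for t
  define \<omega> where "\<omega> t = Sup (A t)" for t
  have bdd: "bdd_above (A t)" for t
    unfolding A_def using bound by (force simp: bdd_above_def intro!: exI[of _ "max 0 N"])
  have ne: "0 \<in> A t" for t by (simp add: A_def)
  have \<omega>0: "0 \<le> \<omega> t" for t unfolding \<omega>_def by (rule cSup_upper[OF ne bdd])
  have \<omega>\<epsilon>: "\<exists>\<tau>>0. \<forall>t<\<tau>. \<omega> t \<le> \<epsilon>" if "\<epsilon> > 0" for \<epsilon>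
  proof -
    obtain \<tau> where \<tau>: "\<tau> > 0" "\<And>t s. (t, s) \<in> T \<Longrightarrow> t < \<tau> \<Longrightarrow> s \<le> \<epsilon>" using small[OF \<open>\<epsilon> > 0\<close>] by blast
    have "\<omega> t \<le> \<epsilon>" if "t < \<tau>" for t
      unfolding \<omega>_def
    proof (rule cSup_least)
      show "A t \<noteq> {}" using ne by blast
      show "s \<le> \<epsilon>" if "s \<in> A t" for s
        using that \<open>t < \<tau>\<close> \<tau>(2) \<open>\<epsilon> > 0\<close> unfolding A_def by force
    qed
    then show ?thesis using \<tau>(1) by blast
  qed
  have "modulus \<omega>"
    unfolding modulus_def
  proof (intro conjI)
    have "\<omega> 0 \<le> 0"
    proof (rule field_le_epsilon)
      fix \<epsilon> :: real assume "\<epsilon> > 0"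
      then have "\<omega> 0 \<le> \<epsilon>" using \<omega>\<epsilon> by blast
      then show "\<omega> 0 \<le> 0 + \<epsilon>" by simp
    qed
    then show "\<omega> 0 = 0" using \<omega>0[of 0] by simp
    show "mono_on {0..} \<omega>"
    proof (rule mono_onI)
      fix t t' :: real assume "t \<le> t'"
      then show "\<omega> t \<le> \<omega> t'"
        unfolding \<omega>_def using ne by (intro cSup_subset_mono bdd) (auto simp: A_def)
    qed
    show "(\<omega> \<longlongrightarrow> 0) (at_right 0)"
    proof (rule tendstoI)
      fix e :: real assume "e > 0"
      then obtain \<tau> where \<tau>: "\<tau> > 0" "\<And>t. t < \<tau> \<Longrightarrow> \<omega> t \<le> e / 2" using \<omega>\<epsilon>[of "e / 2"] by auto
      then have "\<forall>t>0. t < \<tau> \<longrightarrow> dist (\<omega> t) 0 < e"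
        using \<omega>0 \<open>e > 0\<close> by (smt (verit) dist_0_norm dist_commute field_sum_of_halves real_norm_def)
      then show "\<forall>\<^sub>F t in at_right 0. dist (\<omega> t) 0 < e"
        unfolding eventually_at_right[OF zero_less_one] using \<tau>(1) by blast
    qed
  qed
  moreover have "s \<le> \<omega> t" if "(t, s) \<in> T" for t s
    unfolding \<omega>_def by (rule cSup_upper[OF _ bdd]) (use that in \<open>auto simp: A_def\<close>)
  ultimately show ?thesis by blast
qed

lemma uniform_boundary_estimate:
  fixes \<omega>\<^sub>g :: "real \<Rightarrow> real"
  assumes r: "r \<ge> 0" and \<theta>: "0 < \<theta>" "\<theta> < pi / 2" "0 < \<rho>" and d: "d \<ge> 0" and \<omega>: "modulus \<omega>\<^sub>g" and \<epsilon>: "\<epsilon> > 0"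
  shows "\<exists>N \<tau>. 0 < \<tau> \<and> (\<forall>(\<Omega>::'a::euclidean_space set) g u y x.
    bounded_domain \<Omega> \<and> diameter \<Omega> = d \<and> uniform_exterior_cone_condition \<theta> \<rho> \<Omega> \<and>
    has_modulus_on (frontier \<Omega>) g \<omega>\<^sub>g \<and> solves_dirichlet_problem r \<Omega> g u \<and> y \<in> frontier \<Omega> \<and> x \<in> closure \<Omega> \<longrightarrow>
    \<bar>u x - u y\<bar> \<le> N \<and> (dist x y < \<tau> \<longrightarrow> \<bar>u x - u y\<bar> \<le> \<epsilon>))"
proof -
  have \<epsilon>2: "\<epsilon> / 2 > 0" using \<epsilon> by simp
  have "\<omega>\<^sub>g d \<ge> 0" using \<omega> d unfolding modulus_def by (metis atLeast_iff mono_onD order_refl)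
  have "(\<omega>\<^sub>g \<longlongrightarrow> 0) (at_right 0)" using \<omega> unfolding modulus_def by blast
  then have "\<forall>\<^sub>F t in at_right 0. dist (\<omega>\<^sub>g t) 0 < \<epsilon> / 2" using \<epsilon>2 by (rule tendstoD)
  then obtain \<delta> where \<delta>: "\<delta> > 0" "\<And>t. 0 < t \<Longrightarrow> t < \<delta> \<Longrightarrow> dist (\<omega>\<^sub>g t) 0 < \<epsilon> / 2"
    unfolding eventually_at_right[OF zero_less_one] by blast
  have \<omega>small: "\<omega>\<^sub>g t \<le> \<epsilon> / 2" if "0 \<le> t" "t < \<delta>" for t
    using \<delta>(2)[of t] that \<epsilon>2 \<omega> unfolding modulus_def by (cases "t = 0") (auto simp: dist_real_def)
  from boundary_control[OF r \<theta> d \<delta>(1) \<open>\<omega>\<^sub>g d \<ge> 0\<close> \<epsilon>2]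
  obtain N \<tau> where \<tau>: "\<tau> > 0" and bc: "\<And>(\<Omega>::'a set) g y.
    open \<Omega> \<and> (\<forall>x\<in>closure \<Omega>. dist x y \<le> d) \<and> y \<in> frontier \<Omega> \<and> exterior_cone_at \<theta> \<rho> \<Omega> y \<and>
    (\<forall>x\<in>frontier \<Omega>. \<bar>g x - g y\<bar> \<le> \<omega>\<^sub>g d \<and> (dist x y < \<delta> \<longrightarrow> \<bar>g x - g y\<bar> \<le> \<epsilon> / 2)) \<Longrightarrow>
    (\<exists>W. continuous_on (closure \<Omega>) W \<and> viscosity_supersolution r \<Omega> W \<and>
      (\<forall>x\<in>frontier \<Omega>. \<bar>g x - g y\<bar> \<le> W x + \<epsilon> / 2) \<and>
      (\<forall>x\<in>closure \<Omega>. W x \<le> N \<and> (dist x y < \<tau> \<longrightarrow> W x \<le> \<epsilon> / 2)))"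
    by blast
  have "\<bar>u x - u y\<bar> \<le> N + \<epsilon> \<and> (dist x y < \<tau> \<longrightarrow> \<bar>u x - u y\<bar> \<le> \<epsilon>)"
    if *: "bounded_domain \<Omega> \<and> diameter \<Omega> = d \<and> uniform_exterior_cone_condition \<theta> \<rho> \<Omega> \<and>
    has_modulus_on (frontier \<Omega>) g \<omega>\<^sub>g \<and> solves_dirichlet_problem r \<Omega> g u \<and> y \<in> frontier \<Omega> \<and> x \<in> closure \<Omega>"
    for \<Omega> :: "'a set" and g u y x
  proof -
    have o: "open \<Omega>" "bounded \<Omega>" and y: "y \<in> frontier \<Omega>" and x: "x \<in> closure \<Omega>"
      using * unfolding bounded_domain_def by auto
    note u = solves_dirichlet_problemD[of r \<Omega> g u]
    have dd: "dist z y \<le> d" if "z \<in> closure \<Omega>" for z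
      using diameter_bounded_bound[of "closure \<Omega>" z y] that frontier_imp_closure[OF y] o *
      by (simp add: diameter_closure bounded_closure)
    have gd: "\<bar>g z - g y\<bar> \<le> \<omega>\<^sub>g (dist z y)" if "z \<in> frontier \<Omega>" for z
      using * that unfolding has_modulus_on_def by blast
    have "\<bar>g z - g y\<bar> \<le> \<omega>\<^sub>g d" if z: "z \<in> frontier \<Omega>" for z
    proof -
      have "\<omega>\<^sub>g (dist z y) \<le> \<omega>\<^sub>g d"
        using \<omega> dd[OF frontier_imp_closure[OF z]] d unfolding modulus_def by (intro mono_onD[of "{0..}" \<omega>\<^sub>g]) auto
      then show ?thesis using gd[OF z] by linarith
    qed
    moreover have "\<bar>g z - g y\<bar> \<le> \<epsilon> / 2" if z: "z \<in> frontier \<Omega>" "dist z y < \<delta>" for z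
      using gd[OF z(1)] \<omega>small[OF zero_le_dist z(2)] by linarith
    moreover have "exterior_cone_at \<theta> \<rho> \<Omega> y" using * unfolding uniform_exterior_cone_condition_def by blast
    ultimately obtain W where W: "continuous_on (closure \<Omega>) W" "viscosity_supersolution r \<Omega> W"
      "\<And>x. x \<in> frontier \<Omega> \<Longrightarrow> \<bar>g x - g y\<bar> \<le> W x + \<epsilon> / 2"
      "\<And>x. x \<in> closure \<Omega> \<Longrightarrow> W x \<le> N \<and> (dist x y < \<tau> \<longrightarrow> W x \<le> \<epsilon> / 2)"
      using bc[of \<Omega> y g] o(1) y dd by blast
    have "u x \<le> g y + \<epsilon> / 2 + W x"
      by (rule upper_estimate[OF r o u(1,2) _ W(1-3) x]) (use * u(4) in auto)
    moreover have "(g y - \<epsilon> / 2) - W x \<le> u x + 0"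
      using lower_barrier[OF r o(1) W(1-3)] *
      by (intro comparison[OF r o _ u(1) _ u(3) _ x]) (auto simp: perron_class_def u(4))
    moreover have "u y = g y" using u(4) * by blast
    ultimately have "\<bar>u x - u y\<bar> \<le> \<epsilon> / 2 + W x" by linarith
    then show ?thesis using W(4)[OF x] \<epsilon> by auto
  qed
  then show ?thesis using \<tau> by blast
qed

text \<open>If no configuration with these parameters exists the statement is void; otherwise the parameters
satisfy the inequalities that the barriers require.\<close>

lemma uniform_modulus:
  fixes \<omega>\<^sub>g :: "real \<Rightarrow> real"
  assumes r: "r \<ge> 0" and \<omega>: "modulus \<omega>\<^sub>g"
  shows "\<exists>\<omega>. modulus \<omega> \<and> (\<forall>(\<Omega>::'a::euclidean_space set) g u.
    bounded_domain \<Omega> \<and> diameter \<Omega> = d \<and> uniform_exterior_cone_condition \<theta> \<rho> \<Omega> \<and>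
    has_modulus_on (frontier \<Omega>) g \<omega>\<^sub>g \<and> solves_dirichlet_problem r \<Omega> g u \<longrightarrow> has_modulus_on (closure \<Omega>) u \<omega>)"
proof -
  define cfg where "cfg \<Omega> g u \<longleftrightarrow> bounded_domain \<Omega> \<and> diameter \<Omega> = d \<and> uniform_exterior_cone_condition \<theta> \<rho> \<Omega> \<and>
    has_modulus_on (frontier \<Omega>) g \<omega>\<^sub>g \<and> solves_dirichlet_problem r \<Omega> g u" for \<Omega> :: "'a set" and g u
  have fr: "\<exists>y. y \<in> frontier \<Omega>" if "cfg \<Omega> g u" for \<Omega> g u
    using that not_bounded_UNIV frontier_eq_empty unfolding cfg_def bounded_domain_def by (metis all_not_in_conv)
  show ?thesis
  proof (cases "\<exists>\<Omega> g u. cfg \<Omega> g u")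
    case False
    moreover have "modulus (\<lambda>_. 0)" by (simp add: modulus_def mono_on_def)
    ultimately show ?thesis unfolding cfg_def by blast
  next
    case True
    then obtain \<Omega>0 g0 u0 y0 where "cfg \<Omega>0 g0 u0" "y0 \<in> frontier \<Omega>0" using fr by blast
    then have \<theta>: "0 < \<theta>" "\<theta> < pi / 2" "0 < \<rho>" and d: "d \<ge> 0"
      unfolding cfg_def uniform_exterior_cone_condition_def exterior_cone_at_def bounded_domain_def
      using diameter_ge_0 by blast+
    note est = uniform_boundary_estimate[OF r \<theta> d \<omega>, where 'a='a]
    define T where "T = {(dist x z, \<bar>u x - u z\<bar>) | \<Omega> g u x z. cfg \<Omega> g u \<and> x \<in> closure \<Omega> \<and> z \<in> closure \<Omega>}"
    obtain N where N: "\<And>\<Omega> g u y x. cfg \<Omega> g u \<Longrightarrow> y \<in> frontier \<Omega> \<Longrightarrow> x \<in> closure \<Omega> \<Longrightarrow> \<bar>u x - u y\<bar> \<le> N"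
      using est[OF zero_less_one] unfolding cfg_def by blast
    have "\<exists>\<omega>. modulus \<omega> \<and> (\<forall>t s. (t, s) \<in> T \<longrightarrow> s \<le> \<omega> t)"
    proof (rule common_modulus)
      fix t s assume "(t, s) \<in> T"
      then obtain \<Omega> g u x z where 1: "t = dist x z" "s = \<bar>u x - u z\<bar>" "cfg \<Omega> g u" "x \<in> closure \<Omega>" "z \<in> closure \<Omega>"
        unfolding T_def by blast
      show "0 \<le> t" using 1 by simp
      obtain y where "y \<in> frontier \<Omega>" using fr[OF 1(3)] by blast
      from N[OF 1(3) this 1(4)] N[OF 1(3) this 1(5)] show "s \<le> 2 * N" using 1(2) by linarith
    next
      fix \<epsilon> :: real assume "\<epsilon> > 0"
      from est[OF this] obtain \<tau> where \<tau>: "\<tau> > 0"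
        "\<And>\<Omega> g u y x. cfg \<Omega> g u \<Longrightarrow> y \<in> frontier \<Omega> \<Longrightarrow> x \<in> closure \<Omega> \<Longrightarrow> dist x y < \<tau> \<Longrightarrow> \<bar>u x - u y\<bar> \<le> \<epsilon>"
        unfolding cfg_def by blast
      have "s \<le> \<epsilon>" if "(t, s) \<in> T" "t < \<tau>" for t s
      proof -
        obtain \<Omega> g u x z where 1: "t = dist x z" "s = \<bar>u x - u z\<bar>" "cfg \<Omega> g u" "x \<in> closure \<Omega>" "z \<in> closure \<Omega>"
          using \<open>(t, s) \<in> T\<close> unfolding T_def by blast
        have o: "open \<Omega>" "bounded \<Omega>" and u: "solves_dirichlet_problem r \<Omega> g u"
          using 1(3) unfolding cfg_def bounded_domain_def by auto
        note m = interior_modulus[OF r o solves_dirichlet_problemD(1,2,3)[OF u] \<tau>(2)[OF 1(3)]]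
        have "u z \<le> u x + \<epsilon>" "u x \<le> u z + \<epsilon>"
          using m[where x=x and z=z] m[where x=z and z=x] 1 \<open>t < \<tau>\<close> by (simp_all add: dist_commute)
        then show ?thesis using 1(2) by linarith
      qed
      then show "\<exists>\<tau>>0. \<forall>t s. (t, s) \<in> T \<and> t < \<tau> \<longrightarrow> s \<le> \<epsilon>" using \<tau>(1) by blast
    qed
    then obtain \<omega> where \<omega>: "modulus \<omega>" "\<And>t s. (t, s) \<in> T \<Longrightarrow> s \<le> \<omega> t" by blast
    have "has_modulus_on (closure \<Omega>) u \<omega>" if "cfg \<Omega> g u" for \<Omega> g u
      unfolding has_modulus_on_def
    proof (intro ballI \<omega>(2))
      show "(dist x y, \<bar>u x - u y\<bar>) \<in> T" if "x \<in> closure \<Omega>" "y \<in> closure \<Omega>" for x y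
        unfolding T_def using \<open>cfg \<Omega> g u\<close> that by blast
    qed
    then show ?thesis using \<omega>(1) unfolding cfg_def by blast
  qed
qed

theorem mainTheorem3:
  fixes r :: real
  assumes "r \<ge> 0"
  shows
    "(\<forall>(\<Omega> :: (real ^ 'n) set) g.
        bounded_domain \<Omega> \<and> exterior_cone_condition \<Omega> \<and> continuous_on (frontier \<Omega>) g \<longrightarrow>
        (\<exists>u. solves_dirichlet_problem r \<Omega> g u \<and>
             (\<forall>v. solves_dirichlet_problem r \<Omega> g v \<longrightarrow> (\<forall>x\<in>closure \<Omega>. v x = u x)))) \<and>
     (\<forall>d \<omega>\<^sub>g \<theta> \<rho>. modulus \<omega>\<^sub>g \<longrightarrow>
        (\<exists>\<omega>. modulus \<omega> \<and>
          (\<forall>(\<Omega> :: (real ^ 'n) set) g u.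
             bounded_domain \<Omega> \<and> diameter \<Omega> = d \<and> uniform_exterior_cone_condition \<theta> \<rho> \<Omega> \<and>
             continuous_on (frontier \<Omega>) g \<and> has_modulus_on (frontier \<Omega>) g \<omega>\<^sub>g \<and>
             solves_dirichlet_problem r \<Omega> g u \<longrightarrow>
             has_modulus_on (closure \<Omega>) u \<omega>)))"
proof (intro conjI allI impI)
  fix \<Omega> :: "(real ^ 'n) set" and g :: "real ^ 'n \<Rightarrow> real"
  assume *: "bounded_domain \<Omega> \<and> exterior_cone_condition \<Omega> \<and> continuous_on (frontier \<Omega>) g"
  then obtain u where u: "solves_dirichlet_problem r \<Omega> g u"
    using dirichlet_problem_solvable[OF assms] by blast
  have o: "open \<Omega>" "bounded \<Omega>" using * unfolding bounded_domain_def by auto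
  have "v x = u x" if "solves_dirichlet_problem r \<Omega> g v" "x \<in> closure \<Omega>" for v x
    using dirichlet_solutions_le[OF assms o u that] dirichlet_solutions_le[OF assms o that(1) u that(2)] by simp
  then show "\<exists>u. solves_dirichlet_problem r \<Omega> g u \<and>
      (\<forall>v. solves_dirichlet_problem r \<Omega> g v \<longrightarrow> (\<forall>x\<in>closure \<Omega>. v x = u x))"
    using u by blast
next
  fix d \<theta> \<rho> :: real and \<omega>\<^sub>g assume "modulus \<omega>\<^sub>g"
  from uniform_modulus[OF assms this, of d \<theta> \<rho>, where 'a="real ^ 'n"]
  show "\<exists>\<omega>. modulus \<omega> \<and>
      (\<forall>(\<Omega> :: (real ^ 'n) set) g u.
         bounded_domain \<Omega> \<and> diameter \<Omega> = d \<and> uniform_exterior_cone_condition \<theta> \<rho> \<Omega> \<and>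
         continuous_on (frontier \<Omega>) g \<and> has_modulus_on (frontier \<Omega>) g \<omega>\<^sub>g \<and>
         solves_dirichlet_problem r \<Omega> g u \<longrightarrow> has_modulus_on (closure \<Omega>) u \<omega>)"
    by blast
qed

end
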